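(* Let $(S_n)_{n\ge 1}$ be centered real random variables with $\sigma_n=\|S_n\|_{L^2}\in(0,\infty)$ and $\sigma_n\to\infty$. Let $(A_n)$ be a bounded real sequence and $(B_n)$ a sequence of positive numbers with $B_n=\sigma_n+O(1)$; set $W_n=(S_n-A_n)/B_n$ and $F_n(x)=\mathbb P(W_n\le x)$. Let $m\ge 2$ be an integer and suppose that $(S_n)$ satisfies the growth condition of order $m$ (defined in the context). Then there is a constant $C$ such that for all $n$ and all $x\in\mathbb R$, $$|F_n(x)-\Phi(x)|\le C\sigma_n^{-1}(1+|x|)^{-m}.$$ In particular, for every $p>1/m$, $\ \|F_n-\Phi\|_{L^p(dx)}=\left(\int_{\mathbb R}|F_n(x)-\Phi(x)|^p\,dx\right)^{1/p}=O(\sigma_n^{-1})$.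
   Context: $\Phi(x)=\frac1{\sqrt{2\pi}}\int_{-\infty}^x e^{-t^2/2}dt$ is the standard normal distribution function. Put $\Lambda_n(t)=\ln\mathbb E[e^{itS_n/\sigma_n}]+t^2/2$ (the branch of the logarithm with $\Lambda_n(0)=0$). Growth condition of order $m$ ($m\ge2$ an integer): for every $3\le j\le m+1$ there are constants $C_j,\varepsilon_j>0$, independent of $n$, such that for all $n$ the function $\Lambda_n$ is well defined and $j$ times differentiable on $[-\varepsilon_j\sigma_n,\varepsilon_j\sigma_n]$ and $$\sup_{t\in[-\varepsilon_j\sigma_n,\varepsilon_j\sigma_n]}|\Lambda_n^{(j)}(t)|\le C_j\sigma_n^{-(j-2)}.$$ *)

theory Defs
  imports "HOL-Probability.Probability" "HOL-Library.Landau_Symbols"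
begin

definition L2_norm_rv :: "'a measure \<Rightarrow> ('a \<Rightarrow> real) \<Rightarrow> real" where
  "L2_norm_rv M X = sqrt (LINT \<omega>|M. (X \<omega>)\<^sup>2)"

definition Phi :: "real \<Rightarrow> real" where
  "Phi = cdf std_normal_distribution"

lemma Phi_eq: "Phi x = 1 / sqrt (2 * pi) * (LBINT t:{..x}. exp (- t\<^sup>2 / 2))"
proof -
  have "Phi x = enn2real (\<integral>\<^sup>+ t. ennreal (std_normal_density t) * indicator {..x} t \<partial>lborel)"
    unfolding Phi_def cdf_def measure_def by (subst emeasure_density) auto
  also have "\<dots> = enn2real (\<integral>\<^sup>+ t. ennreal (indicator {..x} t * std_normal_density t) \<partial>lborel)"
    by (intro arg_cong[where f = enn2real] nn_integral_cong) (auto split: split_indicator)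
  also have "\<dots> = (LINT t|lborel. indicator {..x} t * std_normal_density t)"
    by (rule integral_eq_nn_integral[symmetric]) auto
  also have "\<dots> = (LINT t|lborel. 1 / sqrt (2 * pi) * (indicator {..x} t * exp (- t\<^sup>2 / 2)))"
    by (intro Bochner_Integration.integral_cong) (auto simp: std_normal_density_def)
  also have "\<dots> = 1 / sqrt (2 * pi) * (LBINT t:{..x}. exp (- t\<^sup>2 / 2))"
    by (simp add: set_lebesgue_integral_def)
  finally show ?thesis .
qed

text \<open>
  On an interval containing \<open>0\<close>, the branch of \<open>log \<circ> \<phi>\<close> vanishing at \<open>0\<close> is the
  continuous \<open>L\<close> below. It is unique there if it exists, and it exists precisely when
  \<open>\<phi>\<close> is continuous, has no zero on the interval, and \<open>\<phi> 0 = 1\<close>.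
\<close>

definition log_branch_on :: "real set \<Rightarrow> (real \<Rightarrow> complex) \<Rightarrow> (real \<Rightarrow> complex) \<Rightarrow> bool" where
  "log_branch_on I \<phi> L \<longleftrightarrow> continuous_on I L \<and> L 0 = 0 \<and> (\<forall>t\<in>I. exp (L t) = \<phi> t)"

text \<open>Derivatives at the endpoints of a closed interval \<open>I\<close> are one-sided.\<close>

definition nth_deriv_within :: "nat \<Rightarrow> real set \<Rightarrow> (real \<Rightarrow> complex) \<Rightarrow> real \<Rightarrow> complex" where
  "nth_deriv_within k I f = ((\<lambda>g t. vector_derivative g (at t within I)) ^^ k) f"

definition times_differentiable_on :: "nat \<Rightarrow> (real \<Rightarrow> complex) \<Rightarrow> real set \<Rightarrow> bool" where
  "times_differentiable_on j f I \<longleftrightarrow> (\<forall>k<j. nth_deriv_within k I f differentiable_on I)"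

text \<open>
  Sequences are indexed from \<open>1\<close>. Existence of \<open>L\<close> expresses that \<open>\<Lambda>\<^sub>n\<close> is well defined
  on the interval; \<open>\<Lambda>\<^sub>n\<close> is \<open>\<lambda>t. L t + t\<^sup>2 / 2\<close>. The supremum bound is stated
  pointwise, since \<open>SUP\<close> over an unbounded set of reals is unspecified.
\<close>

definition growth_condition :: "'a measure \<Rightarrow> (nat \<Rightarrow> 'a \<Rightarrow> real) \<Rightarrow> nat \<Rightarrow> bool" where
  "growth_condition M S m \<longleftrightarrow>
    (\<forall>j\<in>{3..m + 1}. \<exists>C>0. \<exists>\<epsilon>>0. \<forall>n\<ge>1.
      (let \<sigma> = L2_norm_rv M (S n);
           I = {- \<epsilon> * \<sigma> .. \<epsilon> * \<sigma>};
           \<phi> = (\<lambda>t. CLINT \<omega>|M. exp (\<i> * complex_of_real (t * S n \<omega> / \<sigma>)))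
       in \<exists>L. log_branch_on I \<phi> L \<and>
              (let \<Lambda> = (\<lambda>t. L t + complex_of_real (t\<^sup>2 / 2))
               in times_differentiable_on j \<Lambda> I \<and>
                  (\<forall>t\<in>I. norm (nth_deriv_within j I \<Lambda> t) \<le> C / \<sigma> ^ (j - 2)))))"

end

theory Submission imports Defs begin

text \<open>
  Write \<open>X\<close> for \<open>S\<^sub>n / \<sigma>\<^sub>n\<close> and \<open>T\<close> for a small multiple of \<open>\<sigma>\<^sub>n\<close>. On \<open>[- T, T]\<close> the growth condition
  bounds \<open>h = \<phi>\<^sub>X - exp (- t\<^sup>2 / 2)\<close> and its first \<open>m + 1\<close> derivatives by \<open>1 / \<sigma>\<^sub>n\<close> times a polynomial times
  \<open>exp (- t\<^sup>2 / 4)\<close>, because \<open>h\<close> solves the linear equation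
  \<open>h' = (\<Lambda>' - t) h + \<Lambda>' exp (- t\<^sup>2 / 2)\<close> with \<open>\<Lambda>, \<Lambda>', \<Lambda>''\<close> vanishing at \<open>0\<close>.

  Convolving with the probability density proportional to \<open>sinc (\<delta> y) ^ (2 N)\<close>, \<open>\<delta> \<sim> T\<close>, whose Fourier
  transform is a B-spline supported in \<open>[- T, T]\<close>, and integrating by parts \<open>m + 1\<close> times shows that the
  smoothed densities of \<open>X\<close> and of the normal law differ by \<open>O(1 / \<sigma>\<^sub>n) (1 + |z|) ^ (- m - 1)\<close>; hence the
  smoothed distribution functions differ by \<open>O(1 / \<sigma>\<^sub>n) (1 + |x|) ^ (- m)\<close>.

  The smoothing is removed by Esseen's argument in the weighted supremum norm. The weight
  \<open>(1 + |x|) ^ m\<close> is first truncated, so that the supremum is finite without knowing that \<open>X\<close> has moments;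
  the resulting bound does not depend on the truncation.
\<close>

text \<open>The obstacle: only second moments of \<open>X\<close> are given, and control of its
  characteristic function ends at \<open>T\<close>, yet decay of order \<open>m\<close> in
  \<open>x\<close> is claimed. A kernel with band-limited transform uses just this information. It
  acts on densities rather than distribution functions, because their Fourier formula has no factor
  \<open>1 / t\<close> and so no singularity at 0; the price is one extra power of decay, hence the
  \<open>m + 1\<close> derivatives, and the growth condition reaches exactly order
  \<open>m + 1\<close>. The exponent \<open>2 N\<close> serves three ends: being even it makes the
  kernel nonnegative, being large it gives a finite moment of order \<open>m\<close> and a transform
  smooth enough for the integrations by parts. Two errors of order
  \<open>1 / \<sigma>\<^sub>n\<close> remain, the size of \<open>h\<close> and the kernel width, of
  order \<open>1 / T\<close>. The zeros of \<open>\<Lambda>'\<close> and \<open>\<Lambda>''\<close>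
  at 0 encode mean 0 and variance 1. Passing from \<open>X\<close> to \<open>W\<^sub>n\<close>
  shifts the argument by \<open>O((1 + |x|) / \<sigma>\<^sub>n)\<close>, which the decay of the
  normal density absorbs.\<close>

subsection \<open>Functions with bounded derivatives\<close>

text \<open>
  The weight \<open>w\<close> may vanish at a point, which forces all derivatives up to order \<open>r\<close> to vanish there.
  This is how boundary terms disappear in the integration by parts below.
\<close>

fun derivs_bounded :: "nat \<Rightarrow> real set \<Rightarrow> (real \<Rightarrow> real) \<Rightarrow> (real \<Rightarrow> complex) \<Rightarrow> bool" where
  "derivs_bounded 0 I w a \<longleftrightarrow> (\<forall>t\<in>I. norm (a t) \<le> w t)"
| "derivs_bounded (Suc r) I w a \<longleftrightarrow> (\<forall>t\<in>I. norm (a t) \<le> w t) \<and>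
     (\<exists>a'. (\<forall>t\<in>I. (a has_vector_derivative a' t) (at t within I)) \<and> derivs_bounded r I w a')"

lemma derivs_bounded_norm: "derivs_bounded r I w a \<Longrightarrow> t \<in> I \<Longrightarrow> norm (a t) \<le> w t"
  by (cases r) auto

lemma derivs_bounded_mono:
  assumes "derivs_bounded r I w a" "s \<le> r" "J \<subseteq> I" "\<And>t. t \<in> J \<Longrightarrow> w t \<le> v t"
  shows "derivs_bounded s J v a"
  using assms(1,2)
proof (induction r arbitrary: s a)
  case 0
  then show ?case using assms(3,4) by fastforce
next
  case (Suc r)
  from Suc.prems(1) obtain a' where a': "\<forall>t\<in>I. (a has_vector_derivative a' t) (at t within I)"
    "derivs_bounded r I w a'" "\<forall>t\<in>I. norm (a t) \<le> w t" unfolding derivs_bounded.simps by blast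
  show ?case
  proof (cases s)
    case 0
    then show ?thesis using a'(3) assms(3,4) by simp (meson order_trans subsetD)
  next
    case (Suc s')
    have "derivs_bounded s' J v a'" using Suc.IH[OF a'(2)] \<open>s \<le> Suc r\<close> Suc by simp
    moreover have "\<forall>t\<in>J. (a has_vector_derivative a' t) (at t within J)"
      using a'(1) assms(3) has_vector_derivative_within_subset by blast
    moreover have "\<forall>t\<in>J. norm (a t) \<le> v t" using a'(3) assms(3,4) by (meson order_trans subsetD)
    ultimately show ?thesis unfolding Suc derivs_bounded.simps by blast
  qed
qed

lemma derivs_bounded_cong:
  assumes "derivs_bounded r I w a" "\<And>t. t \<in> I \<Longrightarrow> a t = b t"
  shows "derivs_bounded r I w b"
proof (cases r)
  case 0
  then show ?thesis using assms by auto
next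
  case (Suc r')
  then show ?thesis using assms
    by simp (metis has_vector_derivative_transform)
qed

lemma derivs_bounded_add:
  "derivs_bounded r I w a \<Longrightarrow> derivs_bounded r I v b \<Longrightarrow>
   derivs_bounded r I (\<lambda>t. w t + v t) (\<lambda>t. a t + b t)"
proof (induction r arbitrary: a b)
  case 0
  then show ?case by (auto intro: norm_triangle_mono)
next
  case (Suc r)
  obtain a' where "\<forall>t\<in>I. (a has_vector_derivative a' t) (at t within I)" "derivs_bounded r I w a'"
    using Suc.prems(1) unfolding derivs_bounded.simps by blast
  moreover obtain b' where
    "\<forall>t\<in>I. (b has_vector_derivative b' t) (at t within I)" "derivs_bounded r I v b'"
    using Suc.prems(2) unfolding derivs_bounded.simps by blast
  moreover have "\<forall>t\<in>I. norm (a t + b t) \<le> w t + v t"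
    using Suc.prems by (simp add: norm_triangle_mono)
  ultimately show ?case unfolding derivs_bounded.simps
    by (intro conjI exI[of _ "\<lambda>t. a' t + b' t"] ballI has_vector_derivative_add Suc.IH) auto
qed

lemma derivs_bounded_cmult:
  "derivs_bounded r I w a \<Longrightarrow> derivs_bounded r I (\<lambda>t. norm c * w t) (\<lambda>t. c * a t)"
proof (induction r arbitrary: a)
  case 0
  then show ?case by (auto simp: norm_mult mult_left_mono)
next
  case (Suc r)
  obtain a' where
    "\<forall>t\<in>I. (a has_vector_derivative a' t) (at t within I)" "derivs_bounded r I w a'"
    using Suc.prems(1) unfolding derivs_bounded.simps by blast
  moreover have "\<forall>t\<in>I. norm (c * a t) \<le> norm c * w t"
    using Suc.prems by (simp add: norm_mult mult_left_mono)
  ultimately show ?case unfolding derivs_bounded.simps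
    by (intro conjI exI[of _ "\<lambda>t. c * a' t"] ballI has_vector_derivative_mult_right Suc.IH) auto
qed

text \<open>Leibniz rule: each differentiation splits every product into two, so \<open>r\<close> of
  them produce at most \<open>2 ^ r\<close> terms, each bounded by \<open>w t * v t\<close>.\<close>

lemma derivs_bounded_mult:
  "derivs_bounded r I w a \<Longrightarrow> derivs_bounded r I v b \<Longrightarrow>
   derivs_bounded r I (\<lambda>t. 2 ^ r * (w t * v t)) (\<lambda>t. a t * b t)"
proof (induction r arbitrary: a b)
  case 0
  then show ?case by (auto simp: norm_mult intro!: mult_mono order_trans[OF norm_ge_zero])
next
  case (Suc r)
  obtain a' where a': "\<forall>t\<in>I. (a has_vector_derivative a' t) (at t within I)" "derivs_bounded r I w a'"
    using Suc.prems(1) unfolding derivs_bounded.simps by blast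
  obtain b' where b': "\<forall>t\<in>I. (b has_vector_derivative b' t) (at t within I)" "derivs_bounded r I v b'"
    using Suc.prems(2) unfolding derivs_bounded.simps by blast
  note * = a' b'
  have ab: "norm (a t) \<le> w t" "norm (b t) \<le> v t" if "t \<in> I" for t
    using Suc.prems that derivs_bounded_norm by blast+
  have wv: "norm (a t * b t) \<le> w t * v t" "0 \<le> w t * v t" if "t \<in> I" for t
  proof -
    have "0 \<le> w t" "0 \<le> v t" using ab[OF that] norm_ge_zero order_trans by blast+
    then show "norm (a t * b t) \<le> w t * v t" "0 \<le> w t * v t"
      using ab[OF that] by (auto simp: norm_mult intro: mult_mono)
  qed
  have "w t * v t \<le> 2 ^ Suc r * (w t * v t)" if "t \<in> I" for t
    using mult_right_mono[OF one_le_power[of "2::real" "Suc r"] wv(2)[OF that]] by simp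
  then have "\<forall>t\<in>I. norm (a t * b t) \<le> 2 ^ Suc r * (w t * v t)" using wv(1) by (intro ballI) (rule order_trans)
  moreover have dr: "derivs_bounded r I w a" "derivs_bounded r I v b"
    by (rule derivs_bounded_mono[OF Suc.prems(1)], auto)
       (rule derivs_bounded_mono[OF Suc.prems(2)], auto)
  have "derivs_bounded r I (\<lambda>t. 2 ^ Suc r * (w t * v t)) (\<lambda>t. a t * b' t + a' t * b t)"
    by (rule derivs_bounded_mono[OF derivs_bounded_add[OF Suc.IH[OF dr(1) *(4)] Suc.IH[OF *(2) dr(2)]]]) auto
  moreover have "\<forall>t\<in>I. ((\<lambda>t. a t * b t) has_vector_derivative (a t * b' t + a' t * b t)) (at t within I)"
    using *(1,3) by (intro ballI has_vector_derivative_mult) blast+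
  ultimately show ?case unfolding derivs_bounded.simps by (intro conjI exI) assumption+
qed

text \<open>Bootstrapping: the bound on \<open>h\<close> and the equation bound \<open>h'\<close>;
  the product rule applied to the right-hand side then bounds the next derivative, and so on. Each
  order costs one factor \<open>u\<close> and a Leibniz constant, whence the power
  \<open>Suc r\<close>. The constants are generous.\<close>

lemma derivs_bounded_linear_ode:
  assumes deriv: "\<And>t. t \<in> I \<Longrightarrow> (h has_vector_derivative \<alpha> t * h t + \<beta> t) (at t within I)"
    and h: "\<And>t. t \<in> I \<Longrightarrow> norm (h t) \<le> v t"
    and \<alpha>: "derivs_bounded r I u \<alpha>" and \<beta>: "derivs_bounded r I v \<beta>"
    and u: "\<And>t. t \<in> I \<Longrightarrow> 1 \<le> u t"
  shows "derivs_bounded (Suc r) I (\<lambda>t. (2 ^ (r + 3) * u t) ^ Suc r * v t) h"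
proof -
  \<comment> \<open>The weight must vary with the order \<open>s\<close>, because the step from
    \<open>s\<close> to \<open>Suc s\<close> feeds the order-\<open>s\<close> bound on
    \<open>h\<close> back into the equation. At \<open>s = Suc r\<close> the base
    \<open>2 ^ (s + 2)\<close> is the stated \<open>2 ^ (r + 3)\<close>.\<close>
  have "derivs_bounded s I (\<lambda>t. (2 ^ (s + 2) * u t) ^ s * v t) h" if "s \<le> Suc r" for s
    using that
  proof (induction s)
    case 0
    then show ?case using h by auto
  next
    case (Suc s)
    let ?M = "\<lambda>t. (2 ^ (s + 2) * u t) ^ s"
    have v0: "0 \<le> v t" if "t \<in> I" for t using h[OF that] norm_ge_zero order_trans by blast
    have M1: "1 \<le> ?M t" if "t \<in> I" for t
    proof -
      have "1 * 1 \<le> 2 ^ (s + 2) * u t" using u[OF that] by (intro mult_mono one_le_power) auto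
      then show ?thesis by (intro one_le_power) simp
    qed
    have a: "derivs_bounded s I u \<alpha>" "derivs_bounded s I v \<beta>"
      using Suc.prems by (intro derivs_bounded_mono[OF \<alpha>] derivs_bounded_mono[OF \<beta>]; simp)+
    have step: "2 ^ s * (u t * (?M t * v t)) + v t \<le> (2 ^ (Suc s + 2) * u t) ^ Suc s * v t" if "t \<in> I" for t
    proof -
      have "2 ^ s * (u t * (?M t * v t)) + v t = (2 ^ s * u t * ?M t + 1) * v t" by (simp add: algebra_simps)
      also have "\<dots> \<le> (2 ^ s * u t * ?M t + u t * ?M t) * v t"
        using M1[OF that] u[OF that] v0[OF that]
          mult_mono[of 1 "u t" 1 "?M t"] by (intro mult_right_mono) auto
      also have "\<dots> = (2 ^ s + 1) * u t * ?M t * v t" by (simp add: algebra_simps)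
      also have "\<dots> \<le> 2 ^ (Suc s + 2) * u t * (2 ^ (Suc s + 2) * u t) ^ s * v t"
        using u[OF that] v0[OF that] one_le_power[of "2::real" s]
        by (intro mult_mono power_mono mult_nonneg_nonneg) (auto simp: algebra_simps simp del: one_le_power)
      finally show ?thesis by (simp add: algebra_simps)
    qed
    have "derivs_bounded s I (\<lambda>t. 2 ^ s * (u t * (?M t * v t)) + v t) (\<lambda>t. \<alpha> t * h t + \<beta> t)"
      using Suc by (intro derivs_bounded_add derivs_bounded_mult a) auto
    then have 1: "derivs_bounded s I (\<lambda>t. (2 ^ (Suc s + 2) * u t) ^ Suc s * v t) (\<lambda>t. \<alpha> t * h t + \<beta> t)"
      by (rule derivs_bounded_mono) (use step in auto)
    have 2: "norm (h t) \<le> (2 ^ (Suc s + 2) * u t) ^ Suc s * v t" if "t \<in> I" for t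
    proof -
      have "0 \<le> 2 ^ s * (u t * (?M t * v t))"
        using v0[OF that] M1[OF that] u[OF that] by (intro mult_nonneg_nonneg) auto
      then show ?thesis using h[OF that] step[OF that] by linarith
    qed
    show ?case unfolding derivs_bounded.simps
      by (intro conjI ballI exI[of _ "\<lambda>t. \<alpha> t * h t + \<beta> t"] 1 2 deriv)
  qed
  from this[of "Suc r"] show ?thesis by (simp add: numeral_3_eq_3)
qed

text \<open>Each integration by parts trades a factor \<open>x\<close> for a derivative of
  \<open>a\<close>. Since the one weight \<open>w\<close> dominates every derivative, its zeros at
  \<open>l\<close> and \<open>R\<close> remove the boundary terms at all orders. Integrability is
  assumed for the first integrand only; for the differentiated one it comes out of the product rule
  and the fundamental theorem.\<close>

lemma norm_fourier_integral_le:
  fixes a :: "real \<Rightarrow> complex"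
  assumes "l < R" "derivs_bounded r {l..R} w a" "w l = 0" "w R = 0" "w integrable_on {l..R}"
    and "(\<lambda>t. exp (- \<i> * of_real (t * x)) * a t) integrable_on {l..R}"
  shows "\<bar>x\<bar> ^ r * norm (integral {l..R} (\<lambda>t. exp (- \<i> * of_real (t * x)) * a t)) \<le> integral {l..R} w"
  using assms(2,6)
proof (induction r arbitrary: a)
  case 0
  then show ?case
    by (auto simp: norm_mult intro!: Henstock_Kurzweil_Integration.integral_norm_bound_integral assms)
next
  case (Suc r)
  let ?e = "\<lambda>t. exp (- \<i> * of_real (t * x))"
  from Suc.prems(1) obtain a' where a': "\<forall>t\<in>{l..R}. (a has_vector_derivative a' t) (at t within {l..R})"
    "derivs_bounded r {l..R} w a'" and w: "\<forall>t\<in>{l..R}. norm (a t) \<le> w t"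
    unfolding derivs_bounded.simps by blast
  have e': "(?e has_vector_derivative (- \<i> * x) * ?e t) (at t within {l..R})" for t
    unfolding of_real_mult by (rule has_vector_derivative_real_field) (auto intro!: derivative_eq_intros)
  have "((\<lambda>t. ?e t * a t) has_vector_derivative (?e t * a' t + (- \<i> * x) * ?e t * a t)) (at t within {l..R})"
    if "t \<in> {l..R}" for t
    by (intro has_vector_derivative_mult e' a'(1)[rule_format] that)
  then have "((\<lambda>t. ?e t * a' t + (- \<i> * x) * ?e t * a t) has_integral (?e R * a R - ?e l * a l)) {l..R}"
    using \<open>l < R\<close> by (intro fundamental_theorem_of_calculus) auto
  moreover have "a R = 0" "a l = 0" using w[rule_format, of R] w[rule_format, of l] assms by auto
  ultimately have I0: "((\<lambda>t. ?e t * a' t + (- \<i> * x) * ?e t * a t) has_integral 0) {l..R}" by simp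
  have "((\<lambda>t. (- \<i> * x) * (?e t * a t)) has_integral (- \<i> * x) * integral {l..R} (\<lambda>t. ?e t * a t)) {l..R}"
    using Suc.prems by (intro has_integral_mult_right integrable_integral)
  from has_integral_diff[OF I0 this]
  have I1: "((\<lambda>t. ?e t * a' t) has_integral \<i> * x * integral {l..R} (\<lambda>t. ?e t * a t)) {l..R}"
    by (simp add: mult.assoc)
  then have "\<bar>x\<bar> ^ r * norm (integral {l..R} (\<lambda>t. ?e t * a' t)) \<le> integral {l..R} w"
    by (intro Suc.IH a') (rule has_integral_integrable)
  with integral_unique[OF I1] show ?case by (simp add: norm_mult mult_ac)
qed

subsection \<open>B-splines and their Fourier transforms\<close>

text \<open>The window convolved with \<open>j\<close> copies of the uniform density on
  \<open>{- \<delta>..\<delta>}\<close>. Only the convolved copies are normalised, the initial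
  window keeps height 1; hence values stay in \<open>[0, 1]\<close> while the total mass is
  \<open>2 * \<delta>\<close>.\<close>

fun spline :: "real \<Rightarrow> nat \<Rightarrow> real \<Rightarrow> real" where
  "spline \<delta> 0 s = indicator {- \<delta>..\<delta>} s"
| "spline \<delta> (Suc j) s = (LINT v|lborel. indicator {- \<delta>..\<delta>} v * spline \<delta> j (s + v)) / (2 * \<delta>)"

declare spline.simps(2) [simp del]

lemma integrable_indicator_Icc: "integrable lborel (indicator {a..b :: real} :: real \<Rightarrow> real)"
  by (intro integrable_real_indicator) (auto simp: emeasure_lborel_Icc_eq)

lemma spline_measurable [measurable]: "spline \<delta> j \<in> borel_measurable borel"
proof (induction j)
  case 0
  have "spline \<delta> 0 = indicator {- \<delta>..\<delta>}" by auto
  then show ?case by simp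
next
  case (Suc j)
  note [measurable] = Suc
  have "spline \<delta> (Suc j) = (\<lambda>s. (LINT v|lborel. indicator {- \<delta>..\<delta>} v * spline \<delta> j (s + v)) / (2 * \<delta>))"
    by (auto simp: spline.simps)
  then show ?case by simp
qed

context
  fixes \<delta> :: real
  assumes \<delta>: "0 < \<delta>"
begin

lemma spline_window_integrable:
  assumes "\<And>s. 0 \<le> spline \<delta> j s \<and> spline \<delta> j s \<le> 1"
  shows "integrable lborel (\<lambda>v. indicator {- \<delta>..\<delta>} v * spline \<delta> j (s + v))"
  using assms
  by (intro Bochner_Integration.integrable_bound[OF integrable_indicator_Icc[of "- \<delta>" \<delta>]] AE_I2)
     (auto split: split_indicator)

lemma spline_range: "0 \<le> spline \<delta> j s \<and> spline \<delta> j s \<le> 1"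
proof (induction j arbitrary: s)
  case 0
  then show ?case by auto
next
  case (Suc j)
  have "0 \<le> (LINT v|lborel. indicator {- \<delta>..\<delta>} v * spline \<delta> j (s + v))"
    using Suc by (intro integral_nonneg_AE AE_I2) auto
  moreover have "(LINT v|lborel. indicator {- \<delta>..\<delta>} v * spline \<delta> j (s + v))
      \<le> (LINT v|lborel. indicator {- \<delta>..\<delta>} v)"
    using Suc \<delta> spline_window_integrable[OF Suc]
    by (intro integral_mono) (auto split: split_indicator)
  ultimately show ?case using \<delta> by (simp add: divide_le_eq spline.simps)
qed

lemma spline_support: "(real j + 1) * \<delta> < \<bar>s\<bar> \<Longrightarrow> spline \<delta> j s = 0"
proof (induction j arbitrary: s)
  case 0
  then show ?case by (auto split: split_indicator)
next
  case (Suc j)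
  have "(real j + 1) * \<delta> < \<bar>s + v\<bar>" if "\<bar>v\<bar> \<le> \<delta>" for v
    using Suc.prems that by (simp add: algebra_simps)
  then have "spline \<delta> j (s + v) = 0" if "\<bar>v\<bar> \<le> \<delta>" for v
    using that Suc.IH by blast
  then have *: "indicator {- \<delta>..\<delta>} v * spline \<delta> j (s + v) = 0" for v
    by (auto split: split_indicator)
  show ?case unfolding spline.simps * by simp
qed

lemma spline_integrable: "integrable lborel (spline \<delta> j)"
proof (rule Bochner_Integration.integrable_bound[OF integrable_indicator_Icc[of "- ((real j + 1) * \<delta>)" "(real j + 1) * \<delta>"]])
  show "AE s in lborel. norm (spline \<delta> j s) \<le> norm (indicator {- ((real j + 1) * \<delta>)..(real j + 1) * \<delta>} s :: real)"
  proof (rule AE_I2)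
    fix s
    show "norm (spline \<delta> j s) \<le> norm (indicator {- ((real j + 1) * \<delta>)..(real j + 1) * \<delta>} s :: real)"
      using spline_range[of j s] spline_support[of j s]
      by (cases "\<bar>s\<bar> \<le> (real j + 1) * \<delta>") (auto simp: abs_le_iff not_le)
  qed
qed measurable

lemma spline_integrable_on: "spline \<delta> j integrable_on {a..b}"
proof -
  have "set_integrable lborel {a..b} (spline \<delta> j)"
    using spline_integrable[of j] unfolding set_integrable_def
    by (intro integrable_mult_indicator) auto
  then show ?thesis using set_borel_integral_eq_integral(1) by blast
qed

lemma spline_Suc_eq_integral: "spline \<delta> (Suc j) s = integral {s - \<delta>..s + \<delta>} (spline \<delta> j) / (2 * \<delta>)"
proof -
  have "(LINT v|lborel. indicator {- \<delta>..\<delta>} v * spline \<delta> j (s + v)) =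
      (LINT v|lborel. indicator {s - \<delta>..s + \<delta>} v * spline \<delta> j v)"
    by (subst (2) lborel_integral_real_affine[where c=1 and t=s])
       (auto intro!: Bochner_Integration.integral_cong split: split_indicator)
  also have "\<dots> = integral {s - \<delta>..s + \<delta>} (spline \<delta> j)"
    using spline_integrable[of j] integrable_mult_indicator[of "{s - \<delta>..s + \<delta>}" lborel "spline \<delta> j"]
    by (subst set_borel_integral_eq_integral(2)[symmetric])
       (auto simp: set_integrable_def set_lebesgue_integral_def)
  finally show ?thesis by (simp add: spline.simps)
qed

text \<open>With a fixed base point \<open>a\<close> to the left of the window, the moving window
  integral becomes a difference of two values of one antiderivative. Continuity of indefinite
  integrals and the fundamental theorem then apply near \<open>s\<close>.\<close>

lemma spline_Suc_eq_diff:
  assumes "a < s - \<delta>"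
  shows "spline \<delta> (Suc j) s = (integral {a..s + \<delta>} (spline \<delta> j) - integral {a..s - \<delta>} (spline \<delta> j)) / (2 * \<delta>)"
proof -
  have "integral {a..s - \<delta>} (spline \<delta> j) + integral {s - \<delta>..s + \<delta>} (spline \<delta> j) = integral {a..s + \<delta>} (spline \<delta> j)"
    using assms \<delta> by (intro Henstock_Kurzweil_Integration.integral_combine spline_integrable_on) auto
  then show ?thesis by (simp add: spline_Suc_eq_integral)
qed

lemma isCont_integral_spline:
  assumes "a < s"
  shows "isCont (\<lambda>s. integral {a..s} (spline \<delta> j)) s"
proof -
  have "continuous_on {a..s + 1} (\<lambda>s. integral {a..s} (spline \<delta> j))"
    by (intro indefinite_integral_continuous_1 spline_integrable_on)
  then show ?thesis using assms by (auto intro: continuous_on_interior)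
qed

lemma isCont_spline_Suc: "isCont (spline \<delta> (Suc j)) s"
proof -
  let ?a = "s - \<delta> - 1" and ?P = "\<lambda>s. integral {s - \<delta> - 1..s} (spline \<delta> j)"
  have "isCont (\<lambda>t. (integral {?a..t + \<delta>} (spline \<delta> j) - integral {?a..t - \<delta>} (spline \<delta> j)) / (2 * \<delta>)) s"
    using \<delta>
    by (intro continuous_intros isCont_o2[of s "\<lambda>t. t + \<delta>"] isCont_o2[of s "\<lambda>t. t - \<delta>"] isCont_integral_spline) auto
  moreover have "\<forall>\<^sub>F t in nhds s. spline \<delta> (Suc j) t = (integral {?a..t + \<delta>} (spline \<delta> j) - integral {?a..t - \<delta>} (spline \<delta> j)) / (2 * \<delta>)"
    by (rule eventually_mono[OF eventually_nhds_in_open[of "{s - 1<..}" s]]) (auto intro!: spline_Suc_eq_diff)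
  ultimately show ?thesis by (subst isCont_cong) auto
qed

text \<open>The index starts at 2 because the fundamental theorem asks for a continuous integrand,
  and \<open>spline \<delta> 0\<close> jumps.\<close>

lemma has_vector_derivative_spline:
  "(spline \<delta> (Suc (Suc j)) has_vector_derivative
     (spline \<delta> (Suc j) (s + \<delta>) - spline \<delta> (Suc j) (s - \<delta>)) / (2 * \<delta>)) (at s)"
proof -
  let ?a = "s - \<delta> - 1" and ?f = "spline \<delta> (Suc j)"
  have P: "((\<lambda>t. integral {?a..t} ?f) has_real_derivative ?f t) (at t)" if "?a < t" for t
  proof -
    have "((\<lambda>u. integral {?a..u} ?f) has_vector_derivative ?f t) (at t within {?a..t + 1})"
      using that by (intro integral_has_vector_derivative continuous_at_imp_continuous_on ballI isCont_spline_Suc) auto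
    then have "((\<lambda>u. integral {?a..u} ?f) has_vector_derivative ?f t) (at t)"
      using that by (subst (asm) at_within_interior) auto
    then show ?thesis by (simp add: has_real_derivative_iff_has_vector_derivative)
  qed
  have P': "((\<lambda>u. integral {?a..u + d} ?f) has_real_derivative ?f (s + d)) (at s)" if "?a < s + d" for d
    using DERIV_shift[of "\<lambda>u. integral {?a..u} ?f" "?f (s + d)" s d] P[OF that] by (simp add: add.commute)
  have "((\<lambda>t. (integral {?a..t + \<delta>} ?f - integral {?a..t + - \<delta>} ?f) / (2 * \<delta>)) has_real_derivative
      (?f (s + \<delta>) - ?f (s + - \<delta>)) / (2 * \<delta>)) (at s)"
    using \<delta> by (intro DERIV_cdivide DERIV_diff P') auto
  then have "((\<lambda>t. (integral {?a..t + \<delta>} ?f - integral {?a..t - \<delta>} ?f) / (2 * \<delta>)) has_vector_derivative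
      (?f (s + \<delta>) - ?f (s - \<delta>)) / (2 * \<delta>)) (at s)"
    by (simp add: has_real_derivative_iff_has_vector_derivative)
  then show ?thesis
    by (rule has_vector_derivative_transform_within_open[where S="{s - 1<..}"])
       (use \<delta> spline_Suc_eq_diff[of ?a _ "Suc j"] in auto)
qed

end

lemma derivs_bounded_shift:
  "derivs_bounded r UNIV w a \<Longrightarrow> derivs_bounded r UNIV (\<lambda>t. w (t + d)) (\<lambda>t. a (t + d))"
proof (induction r arbitrary: a)
  case 0
  then show ?case by simp
next
  case (Suc r)
  obtain a' where a': "\<forall>t\<in>UNIV. (a has_vector_derivative a' t) (at t)" "derivs_bounded r UNIV w a'"
    using Suc.prems unfolding derivs_bounded.simps by blast
  have "((\<lambda>t. a (t + d)) has_vector_derivative a' (t + d)) (at t)" for t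
  proof -
    have "((\<lambda>t. t + d) has_vector_derivative 1) (at t)"
      by (auto intro!: derivative_eq_intros)
    from vector_diff_chain_at[OF this, of a "a' (t + d)"] a'(1) show ?thesis by (simp add: o_def)
  qed
  moreover have "\<forall>t\<in>UNIV. norm (a (t + d)) \<le> w (t + d)"
    using derivs_bounded_norm[OF Suc.prems] by blast
  ultimately show ?case using Suc.IH[OF a'(2)] unfolding derivs_bounded.simps
    by (intro conjI exI[of _ "\<lambda>t. a' (t + d)"]) auto
qed

text \<open>Differentiation replaces a spline by a difference of two shifted splines of lower index
  divided by \<open>2 * \<delta>\<close>, so each order costs at most
  \<open>1 / \<delta> \<le> c\<close>, and the shifted supports stay inside the wider one. Because
  \<open>1 \<le> c\<close>, the single constant \<open>c ^ j\<close> also covers all lower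
  orders.\<close>

lemma derivs_bounded_spline:
  assumes \<delta>: "0 < \<delta>" and c: "1 \<le> c" "1 / \<delta> \<le> c"
  shows "derivs_bounded j UNIV (\<lambda>t. c ^ j * indicator {- ((real j + 2) * \<delta>)..(real j + 2) * \<delta>} t)
           (\<lambda>t. complex_of_real (spline \<delta> (Suc j) t))"
proof -
  have bound: "norm (complex_of_real (spline \<delta> (Suc j) t)) \<le> c ^ j * indicator {- ((real j + 2) * \<delta>)..(real j + 2) * \<delta>} t" for j t
  proof (cases "t \<in> {- ((real j + 2) * \<delta>)..(real j + 2) * \<delta>}")
    case True
    then show ?thesis using spline_range[OF \<delta>, of "Suc j" t] one_le_power[OF c(1), of j] by simp
  next
    case False
    then have "(real (Suc j) + 1) * \<delta> < \<bar>t\<bar>" by (auto simp: algebra_simps not_le)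
    from spline_support[OF \<delta> this] False show ?thesis by simp
  qed
  show ?thesis
proof (induction j)
  case 0
  show ?case using bound[of 0] by (simp only: derivs_bounded.simps) simp
next
  case (Suc j)
  let ?R = "\<lambda>j. {- ((real j + 2) * \<delta>)..(real j + 2) * \<delta>}" and ?f = "\<lambda>j t. complex_of_real (spline \<delta> (Suc j) t)"
  let ?a' = "\<lambda>t. 1 / (2 * \<delta>) * (?f j (t + \<delta>) + (- 1) * ?f j (t + (- \<delta>)))"
  have "derivs_bounded j UNIV (\<lambda>t. norm (1 / (2 * \<delta>) :: complex) * (c ^ j * indicator (?R j) (t + \<delta>) +
      norm (- 1 :: complex) * (c ^ j * indicator (?R j) (t + (- \<delta>))))) ?a'"
    by (intro derivs_bounded_cmult derivs_bounded_add derivs_bounded_shift[OF Suc.IH]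
        derivs_bounded_shift[where d="- \<delta>" and w="\<lambda>t. c ^ j * indicator (?R j) t", OF Suc.IH])
  then have "derivs_bounded j UNIV (\<lambda>t. c ^ Suc j * indicator (?R (Suc j)) t) ?a'"
  proof (rule derivs_bounded_mono)
    fix t
    let ?i = "indicator (?R (Suc j)) t :: real"
    have "indicator (?R j) (t + \<delta>) \<le> ?i" "indicator (?R j) (t + - \<delta>) \<le> ?i"
      using \<delta> by (auto split: split_indicator simp: algebra_simps)
    then have "c ^ j * indicator (?R j) (t + \<delta>) + norm (- 1 :: complex) * (c ^ j * indicator (?R j) (t + - \<delta>))
        \<le> c ^ j * ?i + 1 * (c ^ j * ?i)"
      using c by (intro add_mono mult_left_mono) auto
    then have "norm (1 / (2 * \<delta>) :: complex) * (c ^ j * indicator (?R j) (t + \<delta>) + norm (- 1 :: complex) * (c ^ j * indicator (?R j) (t + - \<delta>)))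
        \<le> 1 / (2 * \<delta>) * (c ^ j * ?i + 1 * (c ^ j * ?i))"
      using \<delta> c by (intro mult_mono) (auto simp: norm_divide norm_mult)
    also have "\<dots> = (1 / \<delta>) * (c ^ j * ?i)" using \<delta> by (simp add: field_simps)
    also have "\<dots> \<le> c * (c ^ j * ?i)" using c by (intro mult_right_mono) auto
    finally show "norm (1 / (2 * \<delta>) :: complex) * (c ^ j * indicator (?R j) (t + \<delta>) +
      norm (- 1 :: complex) * (c ^ j * indicator (?R j) (t + - \<delta>))) \<le> c ^ Suc j * ?i" by simp
  qed auto
  moreover have "(?f (Suc j) has_vector_derivative ?a' t) (at t within UNIV)" for t
    using has_vector_derivative_of_real[where 'a=complex, OF has_vector_derivative_spline[OF \<delta>, of j t, folded has_real_derivative_iff_has_vector_derivative]] by (simp add: diff_divide_distrib ring_distribs)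
  ultimately show ?case using bound[of "Suc j"] unfolding derivs_bounded.simps
    by (intro conjI exI[of _ ?a'] ballI) simp_all
qed
qed

lemma integral_iexp_window:
  assumes "0 < \<delta>"
  shows "(CLINT v|lborel. indicator {- \<delta>..\<delta>} v *\<^sub>R exp (\<i> * of_real (v * y))) = of_real (2 * \<delta> * sinc (\<delta> * y))"
proof -
  let ?e = "\<lambda>v. exp (\<i> * of_real (v * y))"
  have c: "continuous_on {- \<delta>..\<delta>} ?e" by (intro continuous_intros)
  have "(CLINT v|lborel. indicator {- \<delta>..\<delta>} v *\<^sub>R ?e v) = integral {- \<delta>..\<delta>} ?e"
    using set_borel_integral_eq_integral(2)[OF borel_integrable_atLeastAtMost'[OF c]]
    by (simp add: set_lebesgue_integral_def)
  also have "\<dots> = of_real (2 * \<delta> * sinc (\<delta> * y))"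
  proof (cases "y = 0")
    case True
    then show ?thesis using assms by (simp add: scaleR_conv_of_real)
  next
    case False
    have "((\<lambda>v. ?e v / (\<i> * y)) has_vector_derivative ?e v) (at v within {- \<delta>..\<delta>})" for v
      unfolding of_real_mult
      by (rule has_vector_derivative_real_field) (use False in \<open>auto intro!: derivative_eq_intros simp: mult_ac\<close>)
    then have "(?e has_integral (?e \<delta> / (\<i> * y) - ?e (- \<delta>) / (\<i> * y))) {- \<delta>..\<delta>}"
      using assms by (intro fundamental_theorem_of_calculus) auto
    then have "integral {- \<delta>..\<delta>} ?e = ?e \<delta> / (\<i> * y) - ?e (- \<delta>) / (\<i> * y)" by (rule integral_unique)
    also have "\<dots> = 2 * of_real (sin (\<delta> * y)) / y"
      using False by (simp add: exp_Euler exp_minus_Euler sin_of_real[symmetric] field_simps)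
    finally show ?thesis using False assms by simp
  qed
  finally show ?thesis .
qed

text \<open>Convolution theorem, one sinc factor per window: translation by \<open>v\<close>
  multiplies the transform by \<open>exp (\<i> * v * y)\<close>, and integrating this over the
  window gives \<open>2 * \<delta> * sinc (\<delta> * y)\<close>, whose constant is cancelled by the
  averaging. Index 0 is already one window, hence the power \<open>Suc j\<close>.\<close>

lemma fourier_spline:
  assumes \<delta>: "0 < \<delta>"
  shows "(CLINT s|lborel. spline \<delta> j s *\<^sub>R exp (- \<i> * of_real (s * y))) = of_real (2 * \<delta> * sinc (\<delta> * y) ^ Suc j)"
proof (induction j)
  case 0
  have "indicator {- \<delta>..\<delta>} (- s) = (indicator {- \<delta>..\<delta>} s :: real)" for s by (auto split: split_indicator)
  then show ?case
    using integral_iexp_window[OF \<delta>, of "- y"] by simp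
next
  case (Suc j)
  let ?g = "\<lambda>s v. (indicator {- \<delta>..\<delta>} v * spline \<delta> j (s + v)) *\<^sub>R exp (- \<i> * of_real (s * y))"
  have int: "integrable (lborel \<Otimes>\<^sub>M lborel) (case_prod ?g)"
  proof (rule lborel_pair.Fubini_integrable)
    have "(LINT v|lborel. norm (case_prod ?g (s, v))) = 2 * \<delta> * spline \<delta> (Suc j) s" for s
      using spline_range[OF \<delta>, of j] \<delta> by (simp add: spline.simps abs_mult)
    then show "integrable lborel (\<lambda>s. LINT v|lborel. norm (case_prod ?g (s, v)))"
      using spline_integrable[OF \<delta>] by simp
    show "AE s in lborel. integrable lborel (\<lambda>v. case_prod ?g (s, v))"
      using spline_window_integrable[OF \<delta> spline_range[OF \<delta>], of j] by (intro AE_I2) (auto intro: integrable_scaleR_left)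
  qed measurable
  have "(CLINT s|lborel. spline \<delta> (Suc j) s *\<^sub>R exp (- \<i> * of_real (s * y))) = (CLINT s|lborel. CLINT v|lborel. ?g s v) / (2 * \<delta>)"
  proof -
    have "(CLINT v|lborel. ?g s v) = (2 * \<delta>) *\<^sub>R (spline \<delta> (Suc j) s *\<^sub>R exp (- \<i> * of_real (s * y)))" for s
      using \<delta> spline_window_integrable[OF \<delta> spline_range[OF \<delta>], of j s] by (simp add: spline.simps)
    then have "(CLINT s|lborel. CLINT v|lborel. ?g s v) = (2 * \<delta>) *\<^sub>R (CLINT s|lborel. spline \<delta> (Suc j) s *\<^sub>R exp (- \<i> * of_real (s * y)))"
      by (simp only: integral_scaleR_right)
    then show ?thesis using \<delta> by (simp only: scaleR_conv_of_real) simp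
  qed
  also have "(CLINT s|lborel. CLINT v|lborel. ?g s v) = (CLINT v|lborel. CLINT s|lborel. ?g s v)"
    by (rule lborel_pair.Fubini_integral[OF int, symmetric])
  also have "\<dots> = (CLINT v|lborel. indicator {- \<delta>..\<delta>} v *\<^sub>R exp (\<i> * of_real (v * y)) * of_real (2 * \<delta> * sinc (\<delta> * y) ^ Suc j))"
  proof (rule Bochner_Integration.integral_cong[OF refl])
    fix v
    have "(CLINT s|lborel. spline \<delta> j (s + v) *\<^sub>R exp (- \<i> * of_real (s * y)))
        = (CLINT s|lborel. exp (\<i> * of_real (v * y)) * (spline \<delta> j s *\<^sub>R exp (- \<i> * of_real (s * y))))"
      by (subst (2) lborel_integral_real_affine[where c=1 and t=v])
         (auto intro!: Bochner_Integration.integral_cong simp: exp_add[symmetric] algebra_simps scaleR_conv_of_real)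
    also have "\<dots> = exp (\<i> * of_real (v * y)) * of_real (2 * \<delta> * sinc (\<delta> * y) ^ Suc j)"
      by (simp only: integral_mult_right_zero Suc)
    finally have H: "(CLINT s|lborel. spline \<delta> j (s + v) *\<^sub>R exp (- \<i> * of_real (s * y))) =
       exp (\<i> * of_real (v * y)) * of_real (2 * \<delta> * sinc (\<delta> * y) ^ Suc j)" .
    show "(CLINT s|lborel. ?g s v) = indicator {- \<delta>..\<delta>} v *\<^sub>R exp (\<i> * of_real (v * y)) * of_real (2 * \<delta> * sinc (\<delta> * y) ^ Suc j)"
      by (simp only: scaleR_scaleR[symmetric] integral_scaleR_right H mult_scaleR_left)
  qed
  also have "\<dots> = of_real (2 * \<delta> * sinc (\<delta> * y)) * of_real (2 * \<delta> * sinc (\<delta> * y) ^ Suc j)"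
    by (simp only: integral_mult_left_zero integral_iexp_window[OF \<delta>])
  finally have "(CLINT s|lborel. spline \<delta> (Suc j) s *\<^sub>R exp (- \<i> * of_real (s * y))) =
    of_real (2 * \<delta> * sinc (\<delta> * y)) * of_real (2 * \<delta> * sinc (\<delta> * y) ^ Suc j) / complex_of_real (2 * \<delta>)" .
  moreover have "complex_of_real (2 * \<delta> * x) * of_real (2 * \<delta> * x ^ Suc j) / complex_of_real (2 * \<delta>) = of_real (2 * \<delta> * x ^ Suc (Suc j))" for x
    using \<delta> by (simp add: field_simps)
  ultimately show ?case by (simp only:)
qed

subsection \<open>The smoothing kernel\<close>

lemma integrable_inverse_one_plus_sq: "integrable lborel (\<lambda>y::real. inverse (1 + y\<^sup>2))"
  using integrable_inverse_1_plus_square by (simp add: set_integrable_def)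

lemma one_plus_abs_mult_sinc_le: "(1 + \<bar>y\<bar>) * \<bar>sinc y\<bar> \<le> 2"
proof (cases "y = 0")
  case False
  then have "(1 + \<bar>y\<bar>) * \<bar>sinc y\<bar> = \<bar>sin y\<bar> / \<bar>y\<bar> + \<bar>sin y\<bar>"
    by (simp add: field_simps)
  also have "\<dots> \<le> 1 + 1"
    using abs_sin_le_one[of y] abs_sin_x_le_abs_x[of y] False by (intro add_mono) auto
  finally show ?thesis by simp
qed simp

text \<open>Every sinc factor decays like \<open>1 / (1 + \<bar>y\<bar>)\<close>; after
  \<open>m\<close> of them pay for the weight, at least two are left and provide an integrable
  majorant.\<close>

lemma sinc_power_moment_le:
  assumes "m + 2 \<le> 2 * N"
  shows "(1 + \<bar>y\<bar>) ^ m * sinc y ^ (2 * N) \<le> 4 ^ N * inverse (1 + y\<^sup>2)"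
proof -
  let ?t = "1 + \<bar>y\<bar>"
  have "?t ^ m * ?t ^ 2 \<le> ?t ^ (2 * N)"
    unfolding power_add[symmetric] using assms by (intro power_increasing) auto
  then have "?t ^ m * ?t ^ 2 * sinc y ^ (2 * N) \<le> ?t ^ (2 * N) * sinc y ^ (2 * N)"
    by (intro mult_right_mono zero_le_even_power) simp_all
  also have "\<dots> = ((?t * \<bar>sinc y\<bar>) ^ 2) ^ N"
    by (simp only: power_mult power_mult_distrib power2_abs)
  also have "\<dots> \<le> (2 ^ 2) ^ N"
    by (intro power_mono one_plus_abs_mult_sinc_le) auto
  finally have *: "?t ^ m * sinc y ^ (2 * N) * ?t\<^sup>2 \<le> 4 ^ N" by (simp only: mult_ac) simp
  have "?t ^ m * sinc y ^ (2 * N) * (1 + y\<^sup>2) \<le> ?t ^ m * sinc y ^ (2 * N) * ?t\<^sup>2"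
    by (intro mult_left_mono mult_nonneg_nonneg[OF _ zero_le_even_power]) (auto simp: power2_sum)
  with * have "?t ^ m * sinc y ^ (2 * N) * (1 + y\<^sup>2) \<le> 4 ^ N" by linarith
  moreover have "0 < 1 + y\<^sup>2" by (simp add: add_pos_nonneg)
  ultimately show ?thesis by (simp only: pos_le_divide_eq[symmetric] divide_inverse)
qed

lemma sinc_power_moment_integrable:
  assumes "m + 2 \<le> 2 * N"
  shows "integrable lborel (\<lambda>y. (1 + \<bar>y\<bar>) ^ m * sinc y ^ (2 * N))"
proof (rule Bochner_Integration.integrable_bound)
  show "integrable lborel (\<lambda>y::real. 4 ^ N * inverse (1 + y\<^sup>2))"
    by (intro integrable_mult_right integrable_inverse_one_plus_sq)
  have "0 \<le> (1 + \<bar>y\<bar>) ^ m * sinc y ^ (2 * N)" for y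
    by (rule mult_nonneg_nonneg[OF _ zero_le_even_power]) auto
  then show "AE y in lborel. norm ((1 + \<bar>y\<bar>) ^ m * sinc y ^ (2 * N)) \<le> norm (4 ^ N * inverse (1 + y\<^sup>2))"
    using sinc_power_moment_le[OF assms]
    by (intro AE_I2) (simp only: real_norm_def abs_of_nonneg, meson abs_ge_self order_trans)
qed measurable

definition sinc_mass :: "nat \<Rightarrow> real" where
  "sinc_mass N = (LINT y|lborel. sinc y ^ (2 * N))"

lemma sinc_mass_pos:
  assumes "1 \<le> N"
  shows "0 < sinc_mass N"
proof -
  have int: "integrable lborel (\<lambda>y. sinc y ^ (2 * N))"
    using sinc_power_moment_integrable[of 0 N] assms by simp
  have nn: "0 \<le> sinc y ^ (2 * N)" for y by (rule zero_le_even_power) simp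
  have "sinc_mass N \<noteq> 0"
  proof
    assume "sinc_mass N = 0"
    then have "AE y in lborel. sinc y ^ (2 * N) = 0"
      unfolding sinc_mass_def using int nn by (subst (asm) integral_nonneg_eq_0_iff_AE) auto
    then have "AE y in lborel. y \<notin> {0<..<1::real}"
    proof (rule AE_mp, intro AE_I2 impI notI)
      fix y :: real assume "sinc y ^ (2 * N) = 0" "y \<in> {0<..<1}"
      moreover have "0 < sin y" using \<open>y \<in> {0<..<1}\<close> pi_gt3 by (intro sin_gt_zero) auto
      ultimately show False by auto
    qed
    then have "{0<..<1::real} \<in> null_sets lborel" by (subst (asm) AE_iff_null_sets[symmetric]) auto
    then show False by (auto simp: null_sets_def)
  qed
  moreover have "0 \<le> sinc_mass N" unfolding sinc_mass_def using nn by (intro integral_nonneg_AE AE_I2)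
  ultimately show ?thesis by linarith
qed

text \<open>A kernel of Jackson type on the line; \<open>N = 1\<close> is the Fejer kernel. It is a
  probability density of width about \<open>1 / \<delta>\<close>, and its transform is supported in
  \<open>\<bar>s\<bar> \<le> 2 * N * \<delta>\<close>.\<close>

definition jackson :: "nat \<Rightarrow> real \<Rightarrow> real \<Rightarrow> real" where
  "jackson N \<delta> y = \<delta> * sinc (\<delta> * y) ^ (2 * N) / sinc_mass N"

lemma jackson_measurable [measurable]: "jackson N \<delta> \<in> borel_measurable borel"
  unfolding jackson_def[abs_def] by measurable

lemma jackson_nonneg: "0 < \<delta> \<Longrightarrow> 1 \<le> N \<Longrightarrow> 0 \<le> jackson N \<delta> y"
  using sinc_mass_pos[of N] unfolding jackson_def
  by (intro divide_nonneg_pos mult_nonneg_nonneg zero_le_even_power) auto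

lemma jackson_minus: "jackson N \<delta> (- y) = jackson N \<delta> y"
  using sinc_neg[of "\<delta> * y"] by (simp only: jackson_def mult_minus_right)

text \<open>Substituting \<open>\<delta> * y\<close> shows that moments and tails measured in units
  of \<open>1 / \<delta>\<close> are the same for all \<open>\<delta>\<close>, so constants can be
  fixed once at \<open>\<delta> = 1\<close>.\<close>

lemma jackson_scale:
  fixes f :: "real \<Rightarrow> real"
  assumes "0 < \<delta>"
  shows "integrable lborel (\<lambda>y. jackson N \<delta> y * f (\<delta> * y)) \<longleftrightarrow> integrable lborel (\<lambda>y. jackson N 1 y * f y)"
    and "(LINT y|lborel. jackson N \<delta> y * f (\<delta> * y)) = (LINT y|lborel. jackson N 1 y * f y)"
proof -
  have *: "jackson N \<delta> y * f (\<delta> * y) = \<delta> * (jackson N 1 (0 + \<delta> * y) * f (0 + \<delta> * y))" for y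
    unfolding jackson_def by (simp only: mult_1_left add_0 times_divide_eq_left times_divide_eq_right mult.assoc)
  show "integrable lborel (\<lambda>y. jackson N \<delta> y * f (\<delta> * y)) \<longleftrightarrow> integrable lborel (\<lambda>y. jackson N 1 y * f y)"
    unfolding * using assms lborel_integrable_real_affine_iff[of \<delta> "\<lambda>y. jackson N 1 y * f y" 0] by simp
  show "(LINT y|lborel. jackson N \<delta> y * f (\<delta> * y)) = (LINT y|lborel. jackson N 1 y * f y)"
    unfolding * using assms lborel_integral_real_affine[of \<delta> "\<lambda>y. jackson N 1 y * f y" 0] by simp
qed

lemma jackson_moment_integrable:
  assumes "0 < \<delta>" "m + 2 \<le> 2 * N"
  shows "integrable lborel (\<lambda>y. jackson N \<delta> y * (1 + \<bar>\<delta> * y\<bar>) ^ m)"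
proof -
  have "integrable lborel (\<lambda>y. (1 + \<bar>y\<bar>) ^ m * sinc y ^ (2 * N) / sinc_mass N)"
    by (intro integrable_divide sinc_power_moment_integrable assms)
  also have "(\<lambda>y. (1 + \<bar>y\<bar>) ^ m * sinc y ^ (2 * N) / sinc_mass N) = (\<lambda>y. jackson N 1 y * (1 + \<bar>y\<bar>) ^ m)"
    unfolding jackson_def by (simp only: mult_1_left) (simp only: times_divide_eq_left times_divide_eq_right mult.commute)
  finally show ?thesis using jackson_scale(1)[OF assms(1), of N "\<lambda>y. (1 + \<bar>y\<bar>) ^ m"] by simp
qed

lemma jackson_integrable:
  assumes "0 < \<delta>" "1 \<le> N"
  shows "integrable lborel (jackson N \<delta>)"
  using jackson_moment_integrable[of \<delta> 0 N] assms by simp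

lemma jackson_integral:
  assumes "0 < \<delta>" "1 \<le> N"
  shows "(LINT y|lborel. jackson N \<delta> y) = 1"
proof -
  have "(LINT y|lborel. jackson N \<delta> y) = (LINT y|lborel. jackson N 1 y)"
    using jackson_scale(2)[OF assms(1), of N "\<lambda>_. 1"] by simp
  also have "\<dots> = 1"
    unfolding jackson_def integral_divide_zero mult_1_left
    using sinc_mass_pos[OF assms(2)] by (simp only: sinc_mass_def[symmetric]) simp
  finally show ?thesis .
qed

text \<open>\<open>fourier_spline\<close> read from right to left. The index is
  \<open>2 * N - 1\<close> because a spline of index \<open>j\<close> carries the power
  \<open>j + 1\<close>; the factor 2 in the denominator is what remains of
  \<open>2 * \<delta>\<close> against \<open>\<delta>\<close>.\<close>

lemma jackson_eq_fourier:
  assumes "0 < \<delta>" "1 \<le> N"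
  shows "complex_of_real (jackson N \<delta> y) =
    (CLINT s|lborel. spline \<delta> (2 * N - 1) s *\<^sub>R exp (- \<i> * of_real (s * y))) / (2 * sinc_mass N)"
proof -
  have "Suc (2 * N - 1) = 2 * N" using assms by simp
  then show ?thesis
    unfolding fourier_spline[OF assms(1)] jackson_def by (simp only:) (simp only: of_real_divide of_real_mult, simp)
qed

subsection \<open>Smoothed distributions\<close>

definition smoothed_density :: "(real \<Rightarrow> real) \<Rightarrow> real measure \<Rightarrow> real \<Rightarrow> real" where
  "smoothed_density r \<mu> z = (LINT u|\<mu>. r (z - u))"

context
  fixes r :: "real \<Rightarrow> real" and \<mu> :: "real measure"
  assumes r_meas [measurable]: "r \<in> borel_measurable borel"
    and r_nonneg: "\<And>y. 0 \<le> r y"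
    and r_int: "integrable lborel r"
    and r_mass: "(LINT y|lborel. r y) = 1"
    and \<mu>: "real_distribution \<mu>"
begin

interpretation \<mu>: real_distribution \<mu> by (rule \<mu>)
interpretation \<mu>_lborel: pair_sigma_finite \<mu> lborel ..

lemma integrable_translate: "integrable lborel (\<lambda>z. r (z - u))"
  using lborel_integrable_real_affine_iff[of 1 r "- u"] r_int by simp

lemma integrable_smoothed_pair: "integrable (\<mu> \<Otimes>\<^sub>M lborel) (\<lambda>(u, z). r (z - u))"
proof (rule \<mu>_lborel.Fubini_integrable)
  have "(LINT z|lborel. norm (r (z - u))) = 1" for u
    using lborel_integral_real_affine[of 1 r "- u"] r_nonneg r_mass by simp
  then show "integrable \<mu> (\<lambda>u. LINT z|lborel. norm (case (u, z) of (u, z) \<Rightarrow> r (z - u)))" by simp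
  show "AE u in \<mu>. integrable lborel (\<lambda>z. case (u, z) of (u, z) \<Rightarrow> r (z - u))"
    using integrable_translate by simp
qed measurable

lemma smoothed_density_integrable: "integrable lborel (smoothed_density r \<mu>)"
  using \<mu>_lborel.integrable_snd[OF integrable_smoothed_pair] by (simp add: smoothed_density_def[abs_def])

lemma smoothed_density_mass: "(LINT z|lborel. smoothed_density r \<mu> z) = 1"
proof -
  have "(LINT z|lborel. smoothed_density r \<mu> z) = (LINT u|\<mu>. LINT z|lborel. r (z - u))"
    unfolding smoothed_density_def by (rule \<mu>_lborel.Fubini_integral[OF integrable_smoothed_pair])
  also have "(\<lambda>u. LINT z|lborel. r (z - u)) = (\<lambda>u. 1)"
    using lborel_integral_real_affine[of 1 r "- u" for u] r_mass by simp
  also have "(LINT u|\<mu>. 1) = (1 :: real)" using \<mu>.prob_space unfolding \<mu>.space_eq_univ by simp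
  finally show ?thesis .
qed

text \<open>Both sides are the probability that \<open>U + Y \<le> x\<close>, with \<open>U\<close>
  of law \<open>\<mu>\<close> and \<open>Y\<close> independent of density \<open>r\<close>: once by
  conditioning on \<open>Y\<close>, once through the density of the sum.\<close>

lemma smoothed_cdf:
  "(LINT y|lborel. r y * cdf \<mu> (x - y)) = (LINT z|lborel. indicator {..x} z * smoothed_density r \<mu> z)"
proof -
  have int1: "integrable (\<mu> \<Otimes>\<^sub>M lborel) (\<lambda>(u, z). indicator {..x} z * r (z - u))"
    by (rule Bochner_Integration.integrable_bound[OF integrable_smoothed_pair]) (auto intro!: AE_I2 split: split_indicator)
  \<comment> \<open>Here the half-line \<open>{..x - y}\<close> moves with the other variable.
    Written as a comparison of the two coordinates, its indicator is visibly measurable in the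
    pair.\<close>
  have "(\<lambda>p. if fst p \<le> x - snd p then r (snd p) else 0) \<in> borel_measurable (\<mu> \<Otimes>\<^sub>M lborel)"
    by measurable
  also have "(\<lambda>p. if fst p \<le> x - snd p then r (snd p) else 0) = (\<lambda>(u, y). indicator {..x - y} u * r y)"
    by auto
  finally have pm: "(\<lambda>(u, y). indicator {..x - y} u * r y) \<in> borel_measurable (\<mu> \<Otimes>\<^sub>M lborel)" .
  have int2: "integrable (\<mu> \<Otimes>\<^sub>M lborel) (\<lambda>(u, y). indicator {..x - y} u * r y)"
  proof (rule \<mu>_lborel.Fubini_integrable)
    have im: "(\<lambda>y. indicator {..x - y} u * r y) \<in> borel_measurable borel" for u
    proof -
      have "(\<lambda>y. indicator {..x - y} u * r y) = (\<lambda>y. indicator {..x - u} y * r y)"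
        by (auto split: split_indicator)
      then show ?thesis by simp
    qed
    have b: "norm (indicator {..x - y} u * r y) \<le> norm (r y)" for u y by (auto split: split_indicator)
    show i: "AE u in \<mu>. integrable lborel (\<lambda>y. case (u, y) of (u, y) \<Rightarrow> indicator {..x - y} u * r y)"
    proof (rule AE_I2)
      fix u
      have "integrable lborel (\<lambda>y. indicator {..x - y} u * r y)"
        by (rule Bochner_Integration.integrable_bound[OF r_int]) (use b im in auto)
      then show "integrable lborel (\<lambda>y. case (u, y) of (u, y) \<Rightarrow> indicator {..x - y} u * r y)" by simp
    qed
    show "integrable \<mu> (\<lambda>u. LINT y|lborel. norm (case (u, y) of (u, y) \<Rightarrow> indicator {..x - y} u * r y))"
    proof (rule \<mu>.integrable_const_bound[where B=1])
      have "(LINT y|lborel. norm (indicator {..x - y} u * r y)) \<le> (LINT y|lborel. r y)" for u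
        using b[of _ u] r_nonneg r_int im
        by (intro integral_mono Bochner_Integration.integrable_bound[OF r_int]) auto
      then show "AE u in \<mu>. norm (LINT y|lborel. norm (case (u, y) of (u, y) \<Rightarrow> indicator {..x - y} u * r y)) \<le> 1"
        using r_mass by simp
      have "(\<lambda>(u, y). norm (indicator {..x - y} u * r y)) \<in> borel_measurable (\<mu> \<Otimes>\<^sub>M lborel)"
        using measurable_compose[OF pm borel_measurable_norm] by (simp add: case_prod_beta')
      then show "(\<lambda>u. LINT y|lborel. norm (case (u, y) of (u, y) \<Rightarrow> indicator {..x - y} u * r y)) \<in> borel_measurable \<mu>"
        unfolding prod.case by (rule lborel.borel_measurable_lebesgue_integral)
    qed
  qed (rule pm)
  have "(LINT z|lborel. indicator {..x} z * smoothed_density r \<mu> z) = (LINT z|lborel. LINT u|\<mu>. indicator {..x} z * r (z - u))"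
    unfolding smoothed_density_def by simp
  also have "\<dots> = (LINT u|\<mu>. LINT z|lborel. indicator {..x} z * r (z - u))"
    by (rule \<mu>_lborel.Fubini_integral[OF int1])
  also have "\<dots> = (LINT u|\<mu>. LINT y|lborel. indicator {..x - y} u * r y)"
  proof (rule Bochner_Integration.integral_cong[OF refl])
    fix u
    show "(LINT z|lborel. indicator {..x} z * r (z - u)) = (LINT y|lborel. indicator {..x - y} u * r y)"
      by (subst lborel_integral_real_affine[where c=1 and t=u])
         (auto intro!: Bochner_Integration.integral_cong split: split_indicator)
  qed
  also have "\<dots> = (LINT y|lborel. LINT u|\<mu>. indicator {..x - y} u * r y)"
    by (rule \<mu>_lborel.Fubini_integral[OF int2, symmetric])
  also have "\<dots> = (LINT y|lborel. r y * cdf \<mu> (x - y))"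
    by (simp add: cdf_def mult.commute)
  finally show ?thesis ..
qed

end

text \<open>Inserting the kernel as the transform of a spline and exchanging integrals turns the
  integral over \<open>\<mu>\<close> into \<open>char \<mu>\<close>, weighted by a function of
  compact support.\<close>

lemma smoothed_density_jackson_eq_char:
  assumes \<mu>: "real_distribution \<mu>" and \<delta>: "0 < \<delta>" and N: "1 \<le> N"
  shows "complex_of_real (smoothed_density (jackson N \<delta>) \<mu> z) =
    (CLINT s|lborel. spline \<delta> (2 * N - 1) s *\<^sub>R (exp (- \<i> * of_real (s * z)) * char \<mu> s)) / (2 * sinc_mass N)"
proof -
  interpret \<mu>: real_distribution \<mu> by (rule \<mu>)
  interpret \<mu>_lborel: pair_sigma_finite \<mu> lborel ..
  let ?k = "spline \<delta> (2 * N - 1)"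
  let ?g = "\<lambda>u s. ?k s *\<^sub>R exp (- \<i> * of_real (s * (z - u)))"
  have int: "integrable (\<mu> \<Otimes>\<^sub>M lborel) (case_prod ?g)"
  proof (rule \<mu>_lborel.Fubini_integrable)
    have n: "norm (?g u s) = ?k s" for u s using spline_range[OF \<delta>, of "2 * N - 1" s] by simp
    show "integrable \<mu> (\<lambda>u. LINT s|lborel. norm (case_prod ?g (u, s)))" unfolding prod.case n by simp
    show "AE u in \<mu>. integrable lborel (\<lambda>s. case_prod ?g (u, s))"
      using spline_range[OF \<delta>, of "2 * N - 1"]
      by (intro AE_I2 Bochner_Integration.integrable_bound[OF spline_integrable[OF \<delta>, of "2 * N - 1"]]) auto
  qed measurable
  have "complex_of_real (smoothed_density (jackson N \<delta>) \<mu> z) = (CLINT u|\<mu>. complex_of_real (jackson N \<delta> (z - u)))"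
    unfolding smoothed_density_def by simp
  also have "\<dots> = (CLINT u|\<mu>. (CLINT s|lborel. ?g u s) / complex_of_real (2 * sinc_mass N))"
    unfolding jackson_eq_fourier[OF \<delta> N] ..
  also have "\<dots> = (CLINT u|\<mu>. CLINT s|lborel. ?g u s) / complex_of_real (2 * sinc_mass N)"
    by (rule integral_divide_zero)
  also have "(CLINT u|\<mu>. CLINT s|lborel. ?g u s) = (CLINT s|lborel. CLINT u|\<mu>. ?g u s)"
    by (rule \<mu>_lborel.Fubini_integral[OF int, symmetric])
  also have "(\<lambda>s. CLINT u|\<mu>. ?g u s) = (\<lambda>s. ?k s *\<^sub>R (exp (- \<i> * of_real (s * z)) * char \<mu> s))"
  proof
    fix s
    have "?g u s = ?k s *\<^sub>R (exp (- \<i> * of_real (s * z)) * iexp (s * u))" for u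
      by (simp add: exp_add[symmetric] algebra_simps)
    then have "(CLINT u|\<mu>. ?g u s) = (CLINT u|\<mu>. ?k s *\<^sub>R (exp (- \<i> * of_real (s * z)) * iexp (s * u)))"
      by (simp only:)
    also have "\<dots> = ?k s *\<^sub>R (exp (- \<i> * of_real (s * z)) * char \<mu> s)"
      unfolding char_def by (simp only: integral_scaleR_right integral_mult_right_zero)
    finally show "(CLINT u|\<mu>. ?g u s) = ?k s *\<^sub>R (exp (- \<i> * of_real (s * z)) * char \<mu> s)" .
  qed
  finally show ?thesis .
qed

text \<open>The spline vanishes beyond \<open>2 * N * \<delta>\<close>, so only the values of the
  characteristic functions on \<open>{- R..R}\<close> enter. The strict inequality for
  \<open>R\<close> leaves room for the integrand to vanish near the endpoints, and the gauge
  integral is the form in which integration by parts is available.\<close>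

lemma smoothed_density_diff_eq_integral:
  assumes \<mu>: "real_distribution \<mu>" and \<nu>: "real_distribution \<nu>" and \<delta>: "0 < \<delta>" and N: "1 \<le> N"
    and R: "2 * real N * \<delta> < R"
  shows "complex_of_real (smoothed_density (jackson N \<delta>) \<mu> z - smoothed_density (jackson N \<delta>) \<nu> z) =
    integral {- R..R} (\<lambda>s. exp (- \<i> * of_real (s * z)) * (spline \<delta> (2 * N - 1) s * (char \<mu> s - char \<nu> s))) / (2 * sinc_mass N)"
    and "(\<lambda>s. exp (- \<i> * of_real (s * z)) * (spline \<delta> (2 * N - 1) s * (char \<mu> s - char \<nu> s))) integrable_on {- R..R}"
proof -
  let ?k = "spline \<delta> (2 * N - 1)" and ?e = "\<lambda>s. exp (- \<i> * of_real (s * z))"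
  have int: "integrable lborel (\<lambda>s. ?k s *\<^sub>R (?e s * char \<rho> s))" if "real_distribution \<rho>" for \<rho>
  proof (rule Bochner_Integration.integrable_bound[OF spline_integrable[OF \<delta>, of "2 * N - 1"]])
    interpret real_distribution \<rho> by (rule that)
    show "(\<lambda>s. ?k s *\<^sub>R (?e s * char \<rho> s)) \<in> borel_measurable lborel" by measurable
    show "AE s in lborel. norm (?k s *\<^sub>R (?e s * char \<rho> s)) \<le> norm (?k s)"
      using cmod_char_le_1 by (intro AE_I2) (auto simp: norm_mult intro!: mult_left_le)
  qed
  let ?f = "\<lambda>s. ?e s * (?k s * (char \<mu> s - char \<nu> s))"
  have f: "?f s = ?k s *\<^sub>R (?e s * char \<mu> s) - ?k s *\<^sub>R (?e s * char \<nu> s)" for s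
    by (simp add: scaleR_conv_of_real algebra_simps)
  have intf: "integrable lborel ?f" unfolding f by (intro Bochner_Integration.integrable_diff int \<mu> \<nu>)
  have ind: "indicator {- R..R} s *\<^sub>R ?f s = ?f s" for s
  proof (cases "s \<in> {- R..R}")
    case False
    then have "R < \<bar>s\<bar>" by auto
    moreover have "real (2 * N - 1) + 1 = 2 * real N" using N by linarith
    ultimately have "?k s = 0" using R by (intro spline_support[OF \<delta>]) auto
    then show ?thesis by simp
  qed simp
  have si: "set_integrable lborel {- R..R} ?f" unfolding set_integrable_def ind by (rule intf)
  show "?f integrable_on {- R..R}" using set_borel_integral_eq_integral(1)[OF si] .
  have "complex_of_real (smoothed_density (jackson N \<delta>) \<mu> z - smoothed_density (jackson N \<delta>) \<nu> z) =
    ((CLINT s|lborel. ?k s *\<^sub>R (?e s * char \<mu> s)) - (CLINT s|lborel. ?k s *\<^sub>R (?e s * char \<nu> s))) / (2 * sinc_mass N)"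
    unfolding of_real_diff smoothed_density_jackson_eq_char[OF \<mu> \<delta> N] smoothed_density_jackson_eq_char[OF \<nu> \<delta> N]
    by (simp only: diff_divide_distrib)
  also have "(CLINT s|lborel. ?k s *\<^sub>R (?e s * char \<mu> s)) - (CLINT s|lborel. ?k s *\<^sub>R (?e s * char \<nu> s)) = (CLINT s|lborel. ?f s)"
    unfolding f by (intro Bochner_Integration.integral_diff[symmetric] int \<mu> \<nu>)
  also have "\<dots> = integral {- R..R} ?f"
    using set_borel_integral_eq_integral(2)[OF si] unfolding set_lebesgue_integral_def ind .
  finally show "complex_of_real (smoothed_density (jackson N \<delta>) \<mu> z - smoothed_density (jackson N \<delta>) \<nu> z) =
    integral {- R..R} ?f / (2 * sinc_mass N)" .
qed

section \<open>From decay of densities to decay of distribution functions\<close>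

lemma has_bochner_integral_power_tail:
  assumes "0 \<le> a" "1 \<le> m"
  shows "has_bochner_integral lborel (\<lambda>z. indicator {a..} z * inverse ((1 + \<bar>z\<bar>) ^ Suc m)) (inverse ((1 + a) ^ m) / real m)"
proof (rule has_bochner_integral_nn_integral)
  let ?F = "\<lambda>z::real. - (inverse ((1 + z) ^ m) / real m)"
  obtain k where k: "m = Suc k" using assms(2) by (cases m) auto
  have D: "((\<lambda>p. - (inverse (p ^ Suc k) / c)) has_real_derivative inverse (p ^ Suc (Suc k))) (at p)"
    if "p \<noteq> 0" "c = real (Suc k)" for p c :: real
  proof -
    have "((\<lambda>p. - (inverse (p ^ Suc k) / c)) has_real_derivative - (- (inverse (p ^ Suc k) * (c * p ^ k) * inverse (p ^ Suc k)) / c)) (at p)"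
      using DERIV_minus[OF DERIV_cdivide[OF DERIV_inverse'[OF DERIV_pow[of "Suc k" p]], of c]] that
      by (simp del: power_Suc of_nat_Suc)
    moreover have "c \<noteq> 0" using that by simp
    ultimately show ?thesis using that(1) by (simp add: field_simps)
  qed
  have "(\<integral>\<^sup>+ z. ennreal (inverse ((1 + z) ^ Suc m)) * indicator {a..} z \<partial>lborel) = ennreal (0 - ?F a)"
  proof (rule nn_integral_FTC_atLeast)
    fix z assume z: "a \<le> z"
    then have "1 + z \<noteq> 0" using assms by auto
    from D[OF this refl] show "(?F has_real_derivative inverse ((1 + z) ^ Suc m)) (at z)"
      using DERIV_shift[of "\<lambda>p. - (inverse (p ^ m) / real m)" _ z 1] unfolding k by (simp add: add.commute)
    show "0 \<le> inverse ((1 + z) ^ Suc m)" using z assms by auto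
  next
    have "filterlim (\<lambda>z::real. (1 + z) ^ m) at_infinity at_top"
      using assms(2)
      by (intro filterlim_at_top_imp_at_infinity filterlim_pow_at_top
          filterlim_tendsto_add_at_top[OF tendsto_const] filterlim_ident) auto
    from tendsto_minus[OF tendsto_divide[OF filterlim_compose[OF tendsto_inverse_0 this] tendsto_const[of "real m"]]]
    show "(?F \<longlongrightarrow> 0) at_top" using assms(2) by simp
  qed measurable
  also have "(\<integral>\<^sup>+ z. ennreal (inverse ((1 + z) ^ Suc m)) * indicator {a..} z \<partial>lborel) =
      (\<integral>\<^sup>+ z. ennreal (indicator {a..} z * inverse ((1 + \<bar>z\<bar>) ^ Suc m)) \<partial>lborel)"
    using assms(1) by (intro nn_integral_cong) (auto split: split_indicator)
  finally show "(\<integral>\<^sup>+ z. ennreal (indicator {a..} z * inverse ((1 + \<bar>z\<bar>) ^ Suc m)) \<partial>lborel) = ennreal (inverse ((1 + a) ^ m) / real m)"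
    by simp
qed (use assms in auto)

text \<open>Integrating decay of order \<open>m + 1\<close> from \<open>a\<close> onwards leaves
  order \<open>m\<close>; the factor \<open>1 / m\<close> from the antiderivative is at most 1 and
  is dropped.\<close>

lemma tail_integral_le:
  fixes d :: "real \<Rightarrow> real"
  assumes d: "\<And>z. (1 + \<bar>z\<bar>) ^ Suc m * \<bar>d z\<bar> \<le> b" and m: "1 \<le> m" and a: "0 \<le> a"
    and [measurable]: "d \<in> borel_measurable borel"
  shows "\<bar>LINT z|lborel. indicator {a..} z * d z\<bar> * (1 + a) ^ m \<le> b"
proof -
  let ?g = "\<lambda>z. b * (indicator {a..} z * inverse ((1 + \<bar>z\<bar>) ^ Suc m))"
  have b: "0 \<le> b" using d[of 0] abs_ge_zero[of "d 0"] by simp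
  have g: "integrable lborel ?g" "(LINT z|lborel. ?g z) = b * inverse ((1 + a) ^ m) / real m"
    using has_bochner_integral_power_tail[OF a m] by (auto simp: has_bochner_integral_iff)
  have dg: "norm (indicator {a..} z * d z) \<le> ?g z" for z
  proof -
    have "0 < (1 + \<bar>z\<bar>) ^ Suc m" by (intro zero_less_power) auto
    then have "\<bar>d z\<bar> \<le> b * inverse ((1 + \<bar>z\<bar>) ^ Suc m)"
      using d[of z] by (simp add: divide_inverse[symmetric] pos_le_divide_eq mult.commute del: power_Suc)
    then show ?thesis by (auto split: split_indicator)
  qed
  have "norm (LINT z|lborel. indicator {a..} z * d z) \<le> (LINT z|lborel. norm (indicator {a..} z * d z))"
    by (rule integral_norm_bound)
  also have "\<dots> \<le> (LINT z|lborel. ?g z)"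
  proof (rule integral_mono[OF _ g(1) dg])
    show "integrable lborel (\<lambda>z. norm (indicator {a..} z * d z))"
      by (rule Bochner_Integration.integrable_bound[OF g(1)])
         (measurable, use dg in \<open>auto intro: order_trans[OF _ abs_ge_self]\<close>)
  qed
  also have "\<dots> = b * inverse (real m) * inverse ((1 + a) ^ m)" using g(2) by (simp add: field_simps)
  also have "\<dots> \<le> b * 1 * inverse ((1 + a) ^ m)"
    using b m a by (intro mult_right_mono mult_left_mono) (auto simp: field_simps)
  finally show ?thesis using a by (simp add: field_simps)
qed

text \<open>The smoothed difference at \<open>x\<close> is the integral of the density difference
  over \<open>{..x}\<close>, a tail if \<open>x \<le> 0\<close>. If \<open>x > 0\<close>, both
  densities have mass 1, so up to sign it equals the integral over the opposite tail
  \<open>{x..}\<close>.\<close>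

lemma smoothed_cdf_diff_le:
  assumes [measurable]: "r \<in> borel_measurable borel" and r: "\<And>y. 0 \<le> r y" "integrable lborel r" "(LINT y|lborel. r y) = 1"
    and \<mu>: "real_distribution \<mu>" and \<nu>: "real_distribution \<nu>" and m: "1 \<le> m"
    and d: "\<And>z. (1 + \<bar>z\<bar>) ^ Suc m * \<bar>smoothed_density r \<mu> z - smoothed_density r \<nu> z\<bar> \<le> b"
  shows "\<bar>LINT y|lborel. r y * (cdf \<mu> (x - y) - cdf \<nu> (x - y))\<bar> * (1 + \<bar>x\<bar>) ^ m \<le> b"
proof -
  let ?d = "\<lambda>z. smoothed_density r \<mu> z - smoothed_density r \<nu> z"
  note q = smoothed_density_integrable[OF assms(1) r] smoothed_density_mass[OF assms(1) r]
  have int_d: "integrable lborel ?d" by (intro Bochner_Integration.integrable_diff q \<mu> \<nu>)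
  then have [measurable]: "?d \<in> borel_measurable borel" by auto
  have ind: "integrable lborel (\<lambda>z. indicator A z * f z)" if "A \<in> sets borel" "integrable lborel f" for A and f :: "real \<Rightarrow> real"
    using integrable_mult_indicator[of A lborel f] that by simp
  have int_cdf: "integrable lborel (\<lambda>y. r y * cdf \<rho> (x - y))" if "real_distribution \<rho>" for \<rho>
  proof -
    interpret real_distribution \<rho> by (rule that)
    have [measurable]: "cdf \<rho> \<in> borel_measurable borel"
      by (intro borel_measurable_mono monoI cdf_nondecreasing)
    show ?thesis
      by (rule Bochner_Integration.integrable_bound[OF r(2)])
         (auto intro!: AE_I2 mult_left_le cdf_bounded_prob simp: abs_mult cdf_nonneg)
  qed
  have "(LINT y|lborel. r y * (cdf \<mu> (x - y) - cdf \<nu> (x - y))) = (LINT y|lborel. r y * cdf \<mu> (x - y)) - (LINT y|lborel. r y * cdf \<nu> (x - y))"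
    unfolding right_diff_distrib by (intro Bochner_Integration.integral_diff int_cdf \<mu> \<nu>)
  also have "\<dots> = (LINT z|lborel. indicator {..x} z * ?d z)"
    unfolding smoothed_cdf[OF assms(1) r \<mu>] smoothed_cdf[OF assms(1) r \<nu>] right_diff_distrib
    by (intro Bochner_Integration.integral_diff[symmetric] ind q \<mu> \<nu>) auto
  finally have eq: "(LINT y|lborel. r y * (cdf \<mu> (x - y) - cdf \<nu> (x - y))) = (LINT z|lborel. indicator {..x} z * ?d z)" .
  show ?thesis
  proof (cases "x \<le> 0")
    case True
    have "(LINT z|lborel. indicator {..x} z * ?d z) = (LINT z|lborel. indicator {- x..} z * ?d (- z))"
      by (subst lborel_integral_real_affine[where c="-1" and t=0])
         (auto intro!: Bochner_Integration.integral_cong split: split_indicator)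
    also have "\<bar>\<dots>\<bar> * (1 + (- x)) ^ m \<le> b"
      by (rule tail_integral_le) (use d[of "- z" for z] m True in auto)
    finally show ?thesis using True eq by simp
  next
    case False
    have "(LINT z|lborel. ?d z) = 0"
      using q(1)[OF \<mu>] q(1)[OF \<nu>] by (simp add: q(2)[OF \<mu>] q(2)[OF \<nu>])
    also have "(LINT z|lborel. ?d z) = (LINT z|lborel. indicator {..x} z * ?d z + indicator {x..} z * ?d z)"
      by (rule integral_cong_AE, measurable)
         (use AE_lborel_singleton[of x] in \<open>auto split: split_indicator\<close>)
    also have "\<dots> = (LINT z|lborel. indicator {..x} z * ?d z) + (LINT z|lborel. indicator {x..} z * ?d z)"
      by (intro Bochner_Integration.integral_add ind int_d) auto
    finally have "(LINT z|lborel. indicator {..x} z * ?d z) = - (LINT z|lborel. indicator {x..} z * ?d z)" by simp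
    moreover have "\<bar>LINT z|lborel. indicator {x..} z * ?d z\<bar> * (1 + x) ^ m \<le> b"
      by (rule tail_integral_le) (use d m False in auto)
    ultimately show ?thesis using False eq by simp
  qed
qed

subsection \<open>Removing the smoothing\<close>

text \<open>For \<open>\<bar>y\<bar> \<le> a\<close> the weighted difference inside the smoothing
  integral is at least \<open>V - E\<close>, where \<open>E\<close> bounds the variation of
  \<open>G\<close>. For larger \<open>\<bar>y\<bar>\<close> it is at least \<open>- \<Delta>\<close>
  times the possible growth of the weight, and the kernel gives this region total size at most
  \<open>1 / 4\<close>. So \<open>V\<close> is controlled by the smoothed difference plus a fraction
  of \<open>\<Delta>\<close> below 1, which is what makes the supremum absorbable later.\<close>

lemma desmoothing_one_sided:
  fixes F G w r :: "real \<Rightarrow> real"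
  assumes r [measurable]: "r \<in> borel_measurable borel" and r0: "\<And>y. 0 \<le> r y"
    and r1: "(LINT y|lborel. r y) = 1"
    and r_mom: "integrable lborel (\<lambda>y. r y * (1 + 2 * \<bar>y\<bar>) ^ m)"
    and F: "mono F" "\<And>x. \<bar>F x\<bar> \<le> 1" and G [measurable]: "G \<in> borel_measurable borel" and G1: "\<And>x. \<bar>G x\<bar> \<le> 1"
    and w: "\<And>x. 0 < w x" "\<And>x z. w x \<le> w z * (1 + \<bar>x - z\<bar>) ^ m"
    and \<Delta>: "\<And>x. \<bar>F x - G x\<bar> * w x \<le> \<Delta>"
    and smooth: "\<And>x. \<bar>LINT y|lborel. r y * (F (x - y) - G (x - y))\<bar> * w x \<le> b"
    and incr: "\<And>x y. \<bar>G y - G x\<bar> * w x \<le> K * \<bar>y - x\<bar> * (1 + \<bar>y - x\<bar>) ^ m" and K: "0 \<le> K"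
    and a: "0 \<le> a" and tail: "(LINT y|lborel. indicator {y. a < \<bar>y\<bar>} y * (r y * (1 + 2 * \<bar>y\<bar>) ^ m)) \<le> 1 / 4"
  shows "(F x - G x) * w x \<le> 2 * b * (1 + a) ^ m + 2 * K * a * (1 + 2 * a) ^ m + \<Delta> / 2"
proof -
  define E where "E = 2 * K * a * (1 + 2 * a) ^ m"
  define V where "V = (F x - G x) * w x"
  let ?I = "\<lambda>y. indicator {y. a < \<bar>y\<bar>} y :: real"
  let ?M = "\<lambda>y. (1 + 2 * \<bar>y\<bar>) ^ m"
  \<comment> \<open>The smoothed difference is evaluated at \<open>x + a\<close>: for \<open>\<bar>y\<bar> \<le> a\<close> the point \<open>x + a - y\<close> then lies to the right of \<open>x\<close>,
    where monotonicity bounds \<open>F\<close> from below by \<open>F x\<close>.\<close>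
  let ?D = "\<lambda>y. F (x + a - y) - G (x + a - y)"
  have E0: "0 \<le> E" unfolding E_def using K a by simp
  have \<Delta>0: "0 \<le> \<Delta>"
    using \<Delta>[of 0] w(1)[of 0] by (meson abs_ge_zero less_imp_le mult_nonneg_nonneg order_trans)
  have b0: "0 \<le> b" using smooth[of 0] w(1)[of 0] by (meson abs_ge_zero less_imp_le mult_nonneg_nonneg order_trans)
  have [measurable]: "F \<in> borel_measurable borel" using F(1) by (rule borel_measurable_mono)
  \<comment> \<open>A function that is not integrable has Bochner integral 0 by convention, so mass
    1 already implies integrability.\<close>
  have r_int: "integrable lborel r"
    using r1 not_integrable_integral_eq[of lborel r] by fastforce
  have int_ind: "integrable lborel (\<lambda>y. ?I y * f y)" if "integrable lborel f" for f :: "real \<Rightarrow> real"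
    using integrable_mult_indicator[of "{y. a < \<bar>y\<bar>}" lborel f] that by simp
  have int_D: "integrable lborel (\<lambda>y. r y * ?D y)"
  proof (rule Bochner_Integration.integrable_bound[where f="\<lambda>y. 2 * r y"])
    show "AE y in lborel. norm (r y * ?D y) \<le> norm (2 * r y)"
    proof (rule AE_I2)
      fix y
      have "\<bar>?D y\<bar> \<le> 2" using F(2)[of "x + a - y"] G1[of "x + a - y"] by linarith
      then have "\<bar>?D y\<bar> * r y \<le> 2 * r y" using r0 by (intro mult_right_mono)
      then show "norm (r y * ?D y) \<le> norm (2 * r y)" using r0[of y] by (simp add: abs_mult mult.commute)
    qed
  qed (use r_int in auto)
  \<comment> \<open>One inequality for both regions: outside the window the term with
    \<open>\<bar>V - E\<bar>\<close> cancels \<open>(V - E) * r y\<close>, inside it vanishes. The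
    moment uses \<open>1 + 2 * \<bar>y\<bar>\<close> because the evaluation point differs from
    \<open>x\<close> by \<open>\<bar>a - y\<bar>\<close>, which is at most
    \<open>2 * \<bar>y\<bar>\<close> when \<open>a < \<bar>y\<bar>\<close>.\<close>
  have lower: "(V - E) * r y - \<bar>V - E\<bar> * (?I y * r y) - \<Delta> * (?I y * (r y * ?M y)) \<le> w x * (r y * ?D y)" for y
  proof (cases "a < \<bar>y\<bar>")
    case True
    have "- (\<Delta> * ?M y) \<le> w x * ?D y"
    proof -
      have "w x \<le> w (x + a - y) * (1 + \<bar>x - (x + a - y)\<bar>) ^ m" by (rule w)
      also have "\<dots> \<le> w (x + a - y) * ?M y"
        using w(1)[of "x + a - y"] True a by (intro mult_left_mono power_mono) auto
      finally have "\<bar>?D y\<bar> * w x \<le> \<bar>?D y\<bar> * (w (x + a - y) * ?M y)" by (rule mult_left_mono) simp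
      also have "\<dots> = (\<bar>?D y\<bar> * w (x + a - y)) * ?M y" by simp
      also have "\<dots> \<le> \<Delta> * ?M y" by (intro mult_right_mono \<Delta>) simp
      finally have "\<bar>w x * ?D y\<bar> \<le> \<Delta> * ?M y" using w(1)[of x] by (simp add: abs_mult mult.commute)
      then show ?thesis by linarith
    qed
    then have "- (\<Delta> * ?M y) * r y \<le> w x * ?D y * r y" using r0 by (intro mult_right_mono)
    moreover have "(V - E) * r y \<le> \<bar>V - E\<bar> * r y" using r0 by (intro mult_right_mono) auto
    ultimately show ?thesis using True by (simp add: mult_ac)
  next
    case False
    then have v: "0 \<le> a - y" "a - y \<le> 2 * a" by auto
    have "F x \<le> F (x + a - y)" using v by (intro monoD[OF F(1)]) auto
    then have "(F x - G x) * w x - (G (x + a - y) - G x) * w x \<le> w x * ?D y"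
      using w(1)[of x] by (simp add: algebra_simps)
    moreover have "(G (x + a - y) - G x) * w x \<le> E"
    proof -
      have "(G (x + a - y) - G x) * w x \<le> \<bar>G (x + a - y) - G x\<bar> * w x"
        using w(1)[of x] by (intro mult_right_mono) auto
      also have "\<dots> \<le> K * \<bar>x + a - y - x\<bar> * (1 + \<bar>x + a - y - x\<bar>) ^ m" by (rule incr)
      also have "\<dots> \<le> K * (2 * a) * (1 + 2 * a) ^ m"
        using v K by (intro mult_mono power_mono mult_nonneg_nonneg) auto
      finally show ?thesis unfolding E_def by (simp add: mult_ac)
    qed
    ultimately have "V - E \<le> w x * ?D y" unfolding V_def by linarith
    then have "(V - E) * r y \<le> w x * ?D y * r y" using r0 by (intro mult_right_mono)
    then show ?thesis using False by (simp add: mult_ac)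
  qed
  have \<tau>: "(LINT y|lborel. ?I y * r y) \<le> 1 / 4"
  proof -
    have "(LINT y|lborel. ?I y * r y) \<le> (LINT y|lborel. ?I y * (r y * ?M y))"
    proof (rule integral_mono)
      fix y
      have "r y * 1 \<le> r y * ?M y" by (intro mult_left_mono one_le_power r0) simp
      then show "?I y * r y \<le> ?I y * (r y * ?M y)" by (auto split: split_indicator)
    qed (intro int_ind r_int r_mom)+
    with tail show ?thesis by linarith
  qed
  have "(V - E) * 1 - \<bar>V - E\<bar> * (LINT y|lborel. ?I y * r y) - \<Delta> * (LINT y|lborel. ?I y * (r y * ?M y))
      = (LINT y|lborel. (V - E) * r y - \<bar>V - E\<bar> * (?I y * r y) - \<Delta> * (?I y * (r y * ?M y)))"
    using r_int r_mom int_ind[OF r_int] int_ind[OF r_mom] r1 by simp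
  also have "\<dots> \<le> (LINT y|lborel. w x * (r y * ?D y))"
    by (intro integral_mono lower Bochner_Integration.integrable_diff integrable_mult_right int_D int_ind r_int r_mom)
  also have "\<dots> = w x * (LINT y|lborel. r y * ?D y)" by simp
  also have "\<dots> \<le> w x * \<bar>LINT y|lborel. r y * ?D y\<bar>" using w(1)[of x] by (intro mult_left_mono) auto
  also have "\<dots> \<le> w (x + a) * (1 + a) ^ m * \<bar>LINT y|lborel. r y * ?D y\<bar>"
    using w(2)[of x "x + a"] a by (intro mult_right_mono) auto
  also have "\<dots> = (\<bar>LINT y|lborel. r y * ?D y\<bar> * w (x + a)) * (1 + a) ^ m" by simp
  also have "\<dots> \<le> b * (1 + a) ^ m" using smooth[of "x + a"] a by (intro mult_right_mono) auto
  finally have *: "(V - E) - \<bar>V - E\<bar> * (LINT y|lborel. ?I y * r y) - \<Delta> * (LINT y|lborel. ?I y * (r y * ?M y)) \<le> b * (1 + a) ^ m"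
    by simp
  have "\<bar>V - E\<bar> * (LINT y|lborel. ?I y * r y) \<le> \<bar>V - E\<bar> * (1 / 4)" by (intro mult_left_mono \<tau>) auto
  moreover have "\<Delta> * (LINT y|lborel. ?I y * (r y * ?M y)) \<le> \<Delta> * (1 / 4)" by (intro mult_left_mono tail \<Delta>0)
  moreover have "0 \<le> b * (1 + a) ^ m" using b0 a by simp
  \<comment> \<open>If \<open>V - E\<close> is nonnegative, then
    \<open>3 / 4 * (V - E) \<le> b * (1 + a) ^ m + \<Delta> / 4\<close>; the resulting factors
    \<open>4 / 3\<close> and \<open>1 / 3\<close> are rounded up to 2 and \<open>1 / 2\<close>. If
    it is negative, the right-hand side is nonnegative anyway.\<close>
  ultimately have "V - E \<le> 2 * (b * (1 + a) ^ m) + \<Delta> / 2" using * \<Delta>0 by (cases "0 \<le> V - E") auto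
  then show ?thesis unfolding V_def E_def by simp
qed

text \<open>The bound \<open>L\<close> on the weight enters only to make the supremum
  \<open>\<Delta>\<close> of the weighted difference finite; it does not occur in the conclusion.
  Then \<open>\<Delta> \<le> ?A + \<Delta> / 2\<close> yields
  \<open>\<Delta> \<le> 2 * ?A\<close>.\<close>

lemma desmoothing:
  fixes F G w r :: "real \<Rightarrow> real"
  assumes r [measurable]: "r \<in> borel_measurable borel" and r0: "\<And>y. 0 \<le> r y" and r_even: "\<And>y. r (- y) = r y"
    and r1: "(LINT y|lborel. r y) = 1"
    and r_mom: "integrable lborel (\<lambda>y. r y * (1 + 2 * \<bar>y\<bar>) ^ m)"
    and F: "mono F" "\<And>x. \<bar>F x\<bar> \<le> 1" and G [measurable]: "G \<in> borel_measurable borel" and G1: "\<And>x. \<bar>G x\<bar> \<le> 1"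
    and w: "\<And>x. 0 < w x" "\<And>x z. w x \<le> w z * (1 + \<bar>x - z\<bar>) ^ m" and w_bdd: "\<And>x. w x \<le> L"
    and smooth: "\<And>x. \<bar>LINT y|lborel. r y * (F (x - y) - G (x - y))\<bar> * w x \<le> b"
    and incr: "\<And>x y. \<bar>G y - G x\<bar> * w x \<le> K * \<bar>y - x\<bar> * (1 + \<bar>y - x\<bar>) ^ m" and K: "0 \<le> K"
    and a: "0 \<le> a" and tail: "(LINT y|lborel. indicator {y. a < \<bar>y\<bar>} y * (r y * (1 + 2 * \<bar>y\<bar>) ^ m)) \<le> 1 / 4"
  shows "\<bar>F x - G x\<bar> * w x \<le> 4 * b * (1 + a) ^ m + 4 * K * a * (1 + 2 * a) ^ m"
proof -
  let ?A = "2 * b * (1 + a) ^ m + 2 * K * a * (1 + 2 * a) ^ m"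
  have step: "\<bar>F x - G x\<bar> * w x \<le> ?A + \<Delta> / 2" if \<Delta>: "\<And>x. \<bar>F x - G x\<bar> * w x \<le> \<Delta>" for x \<Delta>
  proof -
    have "(F x - G x) * w x \<le> ?A + \<Delta> / 2"
      by (rule desmoothing_one_sided[OF r r0 r1 r_mom F G G1 w \<Delta> smooth incr K a tail])
    \<comment> \<open>The lower estimate comes from the reflection
      \<open>x \<mapsto> - F (- x)\<close>, which is again monotone; evenness of \<open>r\<close>
      carries the smoothed difference over.\<close>
    moreover have "((- F (- (- x))) - (- G (- (- x)))) * w (- (- x)) \<le> ?A + \<Delta> / 2"
    proof (rule desmoothing_one_sided[where F="\<lambda>x. - F (- x)" and G="\<lambda>x. - G (- x)" and w="\<lambda>x. w (- x)" and x="- x", OF r r0 r1 r_mom])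
      show "mono (\<lambda>x. - F (- x))" using F(1) by (auto simp: mono_def)
      show "w (- x) \<le> w (- z) * (1 + \<bar>x - z\<bar>) ^ m" for x z using w(2)[of "- x" "- z"] by (simp add: abs_minus_commute)
      show "\<bar>- F (- x) - - G (- x)\<bar> * w (- x) \<le> \<Delta>" for x using \<Delta>[of "- x"] by (simp add: abs_minus_commute)
      show "\<bar>- G (- y) - - G (- x)\<bar> * w (- x) \<le> K * \<bar>y - x\<bar> * (1 + \<bar>y - x\<bar>) ^ m" for x y
        using incr[of "- y" "- x"] by (simp add: abs_minus_commute)
      show "\<bar>LINT y|lborel. r y * (- F (- (x - y)) - - G (- (x - y)))\<bar> * w (- x) \<le> b" for x
      proof -
        have "(LINT y|lborel. r y * (- F (- (x - y)) - - G (- (x - y)))) =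
            (LINT y|lborel. - (r y * (F (- x - y) - G (- x - y))))"
          by (subst lborel_integral_real_affine[where c="-1" and t=0])
             (auto intro!: Bochner_Integration.integral_cong simp: r_even algebra_simps)
        then show ?thesis using smooth[of "- x"] by simp
      qed
    qed (use F G1 w K a tail in auto)
    then have "(G x - F x) * w x \<le> ?A + \<Delta> / 2" by simp
    ultimately show ?thesis by (simp add: abs_real_def)
  qed
  define \<Delta> where "\<Delta> = (SUP x. \<bar>F x - G x\<bar> * w x)"
  have "\<bar>F x - G x\<bar> * w x \<le> 2 * L" for x
    using F(2)[of x] G1[of x] w(1)[of x] w_bdd[of x] by (intro mult_mono) auto
  then have bdd: "bdd_above (range (\<lambda>x. \<bar>F x - G x\<bar> * w x))" by (intro bdd_aboveI[of _ "2 * L"]) auto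
  have *: "\<bar>F x - G x\<bar> * w x \<le> \<Delta>" for x unfolding \<Delta>_def by (rule cSUP_upper[OF UNIV_I bdd])
  have "\<Delta> \<le> ?A + \<Delta> / 2" unfolding \<Delta>_def using step[OF *] unfolding \<Delta>_def by (intro cSUP_least) auto
  with *[of x] show ?thesis by simp
qed

section \<open>Gaussian decay and increments of the normal distribution function\<close>

lemma power_mult_gaussian_bounded:
  "\<exists>G>0. \<forall>t::real. (1 + \<bar>t\<bar>) ^ Q * exp (- t\<^sup>2 / 4) \<le> G * inverse (1 + t\<^sup>2)"
proof -
  \<comment> \<open>With \<open>u = 1 + \<bar>t\<bar>\<close>, the \<open>k\<close>-th power of
    \<open>z \<le> exp z\<close> at \<open>z = u\<^sup>2 / (8 * k)\<close> gives
    \<open>u ^ (2 * k) \<le> (8 * k) ^ k * exp (u\<^sup>2 / 8)\<close>, and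
    \<open>u\<^sup>2 / 8 \<le> 1 / 4 + t\<^sup>2 / 4\<close>. This is the source of
    \<open>?G\<close>; the 2 in \<open>k = Q + 2\<close> pays for the factor
    \<open>1 + t\<^sup>2\<close>.\<close>
  define k where "k = Q + 2"
  have k: "0 < real k" unfolding k_def by simp
  let ?G = "exp (1 / 4) * (8 * real k) ^ k"
  have "(1 + \<bar>t\<bar>) ^ Q * exp (- t\<^sup>2 / 4) \<le> ?G * inverse (1 + t\<^sup>2)" for t :: real
  proof -
    let ?u = "1 + \<bar>t\<bar>"
    have sq: "0 \<le> (\<bar>t\<bar> - 1)\<^sup>2" by simp
    have "?u\<^sup>2 / (8 * k) \<le> exp (?u\<^sup>2 / (8 * k))"
      using exp_ge_add_one_self[of "?u\<^sup>2 / (8 * k)"] by linarith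
    then have "(?u\<^sup>2 / (8 * k)) ^ k \<le> exp (?u\<^sup>2 / (8 * k)) ^ k" by (intro power_mono) auto
    also have "\<dots> = exp (?u\<^sup>2 / 8)" using k by (subst exp_of_nat_mult[symmetric]) (simp add: field_simps)
    finally have "(?u\<^sup>2) ^ k \<le> (8 * real k) ^ k * exp (?u\<^sup>2 / 8)"
      using k by (simp add: power_divide pos_divide_le_eq mult.commute)
    also have "\<dots> \<le> (8 * real k) ^ k * exp (1 / 4 + t\<^sup>2 / 4)"
      using sq by (intro mult_left_mono) (auto simp: power2_eq_square algebra_simps)
    also have "\<dots> = ?G * exp (t\<^sup>2 / 4)" by (simp add: exp_add)
    finally have 1: "(?u\<^sup>2) ^ k \<le> ?G * exp (t\<^sup>2 / 4)" .
    have "1 + t\<^sup>2 \<le> ?u\<^sup>2" by (simp add: power2_eq_square algebra_simps)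
    then have "?u ^ Q * (1 + t\<^sup>2) \<le> ?u ^ Q * ?u\<^sup>2" by (intro mult_left_mono) auto
    also have "\<dots> = ?u ^ k" unfolding k_def by (simp add: power_add power2_eq_square)
    also have "\<dots> \<le> ?u ^ (2 * k)" by (intro power_increasing) auto
    also have "\<dots> = (?u\<^sup>2) ^ k" by (rule power_mult)
    also note 1
    finally have 2: "?u ^ Q * (1 + t\<^sup>2) \<le> ?G * exp (t\<^sup>2 / 4)" .
    have "0 < 1 + t\<^sup>2" by (simp add: add_pos_nonneg)
    with 2 have "?u ^ Q \<le> ?G * exp (t\<^sup>2 / 4) / (1 + t\<^sup>2)" by (simp add: pos_le_divide_eq)
    then have "?u ^ Q * exp (- t\<^sup>2 / 4) \<le> ?G * exp (t\<^sup>2 / 4) / (1 + t\<^sup>2) * exp (- t\<^sup>2 / 4)" by (intro mult_right_mono) auto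
    also have "\<dots> = ?G * (exp (t\<^sup>2 / 4) * exp (- t\<^sup>2 / 4)) * inverse (1 + t\<^sup>2)" by (simp only: divide_inverse mult_ac)
    also have "exp (t\<^sup>2 / 4) * exp (- t\<^sup>2 / 4) = 1" by (simp add: exp_add[symmetric])
    finally show ?thesis by simp
  qed
  then show ?thesis using k by (intro exI[of _ ?G]) auto
qed

lemma std_normal_density_decay:
  "\<exists>K>0. \<forall>z. std_normal_density z * (1 + \<bar>z\<bar>) ^ s \<le> K"
proof -
  obtain G where G: "G > 0" "\<And>t::real. (1 + \<bar>t\<bar>) ^ s * exp (- t\<^sup>2 / 4) \<le> G * inverse (1 + t\<^sup>2)"
    using power_mult_gaussian_bounded by blast
  have "std_normal_density z * (1 + \<bar>z\<bar>) ^ s \<le> G" for z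
  proof -
    have "1 / sqrt (2 * pi) \<le> 1" using pi_gt3 by (auto simp: divide_le_eq real_le_rsqrt)
    then have "std_normal_density z * (1 + \<bar>z\<bar>) ^ s \<le> 1 * exp (- z\<^sup>2 / 4) * (1 + \<bar>z\<bar>) ^ s"
      unfolding std_normal_density_def by (intro mult_right_mono mult_mono) auto
    also have "\<dots> \<le> G * inverse (1 + z\<^sup>2)" using G(2)[of z] by (simp add: mult.commute)
    also have "\<dots> \<le> G * 1"
      using G(1) by (intro mult_left_mono) (auto simp: inverse_le_1_iff intro: add_pos_nonneg)
    finally show ?thesis by simp
  qed
  then show ?thesis using G(1) by blast
qed

lemma Phi_diff_le:
  assumes c: "\<And>z. min x y \<le> z \<Longrightarrow> z \<le> max x y \<Longrightarrow> std_normal_density z \<le> c"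
  shows "\<bar>Phi y - Phi x\<bar> \<le> c * \<bar>y - x\<bar>"
proof -
  interpret real_distribution std_normal_distribution by (rule real_dist_normal_dist)
  have *: "\<bar>Phi b - Phi a\<bar> \<le> c * (b - a)"
    if ab: "a < b" and c: "\<And>z. a \<le> z \<Longrightarrow> z \<le> b \<Longrightarrow> std_normal_density z \<le> c" for a b
  proof -
    have c0: "0 \<le> c" using c[of a] ab normal_density_nonneg[of 0 1 a] by linarith
    have "emeasure std_normal_distribution {a<..b} = (\<integral>\<^sup>+z. ennreal (std_normal_density z) * indicator {a<..b} z \<partial>lborel)"
      by (subst emeasure_density) auto
    also have "\<dots> \<le> (\<integral>\<^sup>+z. ennreal c * indicator {a<..b} z \<partial>lborel)"
      using c by (intro nn_integral_mono) (auto split: split_indicator intro: ennreal_leI)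
    also have "\<dots> = ennreal (c * (b - a))" using ab c0 by (simp add: nn_integral_cmult_indicator ennreal_mult)
    finally have "measure std_normal_distribution {a<..b} \<le> c * (b - a)"
      using ab c0 unfolding measure_def by (intro enn2real_leI) auto
    then show ?thesis unfolding Phi_def cdf_diff_eq[OF ab] by simp
  qed
  consider "x < y" | "y < x" | "x = y" by linarith
  then show ?thesis
  proof cases
    case 1
    then show ?thesis using *[of x y] c by simp
  next
    case 2
    then show ?thesis using *[of y x] c by (simp add: abs_minus_commute)
  qed simp
qed

text \<open>A form of Peetre's inequality: a shift changes the polynomial weight at most by the
  weight of the shift.\<close>

lemma one_plus_abs_le_mult: "1 + \<bar>x\<bar> \<le> (1 + \<bar>z\<bar>) * (1 + \<bar>x - z :: real\<bar>)"
proof -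
  have "\<bar>x\<bar> \<le> \<bar>z\<bar> + \<bar>x - z\<bar>" by linarith
  moreover have "0 \<le> \<bar>z\<bar> * \<bar>x - z\<bar>" by simp
  moreover have "(1 + \<bar>z\<bar>) * (1 + \<bar>x - z\<bar>) = 1 + \<bar>z\<bar> + \<bar>x - z\<bar> + \<bar>z\<bar> * \<bar>x - z\<bar>" by (simp add: algebra_simps)
  ultimately show ?thesis by linarith
qed

text \<open>Any \<open>z\<close> between \<open>x\<close> and \<open>y\<close> is within
  \<open>\<bar>y - x\<bar>\<close> of \<open>x\<close>, so the decay of the density at
  \<open>z\<close> can be expressed through the weight at \<open>x\<close> at the cost of
  \<open>(1 + \<bar>y - x\<bar>) ^ m\<close>.\<close>

lemma Phi_weighted_increment:
  assumes K: "\<And>z. std_normal_density z * (1 + \<bar>z\<bar>) ^ m \<le> K"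
  shows "\<bar>Phi y - Phi x\<bar> * (1 + \<bar>x\<bar>) ^ m \<le> K * \<bar>y - x\<bar> * (1 + \<bar>y - x\<bar>) ^ m"
proof -
  have K0: "0 \<le> K" by (rule order_trans[OF _ K[of 0]]) simp
  have "std_normal_density z \<le> K * (1 + \<bar>y - x\<bar>) ^ m / (1 + \<bar>x\<bar>) ^ m" if z: "min x y \<le> z" "z \<le> max x y" for z
  proof -
    have "\<bar>x - z\<bar> \<le> \<bar>y - x\<bar>" using z by (auto simp: min_def max_def split: if_splits)
    then have "(1 + \<bar>x\<bar>) ^ m \<le> ((1 + \<bar>z\<bar>) * (1 + \<bar>y - x\<bar>)) ^ m"
      by (intro power_mono order_trans[OF one_plus_abs_le_mult[of x z]] mult_left_mono) auto
    then have "std_normal_density z * (1 + \<bar>x\<bar>) ^ m \<le> std_normal_density z * ((1 + \<bar>z\<bar>) * (1 + \<bar>y - x\<bar>)) ^ m"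
      by (intro mult_left_mono) auto
    also have "\<dots> = (std_normal_density z * (1 + \<bar>z\<bar>) ^ m) * (1 + \<bar>y - x\<bar>) ^ m" by (simp add: power_mult_distrib)
    also have "\<dots> \<le> K * (1 + \<bar>y - x\<bar>) ^ m" by (intro mult_right_mono K) auto
    finally show ?thesis by (simp add: pos_le_divide_eq)
  qed
  from Phi_diff_le[OF this, of x y] have "\<bar>Phi y - Phi x\<bar> \<le> K * (1 + \<bar>y - x\<bar>) ^ m / (1 + \<bar>x\<bar>) ^ m * \<bar>y - x\<bar>" .
  then show ?thesis by (simp add: pos_le_divide_eq mult_ac)
qed

section \<open>Kernel tails uniform in the scale, and decay of the smoothed density
  difference\<close>

lemma jackson_tail:
  assumes "m + 2 \<le> 2 * N" "0 < e"
  shows "\<exists>a\<ge>0. (LINT y|lborel. jackson N 1 y * (indicator {y. a < \<bar>y\<bar>} y * (1 + \<bar>y\<bar>) ^ m)) \<le> e"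
proof -
  let ?f = "\<lambda>y. jackson N 1 y * (1 + \<bar>y\<bar>) ^ m"
  let ?I = "\<lambda>a y. jackson N 1 y * (indicator {y. a < \<bar>y\<bar>} y * (1 + \<bar>y\<bar>) ^ m)"
  have int: "integrable lborel ?f" using jackson_moment_integrable[of 1 m N] assms by simp
  have "(\<lambda>n. LINT y|lborel. ?I (real n) y) \<longlonglongrightarrow> (LINT y::real|lborel. 0 :: real)"
  proof (rule Bochner_Integration.integral_dominated_convergence[where w="\<lambda>y. \<bar>?f y\<bar>"])
    show "AE y in lborel. (\<lambda>n. ?I (real n) y) \<longlonglongrightarrow> 0"
    proof (rule AE_I2)
      fix y :: real
      obtain n0 where "\<bar>y\<bar> \<le> real n0" using real_arch_simple by blast
      then have "\<forall>\<^sub>F n in sequentially. ?I (real n) y = 0"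
        by (intro eventually_sequentiallyI[of n0]) (auto split: split_indicator)
      then show "(\<lambda>n. ?I (real n) y) \<longlonglongrightarrow> 0" by (rule tendsto_eventually)
    qed
    show "AE y in lborel. norm (?I (real n) y) \<le> \<bar>?f y\<bar>" for n by (auto split: split_indicator)
  qed (use int in auto)
  then have "\<forall>\<^sub>F n in sequentially. (LINT y|lborel. ?I (real n) y) < e"
    using assms(2) by (intro order_tendstoD) auto
  then obtain n where "(LINT y|lborel. ?I (real n) y) < e" unfolding eventually_sequentially by blast
  then show ?thesis by (intro exI[of _ "real n"]) auto
qed

lemma integral_inverse_one_plus_sq_le:
  assumes "0 \<le> T"
  shows "(\<lambda>t::real. inverse (1 + t\<^sup>2)) integrable_on {- T..T}" "integral {- T..T} (\<lambda>t::real. inverse (1 + t\<^sup>2)) \<le> pi"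
proof -
  have "((\<lambda>t::real. inverse (1 + t\<^sup>2)) has_integral arctan T - arctan (- T)) {- T..T}"
    using assms
    by (intro fundamental_theorem_of_calculus)
       (auto simp: has_real_derivative_iff_has_vector_derivative[symmetric] intro!: has_field_derivative_at_within DERIV_arctan)
  then show "(\<lambda>t::real. inverse (1 + t\<^sup>2)) integrable_on {- T..T}" "integral {- T..T} (\<lambda>t::real. inverse (1 + t\<^sup>2)) \<le> pi"
    using arctan_bounded[of T] by (auto simp: has_integral_iff arctan_minus)
qed

lemma one_plus_power_le:
  assumes "0 \<le> (x :: real)"
  shows "(1 + x) ^ n \<le> 2 ^ n * (1 + x ^ n)"
proof -
  have "(1 + x) ^ n \<le> (2 * max 1 x) ^ n" using assms by (intro power_mono) auto
  also have "\<dots> = 2 ^ n * max 1 x ^ n" by (rule power_mult_distrib)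
  also have "\<dots> \<le> 2 ^ n * (1 + x ^ n)" using assms by (intro mult_left_mono) (auto simp: max_def)
  finally show ?thesis .
qed

text \<open>Integration by parts for the product of the spline, which has \<open>2 * N - 2\<close>
  controlled derivatives, with the difference of characteristic functions. The constant collects
  \<open>2 ^ p\<close> from Leibniz, another \<open>2 ^ p\<close> from
  \<open>one_plus_power_le\<close>, \<open>c ^ (2 * N - 2)\<close> from the spline and
  \<open>pi\<close> from the integral of \<open>inverse (1 + t\<^sup>2)\<close>.\<close>

lemma smoothed_density_diff_decay:
  assumes \<mu>: "real_distribution \<mu>" and \<nu>: "real_distribution \<nu>"
    and N: "1 \<le> N" "p \<le> 2 * N - 2" and T: "0 < T" and c: "1 \<le> c" "(2 * real N + 2) / T \<le> c"
    and h: "derivs_bounded p {- T..T} v (\<lambda>t. char \<mu> t - char \<nu> t)"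
    and v: "\<And>t. t \<in> {- T..T} \<Longrightarrow> v t \<le> B * inverse (1 + t\<^sup>2)"
  shows "(1 + \<bar>z\<bar>) ^ p * \<bar>smoothed_density (jackson N (T / (2 * real N + 2))) \<mu> z
      - smoothed_density (jackson N (T / (2 * real N + 2))) \<nu> z\<bar> \<le> 4 ^ p * c ^ (2 * N - 2) * pi / sinc_mass N * B"
proof -
  define \<delta> where "\<delta> = T / (2 * real N + 2)"
  have \<delta>: "0 < \<delta>" unfolding \<delta>_def using T by simp
  \<comment> \<open>The two extra units in the denominator of \<open>\<delta>\<close> leave a gap of
    \<open>2 * \<delta>\<close> between the edge of the spline's support and
    \<open>T\<close>.\<close>
  have "\<delta> * (2 * real N + 2) = T" unfolding \<delta>_def by (simp add: add_nonneg_eq_0_iff)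
  then have T_eq: "T = 2 * real N * \<delta> + 2 * \<delta>" by (simp add: algebra_simps)
  have R: "2 * real N * \<delta> < T" using T_eq \<delta> by linarith
  let ?k = "\<lambda>t. complex_of_real (spline \<delta> (2 * N - 1) t)" and ?h = "\<lambda>t. char \<mu> t - char \<nu> t"
  let ?E = "{- (2 * real N * \<delta>)..2 * real N * \<delta>}"
  define K where "K = 2 ^ p * c ^ (2 * N - 2) * B"
  have B: "0 \<le> B"
    using order_trans[OF norm_ge_zero order_trans[OF derivs_bounded_norm[OF h, of 0] v[of 0]]] T by simp
  have "derivs_bounded (2 * N - 2) UNIV (\<lambda>t. c ^ (2 * N - 2) * indicator ?E t) ?k"
  proof -
    have "Suc (2 * N - 2) = 2 * N - 1" "real (2 * N - 2) + 2 = 2 * real N" using N by auto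
    moreover have "1 / \<delta> \<le> c" using c unfolding \<delta>_def by simp
    ultimately show ?thesis using derivs_bounded_spline[OF \<delta> c(1), of "2 * N - 2"] by simp
  qed
  then have "derivs_bounded p {- T..T} (\<lambda>t. c ^ (2 * N - 2) * indicator ?E t) ?k"
    by (rule derivs_bounded_mono) (use N in auto)
  from derivs_bounded_mult[OF this h]
  have kh: "derivs_bounded p {- T..T} (\<lambda>t. 2 ^ p * (c ^ (2 * N - 2) * indicator ?E t * v t)) (\<lambda>t. ?k t * ?h t)" .
  \<comment> \<open>The product vanishes near the endpoints, so its majorant may be set to 0 at
    \<open>T\<close> and \<open>- T\<close>. Changing two points leaves the integral alone and meets
    the boundary condition of \<open>norm_fourier_integral_le\<close>.\<close>
  let ?w = "\<lambda>t. if \<bar>t\<bar> < T then K * inverse (1 + t\<^sup>2) else 0"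
  have kh: "derivs_bounded p {- T..T} ?w (\<lambda>t. ?k t * ?h t)"
  proof (rule derivs_bounded_mono[OF kh])
    fix t assume t: "t \<in> {- T..T}"
    show "2 ^ p * (c ^ (2 * N - 2) * indicator ?E t * v t) \<le> ?w t"
    proof (cases "t \<in> ?E")
      case True
      then have "\<bar>t\<bar> < T" using R by auto
      moreover have "2 ^ p * (c ^ (2 * N - 2) * v t) \<le> 2 ^ p * (c ^ (2 * N - 2) * (B * inverse (1 + t\<^sup>2)))"
        using c v[OF t] by (intro mult_left_mono) auto
      ultimately show ?thesis using True unfolding K_def by (simp add: mult_ac)
    next
      case False
      then show ?thesis using B c unfolding K_def by auto
    qed
  qed auto
  note I = integral_inverse_one_plus_sq_le[OF less_imp_le[OF T]]
  have w_int: "(?w has_integral K * integral {- T..T} (\<lambda>t. inverse (1 + t\<^sup>2))) {- T..T}"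
  proof (rule has_integral_spike_finite[of "{- T, T}"])
    show "((\<lambda>t. K * inverse (1 + t\<^sup>2)) has_integral K * integral {- T..T} (\<lambda>t. inverse (1 + t\<^sup>2))) {- T..T}"
      by (intro has_integral_mult_right integrable_integral I)
  qed auto
  have w_le: "integral {- T..T} ?w \<le> K * pi"
    using integral_unique[OF w_int] I(2) B c unfolding K_def by (auto intro!: mult_left_mono)
  let ?J = "integral {- T..T} (\<lambda>s. exp (- \<i> * of_real (s * z)) * (?k s * ?h s))"
  note D = smoothed_density_diff_eq_integral[OF \<mu> \<nu> \<delta> N(1) R, of z]
  have J: "\<bar>z\<bar> ^ s * norm ?J \<le> K * pi" if "s \<le> p" for s
  proof -
    have "derivs_bounded s {- T..T} ?w (\<lambda>t. ?k t * ?h t)" by (rule derivs_bounded_mono[OF kh that]) auto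
    from norm_fourier_integral_le[OF _ this _ _ _ D(2)] T w_int w_le show ?thesis by fastforce
  qed
  have "norm (complex_of_real (smoothed_density (jackson N \<delta>) \<mu> z - smoothed_density (jackson N \<delta>) \<nu> z)) = norm ?J / (2 * sinc_mass N)"
    unfolding D(1) norm_divide using sinc_mass_pos[OF N(1)] by simp
  then have eq: "\<bar>smoothed_density (jackson N \<delta>) \<mu> z - smoothed_density (jackson N \<delta>) \<nu> z\<bar> = norm ?J / (2 * sinc_mass N)"
    by (simp only: norm_of_real)
  have "(1 + \<bar>z\<bar>) ^ p * norm ?J \<le> 2 ^ p * (1 + \<bar>z\<bar> ^ p) * norm ?J"
    by (intro mult_right_mono one_plus_power_le) auto
  also have "\<dots> = 2 ^ p * (\<bar>z\<bar> ^ 0 * norm ?J + \<bar>z\<bar> ^ p * norm ?J)" by (simp add: algebra_simps)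
  also have "\<dots> \<le> 2 ^ p * (K * pi + K * pi)" by (intro mult_left_mono add_mono J) auto
  finally have "(1 + \<bar>z\<bar>) ^ p * norm ?J / (2 * sinc_mass N) \<le> 2 ^ p * (K * pi + K * pi) / (2 * sinc_mass N)"
    using sinc_mass_pos[OF N(1)] by (intro divide_right_mono) auto
  also have "\<dots> = 4 ^ p * c ^ (2 * N - 2) * pi / sinc_mass N * B"
  proof -
    have "(4::real) ^ p = 2 ^ p * 2 ^ p" by (simp add: power_mult_distrib[symmetric])
    then show ?thesis unfolding K_def by (simp add: field_simps)
  qed
  finally show ?thesis unfolding eq \<delta>_def[symmetric] by simp
qed

text \<open>In scaled form the kernel's tail beyond \<open>a / \<delta>\<close> does not depend on
  \<open>\<delta>\<close>. The weight in \<open>desmoothing\<close> is unscaled, but for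
  \<open>\<delta> \<ge> \<delta>0\<close> it exceeds the scaled weight by at most
  \<open>(1 + 2 / \<delta>0) ^ m\<close>; so one \<open>a\<close>, chosen with this factor in view,
  serves all scales.\<close>

lemma jackson_scaled_tail_le:
  assumes N: "m + 2 \<le> 2 * N" and \<delta>0: "0 < \<delta>0" "\<delta>0 \<le> \<delta>"
    and a: "(LINT y|lborel. jackson N 1 y * (indicator {y. a < \<bar>y\<bar>} y * (1 + \<bar>y\<bar>) ^ m)) \<le> e / (1 + 2 / \<delta>0) ^ m"
  shows "(LINT y|lborel. indicator {y. a / \<delta> < \<bar>y\<bar>} y * (jackson N \<delta> y * (1 + 2 * \<bar>y\<bar>) ^ m)) \<le> e"
    and "integrable lborel (\<lambda>y. jackson N \<delta> y * (1 + 2 * \<bar>y\<bar>) ^ m)"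
proof -
  have \<delta>: "0 < \<delta>" using \<delta>0 by linarith
  have N1: "1 \<le> N" using N by simp
  define c where "c = (1 + 2 / \<delta>0) ^ m"
  have c: "0 < c" unfolding c_def using \<delta>0 by (intro zero_less_power) (simp add: add_pos_pos)
  have pow: "(1 + 2 * \<bar>y\<bar>) ^ m \<le> c * (1 + \<bar>\<delta> * y\<bar>) ^ m" for y
  proof -
    have "2 * \<bar>y\<bar> = 2 / \<delta> * \<bar>\<delta> * y\<bar>" using \<delta> by (simp add: abs_mult)
    also have "\<dots> \<le> 2 / \<delta>0 * \<bar>\<delta> * y\<bar>" using \<delta>0 by (intro mult_right_mono divide_left_mono) auto
    also have "1 + \<dots> \<le> (1 + 2 / \<delta>0) * (1 + \<bar>\<delta> * y\<bar>)" using \<delta>0 by (simp add: algebra_simps)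
    finally have "(1 + 2 * \<bar>y\<bar>) ^ m \<le> ((1 + 2 / \<delta>0) * (1 + \<bar>\<delta> * y\<bar>)) ^ m" by (intro power_mono) auto
    then show ?thesis unfolding c_def by (simp add: power_mult_distrib)
  qed
  note j0 = jackson_nonneg[OF \<delta> N1]
  have mom: "integrable lborel (\<lambda>y. c * (jackson N \<delta> y * (1 + \<bar>\<delta> * y\<bar>) ^ m))"
    by (intro integrable_mult_right jackson_moment_integrable \<delta> N)
  have le: "jackson N \<delta> y * (1 + 2 * \<bar>y\<bar>) ^ m \<le> c * (jackson N \<delta> y * (1 + \<bar>\<delta> * y\<bar>) ^ m)" for y
    using mult_left_mono[OF pow[of y] j0[of y]] by (simp only: mult.left_commute)
  show int: "integrable lborel (\<lambda>y. jackson N \<delta> y * (1 + 2 * \<bar>y\<bar>) ^ m)"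
    by (rule Bochner_Integration.integrable_bound[OF mom])
       (measurable, use le j0 c in \<open>auto simp: abs_mult intro!: AE_I2\<close>)
  have set: "indicator {y. a / \<delta> < \<bar>y\<bar>} y = (indicator {y. a < \<bar>y\<bar>} (\<delta> * y) :: real)" for y
    using \<delta> by (auto simp: indicator_def pos_divide_less_eq abs_mult mult.commute)
  have ind: "integrable lborel (\<lambda>y. indicator {y. a / \<delta> < \<bar>y\<bar>} y * f y)" if "integrable lborel f" for f :: "real \<Rightarrow> real"
    using integrable_mult_indicator[of "{y. a / \<delta> < \<bar>y\<bar>}" lborel f] that by simp
  have "(LINT y|lborel. indicator {y. a / \<delta> < \<bar>y\<bar>} y * (jackson N \<delta> y * (1 + 2 * \<bar>y\<bar>) ^ m)) \<le>
      (LINT y|lborel. indicator {y. a / \<delta> < \<bar>y\<bar>} y * (c * (jackson N \<delta> y * (1 + \<bar>\<delta> * y\<bar>) ^ m)))"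
    by (intro integral_mono ind int mom mult_left_mono le) auto
  also have "\<dots> = (LINT y|lborel. c * (jackson N \<delta> y * (indicator {y. a < \<bar>y\<bar>} (\<delta> * y) * (1 + \<bar>\<delta> * y\<bar>) ^ m)))"
    unfolding set by (intro Bochner_Integration.integral_cong) (auto simp: mult_ac)
  also have "\<dots> = c * (LINT y|lborel. jackson N \<delta> y * (indicator {y. a < \<bar>y\<bar>} (\<delta> * y) * (1 + \<bar>\<delta> * y\<bar>) ^ m))" by simp
  also have "\<dots> = c * (LINT y|lborel. jackson N 1 y * (indicator {y. a < \<bar>y\<bar>} y * (1 + \<bar>y\<bar>) ^ m))"
    using jackson_scale(2)[OF \<delta>, of N "\<lambda>y. indicator {y. a < \<bar>y\<bar>} y * (1 + \<bar>y\<bar>) ^ m"] by simp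
  also have "\<dots> \<le> c * (e / c)" using a c unfolding c_def by (intro mult_left_mono) auto
  finally show "(LINT y|lborel. indicator {y. a / \<delta> < \<bar>y\<bar>} y * (jackson N \<delta> y * (1 + 2 * \<bar>y\<bar>) ^ m)) \<le> e"
    using c by simp
qed

text \<open>The constant depends on \<open>m\<close>, \<open>Q\<close> and \<open>T0\<close> only.
  The term in \<open>\<beta>\<close> is the smoothed difference, the term in \<open>1 / T\<close>
  the variation of \<open>Phi\<close> over the kernel width \<open>a / \<delta>\<close>. The lower
  bound \<open>T0\<close> keeps \<open>\<delta>\<close> away from 0, hence the constants
  uniform.\<close>

lemma nonuniform_bound_of_char:
  assumes m: "1 \<le> m" and T0: "0 < T0"
  shows "\<exists>C\<ge>0. \<forall>\<mu> T \<beta>. real_distribution \<mu> \<longrightarrow> T0 \<le> T \<longrightarrow>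
    derivs_bounded (Suc m) {- T..T} (\<lambda>t. \<beta> * ((1 + \<bar>t\<bar>) ^ Q * exp (- t\<^sup>2 / 4))) (\<lambda>t. char \<mu> t - of_real (exp (- t\<^sup>2 / 2))) \<longrightarrow>
    (\<forall>x. \<bar>cdf \<mu> x - Phi x\<bar> * (1 + \<bar>x\<bar>) ^ m \<le> C * (\<beta> + 1 / T))"
proof -
  \<comment> \<open>Large enough both for \<open>m + 1\<close> controlled derivatives of the spline
    and for a weighted kernel moment of order \<open>m\<close>.\<close>
  define N where "N = m + 2"
  have N: "1 \<le> N" "Suc m \<le> 2 * N - 2" "m + 2 \<le> 2 * N" unfolding N_def by auto
  define \<delta>0 where "\<delta>0 = T0 / (2 * real N + 2)"
  have \<delta>0: "0 < \<delta>0" unfolding \<delta>0_def using T0 by simp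
  define c where "c = max 1 (1 / \<delta>0)"
  obtain G where G: "0 < G" "\<And>t::real. (1 + \<bar>t\<bar>) ^ Q * exp (- t\<^sup>2 / 4) \<le> G * inverse (1 + t\<^sup>2)"
    using power_mult_gaussian_bounded by blast
  obtain K where K: "0 < K" "\<And>z. std_normal_density z * (1 + \<bar>z\<bar>) ^ m \<le> K"
    using std_normal_density_decay by blast
  have "0 < (1 / 4) / (1 + 2 / \<delta>0) ^ m" using \<delta>0 by (simp add: add_pos_pos)
  from jackson_tail[OF N(3) this] obtain a where a: "0 \<le> a"
    "(LINT y|lborel. jackson N 1 y * (indicator {y. a < \<bar>y\<bar>} y * (1 + \<bar>y\<bar>) ^ m)) \<le> (1 / 4) / (1 + 2 / \<delta>0) ^ m" by blast
  define C1 where "C1 = 4 ^ Suc m * c ^ (2 * N - 2) * pi / sinc_mass N * G"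
  have C1: "0 \<le> C1" unfolding C1_def c_def using G sinc_mass_pos[OF N(1)] by simp
  define C2 where "C2 = 4 * C1 * (1 + a / \<delta>0) ^ m"
  define C3 where "C3 = 4 * K * (a * (2 * real N + 2)) * (1 + 2 * (a / \<delta>0)) ^ m"
  have C23: "0 \<le> C2" "0 \<le> C3" unfolding C2_def C3_def using C1 K a \<delta>0 by auto
  have main: "\<bar>cdf \<mu> x - Phi x\<bar> * (1 + \<bar>x\<bar>) ^ m \<le> (C2 + C3) * (\<beta> + 1 / T)"
    if \<mu>: "real_distribution \<mu>" and T: "T0 \<le> T"
      and h: "derivs_bounded (Suc m) {- T..T} (\<lambda>t. \<beta> * ((1 + \<bar>t\<bar>) ^ Q * exp (- t\<^sup>2 / 4))) (\<lambda>t. char \<mu> t - of_real (exp (- t\<^sup>2 / 2)))"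
    for \<mu> T \<beta> x
  proof -
    interpret \<mu>: real_distribution \<mu> by (rule that(1))
    interpret \<nu>: real_distribution std_normal_distribution by (rule real_dist_normal_dist)
    have T_pos: "0 < T" using T0 T by linarith
    define \<delta> where "\<delta> = T / (2 * real N + 2)"
    have \<delta>: "0 < \<delta>" "\<delta>0 \<le> \<delta>" unfolding \<delta>_def \<delta>0_def using T_pos T by (auto intro: divide_right_mono)
    have \<beta>: "0 \<le> \<beta>"
      using order_trans[OF norm_ge_zero derivs_bounded_norm[OF h, of 0]] T_pos by simp
    have c: "1 \<le> c" "(2 * real N + 2) / T \<le> c"
    proof -
      have "1 / \<delta> \<le> 1 / \<delta>0" using \<delta> \<delta>0 by (intro divide_left_mono) auto
      then show "1 \<le> c" "(2 * real N + 2) / T \<le> c" unfolding c_def \<delta>_def by auto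
    qed
    have h': "derivs_bounded (Suc m) {- T..T} (\<lambda>t. \<beta> * ((1 + \<bar>t\<bar>) ^ Q * exp (- t\<^sup>2 / 4))) (\<lambda>t. char \<mu> t - char std_normal_distribution t)"
      using h by (simp only: char_std_normal_distribution)
    have v: "\<beta> * ((1 + \<bar>t\<bar>) ^ Q * exp (- t\<^sup>2 / 4)) \<le> \<beta> * G * inverse (1 + t\<^sup>2)" for t
      using mult_left_mono[OF G(2)[of t] \<beta>] by (simp add: mult.assoc)
    define b where "b = C1 * \<beta>"
    have dens: "(1 + \<bar>z\<bar>) ^ Suc m * \<bar>smoothed_density (jackson N \<delta>) \<mu> z - smoothed_density (jackson N \<delta>) std_normal_distribution z\<bar> \<le> b" for z
      using smoothed_density_diff_decay[OF \<mu> real_dist_normal_dist N(1,2) T_pos c h' v, of z]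
      unfolding \<delta>_def b_def C1_def by (simp only: mult_ac)
    \<comment> \<open>The weight is truncated at its value at the very point \<open>x\<close> under
      study, where it therefore agrees with the full weight. This is legitimate since the bound from
      \<open>desmoothing\<close> is free of the truncation level.\<close>
    define L where "L = 1 + \<bar>x\<bar>"
    define w where "w y = (min (1 + \<bar>y\<bar>) L) ^ m" for y :: real
    have w0: "0 < w y" for y unfolding w_def L_def by (intro zero_less_power) auto
    have w_le: "w y \<le> (1 + \<bar>y\<bar>) ^ m" for y unfolding w_def L_def by (intro power_mono) auto
    have wL: "w y \<le> L ^ m" for y unfolding w_def L_def by (intro power_mono) auto
    have w_sub: "w y \<le> w z * (1 + \<bar>y - z\<bar>) ^ m" for y z
    proof -
      have "L \<le> L * (1 + \<bar>y - z\<bar>)" using mult_left_mono[of 1 "1 + \<bar>y - z\<bar>" L] unfolding L_def by simp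
      then have "min (1 + \<bar>y\<bar>) L \<le> min (1 + \<bar>z\<bar>) L * (1 + \<bar>y - z\<bar>)"
        using one_plus_abs_le_mult[of y z] by (auto simp: min_def)
      then have "w y \<le> (min (1 + \<bar>z\<bar>) L * (1 + \<bar>y - z\<bar>)) ^ m"
        unfolding w_def by (intro power_mono) (auto simp: L_def)
      then show ?thesis unfolding w_def by (simp add: power_mult_distrib)
    qed
    note jm = jackson_measurable[of N \<delta>] and j0 = jackson_nonneg[OF \<delta>(1) N(1)] and j1 = jackson_integral[OF \<delta>(1) N(1)]
    note ji = jackson_integrable[OF \<delta>(1) N(1)]
    have smooth: "\<bar>LINT y|lborel. jackson N \<delta> y * (cdf \<mu> (x - y) - Phi (x - y))\<bar> * w x \<le> b" for x
    proof -
      have "\<bar>LINT y|lborel. jackson N \<delta> y * (cdf \<mu> (x - y) - Phi (x - y))\<bar> * w x \<le>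
          \<bar>LINT y|lborel. jackson N \<delta> y * (cdf \<mu> (x - y) - Phi (x - y))\<bar> * (1 + \<bar>x\<bar>) ^ m"
        by (intro mult_left_mono w_le) auto
      also have "\<dots> \<le> b" unfolding Phi_def
        by (rule smoothed_cdf_diff_le[OF jm j0 ji j1 \<mu> real_dist_normal_dist m dens])
      finally show ?thesis .
    qed
    have incr: "\<bar>Phi y - Phi x\<bar> * w x \<le> K * \<bar>y - x\<bar> * (1 + \<bar>y - x\<bar>) ^ m" for x y
      using Phi_weighted_increment[OF K(2), of y x] mult_left_mono[OF w_le, of "\<bar>Phi y - Phi x\<bar>" x] by linarith
    have mono: "mono (cdf \<mu>)" "mono Phi" unfolding Phi_def by (auto intro!: monoI \<mu>.cdf_nondecreasing \<nu>.cdf_nondecreasing)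
    have bdd: "\<bar>cdf \<mu> x\<bar> \<le> 1" "\<bar>Phi x\<bar> \<le> 1" for x
      unfolding Phi_def by (auto simp: \<mu>.cdf_nonneg \<nu>.cdf_nonneg \<mu>.cdf_bounded_prob \<nu>.cdf_bounded_prob)
    note tail = jackson_scaled_tail_le[OF N(3) \<delta>0 \<delta>(2) a(2)]
    have a\<delta>: "0 \<le> a / \<delta>" "a / \<delta> \<le> a / \<delta>0" using a \<delta> \<delta>0 by (auto intro!: divide_left_mono)
    have "\<bar>cdf \<mu> x - Phi x\<bar> * w x \<le> 4 * b * (1 + a / \<delta>) ^ m + 4 * K * (a / \<delta>) * (1 + 2 * (a / \<delta>)) ^ m"
      by (rule desmoothing[OF jm j0 jackson_minus j1 tail(2) mono(1) bdd(1) borel_measurable_mono[OF mono(2)] bdd(2)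
            w0 w_sub wL smooth incr less_imp_le[OF K(1)] a\<delta>(1) tail(1)])
    also have "w x = (1 + \<bar>x\<bar>) ^ m" unfolding w_def L_def by simp
    also have "4 * b * (1 + a / \<delta>) ^ m \<le> 4 * b * (1 + a / \<delta>0) ^ m"
      using a\<delta> C1 \<beta> unfolding b_def by (intro mult_left_mono power_mono) auto
    also have "\<dots> = C2 * \<beta>" unfolding b_def C2_def by simp
    also have "4 * K * (a / \<delta>) * (1 + 2 * (a / \<delta>)) ^ m \<le> 4 * K * (a / \<delta>) * (1 + 2 * (a / \<delta>0)) ^ m"
      using a\<delta> K by (intro mult_left_mono power_mono mult_nonneg_nonneg) auto
    also have "\<dots> = C3 * (1 / T)" unfolding C3_def \<delta>_def by simp
    also have "C2 * \<beta> + C3 * (1 / T) \<le> (C2 + C3) * \<beta> + (C2 + C3) * (1 / T)"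
      using C23 \<beta> T_pos by (intro add_mono mult_right_mono) auto
    also have "\<dots> = (C2 + C3) * (\<beta> + 1 / T)" by (rule distrib_left[symmetric])
    finally show ?thesis by simp
  qed
  show ?thesis using main C23 by (intro exI[of _ "C2 + C3"]) auto
qed

subsection \<open>Characteristic functions and the growth condition\<close>

lemma norm_exp_minus_one_le: "norm (exp z - 1) \<le> norm z * exp (norm z)" for z :: complex
proof -
  have "norm (exp z - exp 0) \<le> exp (norm z) * norm (z - 0)"
  proof (rule field_differentiable_bound[where S="cball 0 (norm z)"])
    show "norm (exp u) \<le> exp (norm z)" if "u \<in> cball 0 (norm z)" for u :: complex
      using that complex_Re_le_cmod[of u] by simp
  qed (auto intro: DERIV_exp[THEN has_field_derivative_at_within])
  then show ?thesis by (simp add: mult.commute)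
qed

lemma has_vector_derivative_iff_quotient:
  fixes f :: "real \<Rightarrow> 'a::real_normed_vector"
  shows "(f has_vector_derivative D) (at t) \<longleftrightarrow> ((\<lambda>h. (f (t + h) - f t) /\<^sub>R h) \<longlongrightarrow> D) (at 0)"
proof -
  have "norm (f (t + h) - f t - h *\<^sub>R D) / norm h = norm ((f (t + h) - f t) /\<^sub>R h - D)" if "h \<noteq> 0" for h
  proof -
    have "(f (t + h) - f t) /\<^sub>R h - D = (f (t + h) - f t - h *\<^sub>R D) /\<^sub>R h"
      using that by (simp add: scaleR_diff_right)
    then show ?thesis by (simp add: divide_inverse mult.commute)
  qed
  then have "((\<lambda>h. norm (f (t + h) - f t - h *\<^sub>R D) / norm h) \<longlongrightarrow> 0) (at 0) \<longleftrightarrow>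
      ((\<lambda>h. norm ((f (t + h) - f t) /\<^sub>R h - D)) \<longlongrightarrow> 0) (at 0)"
    by (intro filterlim_cong refl) (auto simp: eventually_at_filter)
  then show ?thesis
    unfolding has_vector_derivative_def has_derivative_at
    by (simp add: bounded_linear_scaleR_left tendsto_norm_zero_iff LIM_zero_iff)
qed

text \<open>Differentiation under the integral by dominated convergence: the difference quotient of
  \<open>iexp\<close> in \<open>t\<close> is at most \<open>\<bar>x\<bar>\<close>, so
  \<open>x *\<^sub>R g x\<close> dominates in norm.\<close>

lemma has_vector_derivative_integral_iexp:
  fixes g :: "real \<Rightarrow> complex"
  assumes \<mu>: "real_distribution \<mu>" and g: "integrable \<mu> g" and xg: "integrable \<mu> (\<lambda>x. x *\<^sub>R g x)"
  shows "((\<lambda>t. CLINT x|\<mu>. g x * iexp (t * x)) has_vector_derivative (CLINT x|\<mu>. \<i> * (x *\<^sub>R g x) * iexp (t * x))) (at t)"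
proof -
  interpret real_distribution \<mu> by (rule \<mu>)
  let ?f = "\<lambda>t. CLINT x|\<mu>. g x * iexp (t * x)"
  let ?D = "CLINT x|\<mu>. \<i> * (x *\<^sub>R g x) * iexp (t * x)"
  have gm [measurable]: "g \<in> borel_measurable \<mu>" using g by auto
  have int: "integrable \<mu> (\<lambda>x. g x * iexp (t * x))" for t
    by (rule Bochner_Integration.integrable_bound[OF g]) (auto simp: norm_mult)
  have "((\<lambda>h. (?f (t + h) - ?f t) /\<^sub>R h) \<longlongrightarrow> ?D) (at 0)"
    unfolding tendsto_at_iff_sequentially
  proof safe
    fix X :: "nat \<Rightarrow> real" assume X: "\<forall>i. X i \<in> UNIV - {0}" "X \<longlonglongrightarrow> 0"
    let ?q = "\<lambda>n x. (g x * iexp ((t + X n) * x) - g x * iexp (t * x)) /\<^sub>R X n"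
    have q: "?q n x = g x * iexp (t * x) * ((iexp (X n * x) - 1) /\<^sub>R X n)" for n x
      by (simp add: exp_add algebra_simps scaleR_conv_of_real)
    have "(\<lambda>n. CLINT x|\<mu>. ?q n x) \<longlonglongrightarrow> ?D"
    proof (rule integral_dominated_convergence[where w="\<lambda>x. norm (x *\<^sub>R g x)"])
      show "AE x in \<mu>. norm (?q n x) \<le> norm (x *\<^sub>R g x)" for n
      proof (rule AE_I2)
        fix x
        have "norm (iexp (X n * x) - 1) \<le> \<bar>X n * x\<bar>" using iexp_approx1[of "X n * x" 0] by simp
        then have "norm ((iexp (X n * x) - 1) /\<^sub>R X n) \<le> \<bar>x\<bar>"
          using X(1) by (simp add: abs_mult divide_simps mult.commute)
        then have "norm (g x * iexp (t * x)) * norm ((iexp (X n * x) - 1) /\<^sub>R X n) \<le> norm (g x) * \<bar>x\<bar>"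
          by (intro mult_mono) (auto simp: norm_mult)
        then show "norm (?q n x) \<le> norm (x *\<^sub>R g x)" unfolding q norm_mult[of "g x * iexp (t * x)"] by (simp only: norm_scaleR mult.commute)
      qed
      show "AE x in \<mu>. (\<lambda>n. ?q n x) \<longlonglongrightarrow> \<i> * (x *\<^sub>R g x) * iexp (t * x)"
      proof (rule AE_I2)
        fix x
        have "((\<lambda>u. iexp (u * x)) has_vector_derivative \<i> * x) (at 0)"
          unfolding of_real_mult by (rule has_vector_derivative_real_field) (auto intro!: derivative_eq_intros)
        then have "((\<lambda>h. (iexp (h * x) - 1) /\<^sub>R h) \<longlongrightarrow> \<i> * x) (at 0)"
          unfolding has_vector_derivative_iff_quotient by simp
        then have "(\<lambda>n. (iexp (X n * x) - 1) /\<^sub>R X n) \<longlonglongrightarrow> \<i> * x"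
          using X unfolding tendsto_at_iff_sequentially by (auto simp: o_def)
        from tendsto_mult_left[OF this, of "g x * iexp (t * x)"]
        show "(\<lambda>n. ?q n x) \<longlonglongrightarrow> \<i> * (x *\<^sub>R g x) * iexp (t * x)" unfolding q by (simp add: scaleR_conv_of_real mult_ac)
      qed
      show "integrable \<mu> (\<lambda>x. norm (x *\<^sub>R g x))" by (intro integrable_norm xg)
    qed measurable
    moreover have "(CLINT x|\<mu>. ?q n x) = (?f (t + X n) - ?f t) /\<^sub>R X n" for n
      by (simp only: integral_scaleR_right Bochner_Integration.integral_diff[OF int int])
    ultimately show "((\<lambda>h. (?f (t + h) - ?f t) /\<^sub>R h) \<circ> X) \<longlonglongrightarrow> ?D" by (simp only: o_def)
  qed
  then show ?thesis unfolding has_vector_derivative_iff_quotient .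
qed

section \<open>Uniqueness of logarithm branches and chains of derivatives\<close>

lemma log_branch_unique:
  assumes L: "log_branch_on I \<phi> L" "log_branch_on J \<phi> L'" and d: "0 \<le> d" "{- d..d} \<subseteq> I" "{- d..d} \<subseteq> J" and t: "t \<in> {- d..d}"
  shows "L t = L' t"
proof -
  let ?S = "{- d..d}" and ?D = "\<lambda>t. L t - L' t"
  have cont: "continuous_on ?S ?D"
    using L d unfolding log_branch_on_def by (intro continuous_on_diff) (auto intro: continuous_on_subset)
  have exp1: "exp (?D s) = 1" if "s \<in> ?S" for s
  proof -
    have "exp (L s) = exp (L' s)" using L d that unfolding log_branch_on_def by (metis subsetD)
    then show ?thesis by (simp add: exp_diff)
  qed
  \<comment> \<open>Two branches differ by a continuous function with values in the integer
    multiples of \<open>2 * pi * \<i>\<close>. Distinct values are at least \<open>2 * pi\<close>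
    apart, so on an interval it is constant, and at 0 it is 0.\<close>
  have "?D constant_on ?S"
  proof (rule continuous_discrete_range_constant[OF _ cont])
    fix s assume s: "s \<in> ?S"
    show "\<exists>e>0. \<forall>y. y \<in> ?S \<and> ?D y \<noteq> ?D s \<longrightarrow> e \<le> norm (?D y - ?D s)"
    proof (intro exI[of _ "2 * pi"] conjI allI impI)
      fix y assume y: "y \<in> ?S \<and> ?D y \<noteq> ?D s"
      have "exp (?D y) = exp (?D s)" using exp1 y s by metis
      then obtain n :: int where n: "?D y = ?D s + (of_int (2 * n) * pi) * \<i>" unfolding exp_eq by blast
      with y have "n \<noteq> 0" by auto
      then have "1 \<le> \<bar>n\<bar>" by simp
      then have "1 \<le> \<bar>real_of_int n\<bar>" by linarith
      then have "2 * pi * 1 \<le> 2 * pi * \<bar>real_of_int n\<bar>" by (intro mult_left_mono) auto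
      then show "2 * pi \<le> norm (?D y - ?D s)" unfolding n by (simp add: norm_mult abs_mult mult_ac)
    qed simp
  qed simp
  moreover have "0 \<in> ?S" using d by simp
  moreover have "?D 0 = 0" using L unfolding log_branch_on_def by simp
  ultimately have "?D t = 0" using t unfolding constant_on_def by metis
  then show ?thesis by simp
qed

lemma derivative_chain_unique:
  assumes U: "open U"
    and f: "\<And>k t. k < p \<Longrightarrow> t \<in> U \<Longrightarrow> (f k has_vector_derivative f (Suc k) t) (at t)"
    and g: "\<And>k t. k < p \<Longrightarrow> t \<in> U \<Longrightarrow> (g k has_vector_derivative g (Suc k) t) (at t)"
    and 0: "\<And>t. t \<in> U \<Longrightarrow> f 0 t = g 0 t" and k: "k \<le> p" and t: "t \<in> U"
  shows "f k t = g k t"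
  using k t
proof (induction k arbitrary: t)
  case (Suc k)
  have "(f k has_vector_derivative g (Suc k) t) (at t)"
    by (rule has_vector_derivative_transform_within_open[OF g[of k t] U]) (use Suc in auto)
  with f[of k t] Suc.prems show ?case by (intro vector_derivative_unique_at) auto
qed (use 0 in auto)

text \<open>In the interior the derivatives within \<open>I\<close> are ordinary two-sided ones, so
  they no longer depend on \<open>I\<close> and can be compared across different intervals.\<close>

lemma times_differentiable_on_chain:
  assumes "times_differentiable_on j f I" "k < j" "t \<in> interior I"
  shows "(nth_deriv_within k I f has_vector_derivative nth_deriv_within (Suc k) I f t) (at t)"
proof -
  have "t \<in> I" using assms(3) interior_subset by blast
  then have "nth_deriv_within k I f differentiable (at t within I)"
    using assms unfolding times_differentiable_on_def differentiable_on_def by blast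
  then have "(nth_deriv_within k I f has_vector_derivative vector_derivative (nth_deriv_within k I f) (at t within I)) (at t within I)"
    by (simp add: vector_derivative_works)
  then show ?thesis using at_within_interior[OF assms(3)] by (simp add: nth_deriv_within_def)
qed

text \<open>Turns an explicit sequence of derivatives into the recursive predicate; the induction
  descends from the top order \<open>r\<close>.\<close>

lemma derivs_bounded_chain:
  assumes "\<And>k t. k < r \<Longrightarrow> t \<in> I \<Longrightarrow> (f k has_vector_derivative f (Suc k) t) (at t within I)"
    and "\<And>k t. k \<le> r \<Longrightarrow> t \<in> I \<Longrightarrow> norm (f k t) \<le> w t"
  shows "derivs_bounded r I w (f 0)"
proof -
  have "derivs_bounded (r - k) I w (f k)" if "k \<le> r" for k
    using that
  proof (induction k rule: inc_induct)
    case (step k)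
    then have "r - k = Suc (r - Suc k)" by simp
    then show ?case using step assms unfolding \<open>r - k = Suc (r - Suc k)\<close> derivs_bounded.simps
      by (intro conjI ballI exI[of _ "f (Suc k)"]) auto
  qed (use assms in auto)
  from this[of 0] show ?thesis by simp
qed

section \<open>Derivative bounds for the Gaussian and for the difference of characteristic
  functions\<close>

lemma derivs_bounded_uminus: "derivs_bounded r I (\<lambda>t. 1 + \<bar>t\<bar>) (\<lambda>t. - complex_of_real t)"
  by (rule derivs_bounded_chain[where f="\<lambda>k t. if k = 0 then - of_real t else if k = 1 then - 1 else 0", simplified])
     (auto intro!: derivative_eq_intros)

lemma has_vector_derivative_gaussian:
  "((\<lambda>t. complex_of_real (exp (- t\<^sup>2 / 2))) has_vector_derivative - of_real t * of_real (exp (- t\<^sup>2 / 2))) (at t within I)"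
proof -
  have "((\<lambda>t. exp (- t\<^sup>2 / 2)) has_real_derivative - t * exp (- t\<^sup>2 / 2)) (at t within I)"
    by (auto intro!: derivative_eq_intros simp: power2_eq_square)
  from has_vector_derivative_of_real[where 'a=complex, OF this] show ?thesis by simp
qed

lemma derivs_bounded_gaussian:
  "derivs_bounded (Suc r) I (\<lambda>t. (2 ^ (r + 3) * (1 + \<bar>t\<bar>)) ^ Suc r * exp (- t\<^sup>2 / 2)) (\<lambda>t. of_real (exp (- t\<^sup>2 / 2)))"
proof (rule derivs_bounded_linear_ode[where \<alpha>="\<lambda>t. - of_real t" and \<beta>="\<lambda>_. 0"])
  show "((\<lambda>t. complex_of_real (exp (- t\<^sup>2 / 2))) has_vector_derivative - of_real t * of_real (exp (- t\<^sup>2 / 2)) + 0) (at t within I)" for t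
    using has_vector_derivative_gaussian by simp
  show "derivs_bounded r I (\<lambda>t. 1 + \<bar>t\<bar>) (\<lambda>t. - complex_of_real t)"
    by (rule derivs_bounded_uminus)
  show "derivs_bounded r I (\<lambda>t. exp (- t\<^sup>2 / 2)) (\<lambda>_. 0)"
    by (rule derivs_bounded_chain[where f="\<lambda>_ _. 0"]) auto
qed auto

text \<open>In \<open>derivs_bounded_linear_ode\<close>, \<open>u\<close> bounds the coefficient
  \<open>\<Lambda> 1 t - t\<close>, and \<open>v\<close> bounds both the difference itself and the
  inhomogeneous term. The degree of \<open>v\<close> is \<open>m + 4 = 3 + (m + 1)\<close>, from
  \<open>\<Lambda> 1\<close> and from the derivatives of the Gaussian; the final degree is
  \<open>4 * m + 7 = 3 * (m + 1) + (m + 4)\<close>. By \<open>small\<close>, the factor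
  \<open>exp (norm (\<Lambda> 0 t))\<close> uses up half of the Gaussian exponent. The explicit
  factor \<open>\<beta>\<close> is what becomes \<open>1 / \<sigma>\<^sub>n\<close>.\<close>

lemma derivs_bounded_char_diff:
  fixes \<phi> :: "real \<Rightarrow> complex" and \<Lambda> :: "nat \<Rightarrow> real \<Rightarrow> complex"
  assumes exp: "\<And>t. t \<in> I \<Longrightarrow> \<phi> t = exp (\<Lambda> 0 t - of_real (t\<^sup>2 / 2))"
    and chain: "\<And>k t. k \<le> m \<Longrightarrow> t \<in> I \<Longrightarrow> (\<Lambda> k has_vector_derivative \<Lambda> (Suc k) t) (at t within I)"
    and bound: "\<And>k t. k \<le> Suc m \<Longrightarrow> t \<in> I \<Longrightarrow> norm (\<Lambda> k t) \<le> \<beta> * (1 + \<bar>t\<bar>) ^ 3"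
    and small: "\<And>t. t \<in> I \<Longrightarrow> norm (\<Lambda> 0 t) \<le> t\<^sup>2 / 4"
    and \<beta>: "0 \<le> \<beta>"
  shows "derivs_bounded (Suc m) I
    (\<lambda>t. ((2 ^ (m + 3) * (\<beta> + 1)) ^ Suc m * (2 ^ m * (2 ^ (m + 3)) ^ Suc m) * \<beta>) * ((1 + \<bar>t\<bar>) ^ (4 * m + 7) * exp (- t\<^sup>2 / 4)))
    (\<lambda>t. \<phi> t - of_real (exp (- t\<^sup>2 / 2)))"
proof -
  let ?w = "\<lambda>t::real. 1 + \<bar>t\<bar>" and ?g = "\<lambda>t. complex_of_real (exp (- t\<^sup>2 / 2))"
  define c where "c = 2 ^ m * (2 ^ (m + 3)) ^ Suc m * \<beta>"
  define u where "u t = (\<beta> + 1) * ?w t ^ 3" for t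
  define v where "v t = c * (?w t ^ (m + 4) * exp (- t\<^sup>2 / 4))" for t
  have c\<beta>: "\<beta> \<le> c"
  proof -
    have "1 * 1 \<le> (2::real) ^ m * (2 ^ (m + 3)) ^ Suc m" by (intro mult_mono one_le_power) auto
    from mult_right_mono[OF this \<beta>] show ?thesis unfolding c_def by simp
  qed
  have e: "exp (- t\<^sup>2 / 2) \<le> exp (- t\<^sup>2 / 4)" for t :: real by simp
  have \<Lambda>1: "derivs_bounded m I (\<lambda>t. \<beta> * ?w t ^ 3) (\<Lambda> 1)"
  proof -
    have "derivs_bounded m I (\<lambda>t. \<beta> * ?w t ^ 3) (\<Lambda> (Suc 0))"
      by (rule derivs_bounded_chain[where f="\<lambda>k. \<Lambda> (Suc k)"]) (use chain bound in auto)
    then show ?thesis by simp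
  qed
  have "derivs_bounded m I (\<lambda>t. \<beta> * ?w t ^ 3 + ?w t) (\<lambda>t. \<Lambda> 1 t + - of_real t)"
  proof (intro derivs_bounded_add \<Lambda>1)
    show "derivs_bounded m I ?w (\<lambda>t. - complex_of_real t)"
      by (rule derivs_bounded_uminus)
  qed
  then have \<alpha>: "derivs_bounded m I u (\<lambda>t. \<Lambda> 1 t - of_real t)"
  proof (rule derivs_bounded_mono[OF derivs_bounded_cong])
    fix t
    have "?w t ^ 1 \<le> ?w t ^ 3" by (intro power_increasing) auto
    then show "\<beta> * ?w t ^ 3 + ?w t \<le> u t" unfolding u_def by (simp add: distrib_right)
  qed auto
  have "derivs_bounded m I (\<lambda>t. (2 ^ (m + 3) * ?w t) ^ Suc m * exp (- t\<^sup>2 / 2)) ?g"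
    by (rule derivs_bounded_mono[OF derivs_bounded_gaussian]) auto
  from derivs_bounded_mult[OF \<Lambda>1 this]
  have inhom: "derivs_bounded m I v (\<lambda>t. \<Lambda> 1 t * ?g t)"
  proof (rule derivs_bounded_mono)
    fix t
    have w: "?w t ^ (m + 4) = ?w t ^ 3 * ?w t ^ Suc m" by (simp only: power_add[symmetric]) (simp add: add.commute)
    have "2 ^ m * (\<beta> * ?w t ^ 3 * ((2 ^ (m + 3) * ?w t) ^ Suc m * exp (- t\<^sup>2 / 2))) = c * (?w t ^ (m + 4) * exp (- t\<^sup>2 / 2))"
      unfolding c_def w power_mult_distrib by (simp only: mult_ac)
    also have "\<dots> \<le> v t" unfolding v_def using e c\<beta> \<beta> by (intro mult_left_mono) auto
    finally show "2 ^ m * (\<beta> * ?w t ^ 3 * ((2 ^ (m + 3) * ?w t) ^ Suc m * exp (- t\<^sup>2 / 2))) \<le> v t" .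
  qed auto
  have main: "derivs_bounded (Suc m) I (\<lambda>t. (2 ^ (m + 3) * u t) ^ Suc m * v t) (\<lambda>t. \<phi> t - ?g t)"
  proof (rule derivs_bounded_linear_ode[OF _ _ \<alpha> inhom])
    fix t assume t: "t \<in> I"
    show "1 \<le> u t" unfolding u_def using \<beta> mult_mono[of 1 "\<beta> + 1" 1 "?w t ^ 3"] one_le_power[of "?w t" 3] by simp
    have E: "\<phi> s = exp (\<Lambda> 0 s) * ?g s" if "s \<in> I" for s
    proof -
      have "\<Lambda> 0 s - of_real (s\<^sup>2 / 2) = \<Lambda> 0 s + of_real (- s\<^sup>2 / 2)" by simp
      then show ?thesis unfolding exp[OF that] by (simp only: exp_add exp_of_real)
    qed
    have g': "(?g has_vector_derivative - of_real t * ?g t) (at t within I)"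
      by (rule has_vector_derivative_gaussian)
    have "((\<lambda>t. exp (\<Lambda> 0 t)) has_vector_derivative exp (\<Lambda> 0 t) * \<Lambda> 1 t) (at t within I)"
      using field_vector_diff_chain_within[OF chain[of 0 t] DERIV_exp[THEN has_field_derivative_at_within]] t
      by (simp add: o_def mult.commute)
    from has_vector_derivative_diff[OF has_vector_derivative_mult[OF this g'] g']
    have "((\<lambda>t. exp (\<Lambda> 0 t) * ?g t - ?g t) has_vector_derivative (\<Lambda> 1 t - of_real t) * (\<phi> t - ?g t) + \<Lambda> 1 t * ?g t) (at t within I)"
      using E[OF t] by (simp add: algebra_simps)
    then show "((\<lambda>t. \<phi> t - ?g t) has_vector_derivative (\<Lambda> 1 t - of_real t) * (\<phi> t - ?g t) + \<Lambda> 1 t * ?g t) (at t within I)"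
      by (rule has_vector_derivative_transform[OF t, rotated]) (use E in auto)
    have "norm (\<phi> t - ?g t) = norm (exp (\<Lambda> 0 t) - 1) * exp (- t\<^sup>2 / 2)"
    proof -
      have "\<phi> t - ?g t = (exp (\<Lambda> 0 t) - 1) * ?g t" using E[OF t] by (simp add: algebra_simps)
      then show ?thesis by (simp only: norm_mult norm_of_real) simp
    qed
    also have "\<dots> \<le> (norm (\<Lambda> 0 t) * exp (norm (\<Lambda> 0 t))) * exp (- t\<^sup>2 / 2)"
      by (intro mult_right_mono norm_exp_minus_one_le) auto
    also have "\<dots> \<le> (c * ?w t ^ (m + 4) * exp (t\<^sup>2 / 4)) * exp (- t\<^sup>2 / 2)"
    proof (intro mult_right_mono mult_mono)
      have "norm (\<Lambda> 0 t) \<le> \<beta> * ?w t ^ 3" by (rule bound) (use t in auto)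
      also have "\<dots> \<le> c * ?w t ^ (m + 4)" using c\<beta> \<beta> by (intro mult_mono power_increasing) auto
      finally show "norm (\<Lambda> 0 t) \<le> c * ?w t ^ (m + 4)" .
    qed (use small[OF t] c\<beta> \<beta> in auto)
    also have "\<dots> = v t" unfolding v_def by (simp add: exp_add[symmetric])
    finally show "norm (\<phi> t - ?g t) \<le> v t" .
  qed
  show ?thesis
  proof (rule derivs_bounded_mono[OF main])
    fix t
    have w: "?w t ^ (4 * m + 7) = (?w t ^ 3) ^ Suc m * ?w t ^ (m + 4)"
      by (simp only: power_mult[symmetric] power_add[symmetric]) (simp add: algebra_simps)
    show "(2 ^ (m + 3) * u t) ^ Suc m * v t \<le> ((2 ^ (m + 3) * (\<beta> + 1)) ^ Suc m * (2 ^ m * (2 ^ (m + 3)) ^ Suc m) * \<beta>) * (?w t ^ (4 * m + 7) * exp (- t\<^sup>2 / 4))"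
      unfolding u_def v_def c_def w power_mult_distrib by (simp only: mult_ac order_refl)
  qed auto
qed

section \<open>Cumulants near zero and use of the growth condition\<close>

lemma norm_le_of_derivative_bound:
  fixes f :: "real \<Rightarrow> 'a::real_normed_vector"
  assumes "\<And>s. \<bar>s\<bar> \<le> \<bar>t\<bar> \<Longrightarrow> (f has_vector_derivative f' s) (at s)" "\<And>s. \<bar>s\<bar> \<le> \<bar>t\<bar> \<Longrightarrow> norm (f' s) \<le> B" "f 0 = 0"
  shows "norm (f t) \<le> B * \<bar>t\<bar>"
proof -
  have "norm (f t - f 0) \<le> B * norm (t - 0)"
  proof (rule differentiable_bound[where S="{- \<bar>t\<bar>..\<bar>t\<bar>}" and f'="\<lambda>s h. h *\<^sub>R f' s"])
    fix s assume "s \<in> {- \<bar>t\<bar>..\<bar>t\<bar>}"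
    then have s: "\<bar>s\<bar> \<le> \<bar>t\<bar>" by (simp add: abs_le_iff)
    show "(f has_derivative (\<lambda>h. h *\<^sub>R f' s)) (at s within {- \<bar>t\<bar>..\<bar>t\<bar>})"
      using assms(1)[OF s] unfolding has_vector_derivative_def by (rule has_derivative_at_withinI)
    have "norm (f' s) \<le> B" using assms(2)[OF s] .
    then show "onorm (\<lambda>h. h *\<^sub>R f' s) \<le> B"
    proof (intro onorm_le)
      fix h
      have "\<bar>h\<bar> * norm (f' s) \<le> \<bar>h\<bar> * B" using \<open>norm (f' s) \<le> B\<close> by (intro mult_left_mono) auto
      then show "norm (h *\<^sub>R f' s) \<le> B * norm h" by (simp add: mult.commute)
    qed
  qed auto
  then show ?thesis using assms(3) by simp
qed

text \<open>The first two derivatives of the characteristic function at 0 are computed twice: from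
  the moments they are 0 and -1, and from \<open>D1 t = char \<mu> t * (\<Lambda> 1 t - t)\<close>
  they are \<open>\<Lambda> 1 0\<close> and, once this vanishes,
  \<open>\<Lambda> 2 0 - 1\<close>.\<close>

lemma cumulant_derivatives_zero:
  fixes \<Lambda> :: "nat \<Rightarrow> real \<Rightarrow> complex"
  assumes \<mu>: "real_distribution \<mu>" and sq: "integrable \<mu> (\<lambda>x. x\<^sup>2)" "(LINT x|\<mu>. x) = 0" "(LINT x|\<mu>. x\<^sup>2) = 1"
    and U: "open U" "0 \<in> U" and exp: "\<And>t. t \<in> U \<Longrightarrow> exp (\<Lambda> 0 t - of_real (t\<^sup>2 / 2)) = char \<mu> t"
    and chain: "\<And>k t. k < 2 \<Longrightarrow> t \<in> U \<Longrightarrow> (\<Lambda> k has_vector_derivative \<Lambda> (Suc k) t) (at t)"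
  shows "\<Lambda> 1 0 = 0" "\<Lambda> 2 0 = 0"
proof -
  interpret real_distribution \<mu> by (rule \<mu>)
  have int1: "integrable \<mu> (\<lambda>x. x)"
  proof (rule Bochner_Integration.integrable_bound[where f="\<lambda>x. 1 + x\<^sup>2"])
    have "\<bar>x\<bar> \<le> 1 + x\<^sup>2" for x :: real
    proof (cases "\<bar>x\<bar> \<le> 1")
      case False
      then have "1 * \<bar>x\<bar> \<le> \<bar>x\<bar> * \<bar>x\<bar>" by (intro mult_right_mono) auto
      then show ?thesis by (simp add: power2_eq_square)
    qed (simp add: add_increasing2)
    then show "AE x in \<mu>. norm x \<le> norm (1 + x\<^sup>2)" by (intro AE_I2) (simp add: abs_of_nonneg)
  qed (use sq in auto)
  define D1 where "D1 t = (CLINT x|\<mu>. \<i> * of_real x * iexp (t * x))" for t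
  have char1: "(char \<mu> has_vector_derivative D1 t) (at t)" for t
    using has_vector_derivative_integral_iexp[OF \<mu>, of "\<lambda>_. 1" t] int1
    unfolding char_def[abs_def] D1_def by (simp add: scaleR_conv_of_real)
  have D1': "(D1 has_vector_derivative - 1) (at 0)"
  proof -
    have "integrable \<mu> (\<lambda>x. \<i> * complex_of_real x)" using int1 by (intro integrable_mult_right integrable_of_real)
    moreover have eq: "x *\<^sub>R (\<i> * complex_of_real x) = \<i> * of_real (x\<^sup>2)" for x
      by (simp add: scaleR_conv_of_real power2_eq_square mult_ac)
    have "integrable \<mu> (\<lambda>x. x *\<^sub>R (\<i> * complex_of_real x))"
      unfolding eq using sq(1) by (intro integrable_mult_right integrable_of_real)
    ultimately have "(D1 has_vector_derivative (CLINT x|\<mu>. \<i> * (x *\<^sub>R (\<i> * of_real x)) * iexp (0 * x))) (at 0)"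
      unfolding D1_def[abs_def] by (rule has_vector_derivative_integral_iexp[OF \<mu>])
    also have "(CLINT x|\<mu>. \<i> * (x *\<^sub>R (\<i> * of_real x)) * iexp (0 * x)) = (CLINT x|\<mu>. - of_real (x\<^sup>2))"
      unfolding eq by simp
    also have "\<dots> = - 1" by (simp only: Bochner_Integration.integral_minus integral_complex_of_real sq(3) of_real_1)
    finally show ?thesis .
  qed
  have D1_eq: "D1 t = char \<mu> t * (\<Lambda> 1 t - of_real t)" if t: "t \<in> U" for t
  proof -
    have sq': "((\<lambda>t. complex_of_real (t\<^sup>2 / 2)) has_vector_derivative of_real t) (at t)"
      by (rule has_vector_derivative_of_real) (auto intro!: derivative_eq_intros)
    have "((\<lambda>t. exp (\<Lambda> 0 t - of_real (t\<^sup>2 / 2))) has_vector_derivative (\<Lambda> 1 t - of_real t) * exp (\<Lambda> 0 t - of_real (t\<^sup>2 / 2))) (at t)"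
      using field_vector_diff_chain_at[OF has_vector_derivative_diff[OF chain[of 0 t] sq'] DERIV_exp] t
      by (simp add: o_def)
    then have "(char \<mu> has_vector_derivative (\<Lambda> 1 t - of_real t) * exp (\<Lambda> 0 t - of_real (t\<^sup>2 / 2))) (at t)"
      by (rule has_vector_derivative_transform_within_open[OF _ U(1) t]) (use exp in auto)
    from vector_derivative_unique_at[OF char1 this] show ?thesis using exp[OF t] by (simp add: mult.commute)
  qed
  have "D1 0 = 0"
  proof -
    have "D1 0 = \<i> * (CLINT x|\<mu>. of_real x)" unfolding D1_def by simp
    then show ?thesis using sq(2) by simp
  qed
  then show z1: "\<Lambda> 1 0 = 0" using D1_eq[OF U(2)] char_zero by simp
  have id: "((\<lambda>t. complex_of_real t) has_vector_derivative 1) (at 0)"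
    using has_vector_derivative_of_real[where 'a=complex, OF DERIV_ident] by simp
  have "((\<lambda>t. char \<mu> t * (\<Lambda> 1 t - of_real t)) has_vector_derivative char \<mu> 0 * (\<Lambda> 2 0 - 1) + D1 0 * (\<Lambda> 1 0 - of_real 0)) (at 0)"
    using chain[of 1 0] U by (intro has_vector_derivative_mult char1 has_vector_derivative_diff id) (auto simp: numeral_2_eq_2)
  then have "(D1 has_vector_derivative char \<mu> 0 * (\<Lambda> 2 0 - 1) + D1 0 * (\<Lambda> 1 0 - of_real 0)) (at 0)"
    by (rule has_vector_derivative_transform_within_open[OF _ U]) (use D1_eq in auto)
  from vector_derivative_unique_at[OF D1' this] show "\<Lambda> 2 0 = 0" using z1 char_zero by simp
qed

text \<open>The growth condition provides a separate radius, constant and branch for each order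
  \<open>j\<close>. On the smallest radius all branches agree, so the one for
  \<open>j = m + 1\<close>, with its derivatives, can represent them all. The open interval makes
  the derivatives two-sided.\<close>

lemma growth_condition_chain:
  assumes growth: "growth_condition M S m" and m: "2 \<le> m"
    and s0: "0 < s0" "\<And>n. 1 \<le> n \<Longrightarrow> s0 \<le> L2_norm_rv M (S n)"
  shows "\<exists>C>0. \<exists>\<epsilon>>0. \<forall>n\<ge>1. \<exists>\<Lambda>. \<Lambda> 0 0 = 0 \<and>
      (\<forall>t\<in>{- (\<epsilon> * L2_norm_rv M (S n))<..<\<epsilon> * L2_norm_rv M (S n)}.
        exp (\<Lambda> 0 t - of_real (t\<^sup>2 / 2)) = (CLINT \<omega>|M. exp (\<i> * complex_of_real (t * S n \<omega> / L2_norm_rv M (S n)))) \<and>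
        (\<forall>k\<le>m. (\<Lambda> k has_vector_derivative \<Lambda> (Suc k) t) (at t)) \<and>
        (\<forall>j\<in>{3..Suc m}. norm (\<Lambda> j t) \<le> C / L2_norm_rv M (S n)))"
proof -
  define \<phi> where "\<phi> n t = (CLINT \<omega>|M. exp (\<i> * complex_of_real (t * S n \<omega> / L2_norm_rv M (S n))))" for n t
  define \<sigma> where "\<sigma> n = L2_norm_rv M (S n)" for n
  let ?I = "\<lambda>e n. {- e * \<sigma> n..e * \<sigma> n}"
  let ?\<Lambda> = "\<lambda>L t. L t + complex_of_real (t\<^sup>2 / 2)"
  let ?J = "{3..m + 1}"
  have "\<forall>j\<in>?J. \<exists>C \<epsilon>. C > 0 \<and> \<epsilon> > 0 \<and> (\<forall>n\<ge>1. \<exists>L. log_branch_on (?I \<epsilon> n) (\<phi> n) L \<and>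
      times_differentiable_on j (?\<Lambda> L) (?I \<epsilon> n) \<and>
      (\<forall>t\<in>?I \<epsilon> n. norm (nth_deriv_within j (?I \<epsilon> n) (?\<Lambda> L) t) \<le> C / \<sigma> n ^ (j - 2)))"
    using growth unfolding growth_condition_def Let_def \<phi>_def \<sigma>_def by blast
  from bchoice[OF this] obtain C where "\<forall>j\<in>?J. \<exists>\<epsilon>. C j > 0 \<and> \<epsilon> > 0 \<and> (\<forall>n\<ge>1. \<exists>L. log_branch_on (?I \<epsilon> n) (\<phi> n) L \<and>
      times_differentiable_on j (?\<Lambda> L) (?I \<epsilon> n) \<and>
      (\<forall>t\<in>?I \<epsilon> n. norm (nth_deriv_within j (?I \<epsilon> n) (?\<Lambda> L) t) \<le> C j / \<sigma> n ^ (j - 2)))" by blast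
  from bchoice[OF this] obtain \<epsilon> where C\<epsilon>: "\<And>j. j \<in> ?J \<Longrightarrow> C j > 0" "\<And>j. j \<in> ?J \<Longrightarrow> \<epsilon> j > 0"
    and L_ex: "\<And>j n. j \<in> ?J \<Longrightarrow> n \<ge> 1 \<Longrightarrow> \<exists>L. log_branch_on (?I (\<epsilon> j) n) (\<phi> n) L \<and>
      times_differentiable_on j (?\<Lambda> L) (?I (\<epsilon> j) n) \<and>
      (\<forall>t\<in>?I (\<epsilon> j) n. norm (nth_deriv_within j (?I (\<epsilon> j) n) (?\<Lambda> L) t) \<le> C j / \<sigma> n ^ (j - 2))"
    by blast
  define e where "e = Min (\<epsilon> ` ?J)"
  \<comment> \<open>Only one power of \<open>1 / \<sigma> n\<close> is kept. The remaining
    \<open>j - 3 \<le> m\<close> powers are bounded using \<open>s0\<close>, and the maximum with 1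
    lets \<open>q ^ m\<close> cover all orders.\<close>
  define q where "q = max 1 (1 / s0)"
  define K where "K = (\<Sum>j\<in>?J. C j) * q ^ m"
  have J: "finite ?J" "?J \<noteq> {}" "m + 1 \<in> ?J" using m by auto
  have e: "0 < e" "\<And>j. j \<in> ?J \<Longrightarrow> e \<le> \<epsilon> j" unfolding e_def using J C\<epsilon>(2) by auto
  have K: "0 < K" unfolding K_def q_def using C\<epsilon>(1) J by (intro mult_pos_pos sum_pos) auto
  have CK: "C j / \<sigma> n ^ (j - 2) \<le> K / \<sigma> n" if j: "j \<in> ?J" and n: "n \<ge> 1" for j n
  proof -
    have \<sigma>: "s0 \<le> \<sigma> n" "0 < \<sigma> n" using s0(1) s0(2)[OF n] unfolding \<sigma>_def by auto
    have "j - 2 = Suc (j - 3)" using j by auto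
    then have "C j / \<sigma> n ^ (j - 2) = C j * (1 / \<sigma> n) ^ (j - 3) / \<sigma> n" by (simp add: power_divide)
    also have "\<dots> \<le> (\<Sum>j\<in>?J. C j) * q ^ m / \<sigma> n"
    proof (intro divide_right_mono mult_mono)
      show "C j \<le> (\<Sum>j\<in>?J. C j)" using j C\<epsilon>(1) J by (intro member_le_sum) (auto simp: less_imp_le)
      have "1 / \<sigma> n \<le> q" unfolding q_def using \<sigma> s0 by (intro max.coboundedI2 divide_left_mono) auto
      then have "(1 / \<sigma> n) ^ (j - 3) \<le> q ^ (j - 3)" using \<sigma> by (intro power_mono) auto
      also have "\<dots> \<le> q ^ m" unfolding q_def using j by (intro power_increasing) auto
      finally show "(1 / \<sigma> n) ^ (j - 3) \<le> q ^ m" .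
      show "0 \<le> (\<Sum>j\<in>?J. C j)" using C\<epsilon>(1) by (intro sum_nonneg) (auto simp: less_imp_le)
    qed (use \<sigma> in auto)
    finally show ?thesis unfolding K_def .
  qed
  have "\<exists>\<Lambda>. \<Lambda> 0 0 = 0 \<and> (\<forall>t\<in>{- (e * \<sigma> n)<..<e * \<sigma> n}. exp (\<Lambda> 0 t - of_real (t\<^sup>2 / 2)) = \<phi> n t \<and>
        (\<forall>k\<le>m. (\<Lambda> k has_vector_derivative \<Lambda> (Suc k) t) (at t)) \<and> (\<forall>j\<in>{3..Suc m}. norm (\<Lambda> j t) \<le> K / \<sigma> n))"
    if n: "n \<ge> 1" for n
  proof -
    have \<sigma>: "0 < \<sigma> n" using s0(1) s0(2)[OF n] unfolding \<sigma>_def by auto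
    have "\<forall>j\<in>?J. \<exists>L. log_branch_on (?I (\<epsilon> j) n) (\<phi> n) L \<and> times_differentiable_on j (?\<Lambda> L) (?I (\<epsilon> j) n) \<and>
      (\<forall>t\<in>?I (\<epsilon> j) n. norm (nth_deriv_within j (?I (\<epsilon> j) n) (?\<Lambda> L) t) \<le> C j / \<sigma> n ^ (j - 2))"
      using L_ex n by blast
    from bchoice[OF this] obtain L where L: "\<And>j. j \<in> ?J \<Longrightarrow> log_branch_on (?I (\<epsilon> j) n) (\<phi> n) (L j)"
      "\<And>j. j \<in> ?J \<Longrightarrow> times_differentiable_on j (?\<Lambda> (L j)) (?I (\<epsilon> j) n)"
      "\<And>j t. j \<in> ?J \<Longrightarrow> t \<in> ?I (\<epsilon> j) n \<Longrightarrow> norm (nth_deriv_within j (?I (\<epsilon> j) n) (?\<Lambda> (L j)) t) \<le> C j / \<sigma> n ^ (j - 2)"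
      by blast
    let ?U = "{- (e * \<sigma> n)<..<e * \<sigma> n}"
    let ?f = "\<lambda>j k. nth_deriv_within k (?I (\<epsilon> j) n) (?\<Lambda> (L j))"
    have sub: "e * \<sigma> n \<le> \<epsilon> j * \<sigma> n" if "j \<in> ?J" for j using e(2)[OF that] \<sigma> by (intro mult_right_mono) auto
    have int: "?U \<subseteq> interior (?I (\<epsilon> j) n)" if "j \<in> ?J" for j using sub[OF that] by auto
    have chain: "(?f j k has_vector_derivative ?f j (Suc k) t) (at t)" if "j \<in> ?J" "k < j" "t \<in> ?U" for j k t
      using times_differentiable_on_chain[OF L(2)[OF that(1)] that(2)] int[OF that(1)] that(3) by blast
    have L_eq: "L j t = L (m + 1) t" if "j \<in> ?J" "t \<in> ?U" for j t
      by (rule log_branch_unique[OF L(1)[OF that(1)] L(1)[OF J(3)], of "e * \<sigma> n"])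
         (use sub[OF that(1)] sub[OF J(3)] that(2) e \<sigma> in auto)
    have f_eq: "?f (m + 1) j t = ?f j j t" if j: "j \<in> ?J" and t: "t \<in> ?U" for j t
    proof (rule derivative_chain_unique[where U="?U" and p=j and f="?f (m + 1)" and g="?f j"])
      show "(?f j k has_vector_derivative ?f j (Suc k) s) (at s)" if "k < j" "s \<in> ?U" for k s
        using that j by (intro chain) auto
      show "(?f (m + 1) k has_vector_derivative ?f (m + 1) (Suc k) s) (at s)" if "k < j" "s \<in> ?U" for k s
        using that j by (intro chain J(3)) auto
      show "?f (m + 1) 0 s = ?f j 0 s" if "s \<in> ?U" for s
        using L_eq[OF j that] by (simp add: nth_deriv_within_def)
      show "t \<in> ?U" by (rule t)
    qed (rule open_greaterThanLessThan order_refl)+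
    show ?thesis
    proof (intro exI[of _ "?f (m + 1)"] conjI ballI allI impI)
      show "?f (m + 1) 0 0 = 0" using L(1)[OF J(3)] by (simp add: nth_deriv_within_def log_branch_on_def)
      fix t assume t: "t \<in> ?U"
      then have "t \<in> ?I (\<epsilon> (m + 1)) n" using int[OF J(3)] interior_subset by blast
      then show "exp (?f (m + 1) 0 t - of_real (t\<^sup>2 / 2)) = \<phi> n t"
        using L(1)[OF J(3)] by (simp add: nth_deriv_within_def log_branch_on_def)
      show "(?f (m + 1) k has_vector_derivative ?f (m + 1) (Suc k) t) (at t)" if "k \<le> m" for k
        using that t by (intro chain J(3)) auto
      show "norm (?f (m + 1) j t) \<le> K / \<sigma> n" if "j \<in> {3..Suc m}" for j
      proof -
        have j: "j \<in> ?J" using that by simp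
        have "t \<in> ?I (\<epsilon> j) n" using int[OF j] interior_subset t by blast
        from L(3)[OF j this] CK[OF j n] f_eq[OF j t] show ?thesis by simp
      qed
    qed
  qed
  then show ?thesis using K e(1) unfolding \<sigma>_def \<phi>_def by blast
qed

lemma (in prob_space) nonuniform_bound_normalized:
  assumes S [measurable]: "\<And>n. 1 \<le> n \<Longrightarrow> S n \<in> borel_measurable M"
    and S_L2: "\<And>n. 1 \<le> n \<Longrightarrow> integrable M (\<lambda>\<omega>. (S n \<omega>)\<^sup>2)"
    and S_centered: "\<And>n. 1 \<le> n \<Longrightarrow> (LINT \<omega>|M. S n \<omega>) = 0"
    and s0: "0 < s0" "\<And>n. 1 \<le> n \<Longrightarrow> s0 \<le> L2_norm_rv M (S n)"
    and m: "2 \<le> m" and growth: "growth_condition M S m"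
  shows "\<exists>C\<ge>0. \<forall>n\<ge>1. \<forall>x. \<bar>cdf (distr M borel (\<lambda>\<omega>. S n \<omega> / L2_norm_rv M (S n))) x - Phi x\<bar> * (1 + \<bar>x\<bar>) ^ m
      \<le> C / L2_norm_rv M (S n)"
proof -
  define \<sigma> where "\<sigma> n = L2_norm_rv M (S n)" for n
  obtain C0 \<epsilon> where C0: "0 < C0" and \<epsilon>: "0 < \<epsilon>" and \<Lambda>_ex: "\<And>n. 1 \<le> n \<Longrightarrow> \<exists>\<Lambda>. \<Lambda> 0 0 = 0 \<and>
      (\<forall>t\<in>{- (\<epsilon> * \<sigma> n)<..<\<epsilon> * \<sigma> n}.
        exp (\<Lambda> 0 t - of_real (t\<^sup>2 / 2)) = (CLINT \<omega>|M. exp (\<i> * complex_of_real (t * S n \<omega> / \<sigma> n))) \<and>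
        (\<forall>k\<le>m. (\<Lambda> k has_vector_derivative \<Lambda> (Suc k) t) (at t)) \<and>
        (\<forall>j\<in>{3..Suc m}. norm (\<Lambda> j t) \<le> C0 / \<sigma> n))"
    using growth_condition_chain[OF growth m s0(1) s0(2)] unfolding \<sigma>_def by blast
  \<comment> \<open>The first entry keeps \<open>{- T..T}\<close> inside the open interval. The
    second gives \<open>C0 * e \<le> 1 / 4\<close>, so that the cubic bound on
    \<open>\<Lambda> 0\<close> implies \<open>norm (\<Lambda> 0 t) \<le> t\<^sup>2 / 4\<close> up to
    \<open>T = e * \<sigma> n\<close>.\<close>
  define e where "e = min (\<epsilon> / 2) (1 / (4 * C0))"
  have e: "0 < e" "e < \<epsilon>" "C0 * e \<le> 1 / 4"
  proof -
    show "0 < e" "e < \<epsilon>" unfolding e_def using \<epsilon> C0 by auto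
    have "C0 * e \<le> C0 * (1 / (4 * C0))" unfolding e_def using C0 by (intro mult_left_mono) auto
    then show "C0 * e \<le> 1 / 4" using C0 by simp
  qed
  define b0 where "b0 = C0 / s0"
  define K where "K = (2 ^ (m + 3) * (b0 + 1)) ^ Suc m * (2 ^ m * (2 ^ (m + 3)) ^ Suc m)"
  have b0: "0 \<le> b0" unfolding b0_def using C0 s0 by simp
  have K0: "0 \<le> K" unfolding K_def using b0 by simp
  have "1 \<le> m" "0 < e * s0" using m e s0 by auto
  from nonuniform_bound_of_char[OF this, of "4 * m + 7"] obtain C1 where C1: "0 \<le> C1"
    "\<And>\<mu> T \<beta> x. real_distribution \<mu> \<Longrightarrow> e * s0 \<le> T \<Longrightarrow>
      derivs_bounded (Suc m) {- T..T} (\<lambda>t. \<beta> * ((1 + \<bar>t\<bar>) ^ (4 * m + 7) * exp (- t\<^sup>2 / 4))) (\<lambda>t. char \<mu> t - of_real (exp (- t\<^sup>2 / 2))) \<Longrightarrow>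
      \<bar>cdf \<mu> x - Phi x\<bar> * (1 + \<bar>x\<bar>) ^ m \<le> C1 * (\<beta> + 1 / T)"
    by blast
  have main: "\<bar>cdf (distr M borel (\<lambda>\<omega>. S n \<omega> / \<sigma> n)) x - Phi x\<bar> * (1 + \<bar>x\<bar>) ^ m \<le> C1 * (K * C0 + 1 / e) / \<sigma> n"
    if n: "1 \<le> n" for n x
  proof -
    have \<sigma>: "s0 \<le> \<sigma> n" "0 < \<sigma> n" using s0(1) s0(2)[OF n] unfolding \<sigma>_def by auto
    note [measurable] = S[OF n]
    define \<mu> where "\<mu> = distr M borel (\<lambda>\<omega>. S n \<omega> / \<sigma> n)"
    have \<mu>: "real_distribution \<mu>" unfolding \<mu>_def by (intro real_distribution_distr) measurable
    obtain \<Lambda> where \<Lambda>0: "\<Lambda> 0 0 = 0" and \<Lambda>: "\<forall>t\<in>{- (\<epsilon> * \<sigma> n)<..<\<epsilon> * \<sigma> n}.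
        exp (\<Lambda> 0 t - of_real (t\<^sup>2 / 2)) = (CLINT \<omega>|M. exp (\<i> * complex_of_real (t * S n \<omega> / \<sigma> n))) \<and>
        (\<forall>k\<le>m. (\<Lambda> k has_vector_derivative \<Lambda> (Suc k) t) (at t)) \<and>
        (\<forall>j\<in>{3..Suc m}. norm (\<Lambda> j t) \<le> C0 / \<sigma> n)"
      using \<Lambda>_ex[OF n] by blast
    let ?U = "{- (\<epsilon> * \<sigma> n)<..<\<epsilon> * \<sigma> n}"
    have char: "char \<mu> t = (CLINT \<omega>|M. exp (\<i> * complex_of_real (t * S n \<omega> / \<sigma> n)))" for t
      unfolding char_def \<mu>_def by (subst integral_distr) auto
    have exp: "exp (\<Lambda> 0 t - of_real (t\<^sup>2 / 2)) = char \<mu> t" if "t \<in> ?U" for t using \<Lambda> that unfolding char by blast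
    have chain: "(\<Lambda> k has_vector_derivative \<Lambda> (Suc k) t) (at t)" if "k \<le> m" "t \<in> ?U" for k t using \<Lambda> that by blast
    have high: "norm (\<Lambda> j t) \<le> C0 / \<sigma> n" if "3 \<le> j" "j \<le> Suc m" "t \<in> ?U" for j t using \<Lambda> that by auto
    have "(LINT \<omega>|M. (S n \<omega>)\<^sup>2) = (\<sigma> n)\<^sup>2"
      unfolding \<sigma>_def L2_norm_rv_def by (subst real_sqrt_pow2) (auto intro!: integral_nonneg_AE)
    then have mom: "integrable \<mu> (\<lambda>x. x\<^sup>2)" "(LINT x|\<mu>. x) = 0" "(LINT x|\<mu>. x\<^sup>2) = 1"
      unfolding \<mu>_def using S_L2[OF n] S_centered[OF n] \<sigma>
      by (auto simp: integrable_distr_eq integral_distr power_divide)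
    have U: "open ?U" "0 \<in> ?U" using \<epsilon> \<sigma> by auto
    have "(\<Lambda> k has_vector_derivative \<Lambda> (Suc k) t) (at t)" if "k < 2" "t \<in> ?U" for k t
      using chain[of k t] that m by linarith
    note \<Lambda>12 = cumulant_derivatives_zero[where \<Lambda>=\<Lambda>, OF \<mu> mom U exp this]
    define c where "c = C0 / \<sigma> n"
    have c0: "0 \<le> c" unfolding c_def using C0 \<sigma> by simp
    have sub: "s \<in> ?U" if "\<bar>s\<bar> \<le> \<bar>t\<bar>" "t \<in> ?U" for s t using that by auto
    \<comment> \<open>The bound \<open>c\<close> on the third derivative is integrated from 0 three
      times; the vanishing values there turn it into linear, quadratic and cubic bounds, all still
      proportional to \<open>c\<close>.\<close>
    have low2: "norm (\<Lambda> 2 t) \<le> c * \<bar>t\<bar>" if t: "t \<in> ?U" for t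
    proof (rule norm_le_of_derivative_bound[where f'="\<Lambda> 3"])
      fix s assume s: "\<bar>s\<bar> \<le> \<bar>t\<bar>"
      show "(\<Lambda> 2 has_vector_derivative \<Lambda> 3 s) (at s)" using chain[OF m sub[OF s t]] by simp
      show "norm (\<Lambda> 3 s) \<le> c" using high[OF order_refl _ sub[OF s t]] m unfolding c_def by simp
    qed (rule \<Lambda>12)
    have low1: "norm (\<Lambda> 1 t) \<le> c * \<bar>t\<bar> * \<bar>t\<bar>" if t: "t \<in> ?U" for t
    proof (rule norm_le_of_derivative_bound[where f'="\<Lambda> 2"])
      fix s assume s: "\<bar>s\<bar> \<le> \<bar>t\<bar>"
      show "(\<Lambda> 1 has_vector_derivative \<Lambda> 2 s) (at s)" using chain[OF _ sub[OF s t], of 1] m by (simp add: numeral_2_eq_2)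
      show "norm (\<Lambda> 2 s) \<le> c * \<bar>t\<bar>"
        by (rule order_trans[OF low2[OF sub[OF s t]] mult_left_mono[OF s c0]])
    qed (rule \<Lambda>12)
    have low0: "norm (\<Lambda> 0 t) \<le> c * \<bar>t\<bar> * \<bar>t\<bar> * \<bar>t\<bar>" if t: "t \<in> ?U" for t
    proof (rule norm_le_of_derivative_bound[where f'="\<Lambda> 1"])
      fix s assume s: "\<bar>s\<bar> \<le> \<bar>t\<bar>"
      show "(\<Lambda> 0 has_vector_derivative \<Lambda> 1 s) (at s)" using chain[OF _ sub[OF s t], of 0] by simp
      have "norm (\<Lambda> 1 s) \<le> c * \<bar>s\<bar> * \<bar>s\<bar>" by (rule low1[OF sub[OF s t]])
      also have "\<dots> \<le> c * \<bar>t\<bar> * \<bar>t\<bar>" using s c0 by (intro mult_mono) auto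
      finally show "norm (\<Lambda> 1 s) \<le> c * \<bar>t\<bar> * \<bar>t\<bar>" .
    qed (rule \<Lambda>0)
    have bound: "norm (\<Lambda> k t) \<le> c * (1 + \<bar>t\<bar>) ^ 3" if k: "k \<le> Suc m" and t: "t \<in> ?U" for k t
    proof -
      let ?w = "1 + \<bar>t\<bar>"
      have "1 * 1 * 1 \<le> ?w * ?w * ?w" "1 * 1 * \<bar>t\<bar> \<le> ?w * ?w * ?w" "1 * \<bar>t\<bar> * \<bar>t\<bar> \<le> ?w * ?w * ?w" "\<bar>t\<bar> * \<bar>t\<bar> * \<bar>t\<bar> \<le> ?w * ?w * ?w"
        by (intro mult_mono; simp)+
      from mult_left_mono[OF this(1) c0] mult_left_mono[OF this(2) c0] mult_left_mono[OF this(3) c0] mult_left_mono[OF this(4) c0]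
      have le: "c \<le> c * ?w ^ 3" "c * \<bar>t\<bar> \<le> c * ?w ^ 3" "c * \<bar>t\<bar> * \<bar>t\<bar> \<le> c * ?w ^ 3" "c * \<bar>t\<bar> * \<bar>t\<bar> * \<bar>t\<bar> \<le> c * ?w ^ 3"
        by (simp_all only: power3_eq_cube mult.assoc mult_1_left mult_1_right)
      consider "k = 0" | "k = 1" | "k = 2" | "3 \<le> k" by linarith
      then show ?thesis
      proof cases
        case 1
        with low0[OF t] le show ?thesis by (metis order_trans)
      next
        case 2
        with low1[OF t] le show ?thesis by (metis order_trans)
      next
        case 3
        with low2[OF t] le show ?thesis by (metis order_trans)
      next
        case 4
        from high[OF this k t] le(1) show ?thesis unfolding c_def by linarith
      qed
    qed
    define T where "T = e * \<sigma> n"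
    have T: "0 < T" "e * s0 \<le> T" unfolding T_def using e \<sigma> by (auto intro: mult_left_mono)
    have TU: "{- T..T} \<subseteq> ?U" unfolding T_def using mult_strict_right_mono[OF e(2) \<sigma>(2)] by auto
    have cT: "c * T \<le> 1 / 4" unfolding c_def T_def using e \<sigma> by simp
    let ?\<beta> = "(2 ^ (m + 3) * (c + 1)) ^ Suc m * (2 ^ m * (2 ^ (m + 3)) ^ Suc m) * c"
    have h: "derivs_bounded (Suc m) {- T..T} (\<lambda>t. ?\<beta> * ((1 + \<bar>t\<bar>) ^ (4 * m + 7) * exp (- t\<^sup>2 / 4)))
      (\<lambda>t. char \<mu> t - of_real (exp (- t\<^sup>2 / 2)))"
    proof (rule derivs_bounded_char_diff)
      fix t assume t: "t \<in> {- T..T}"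
      then have tU: "t \<in> ?U" using TU by blast
      show "char \<mu> t = exp (\<Lambda> 0 t - of_real (t\<^sup>2 / 2))" using exp[OF tU] ..
      show "(\<Lambda> k has_vector_derivative \<Lambda> (Suc k) t) (at t within {- T..T})" if "k \<le> m" for k
        by (rule has_vector_derivative_at_within[OF chain[OF that tU]])
      show "norm (\<Lambda> k t) \<le> c * (1 + \<bar>t\<bar>) ^ 3" if "k \<le> Suc m" for k by (rule bound[OF that tU])
      have "\<bar>t\<bar> \<le> T" using t by auto
      have "c * \<bar>t\<bar> * (\<bar>t\<bar> * \<bar>t\<bar>) \<le> c * T * (\<bar>t\<bar> * \<bar>t\<bar>)"
        using \<open>\<bar>t\<bar> \<le> T\<close> c0 by (intro mult_right_mono mult_left_mono) auto
      also have "\<dots> \<le> 1 / 4 * (\<bar>t\<bar> * \<bar>t\<bar>)" by (intro mult_right_mono cT) auto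
      finally show "norm (\<Lambda> 0 t) \<le> t\<^sup>2 / 4" using low0[OF tU] by (simp add: power2_eq_square mult.assoc)
    qed (rule c0)
    \<comment> \<open>The power of \<open>c + 1\<close> in \<open>?\<beta>\<close> is replaced by a
      constant, so that only the linear factor \<open>c = C0 / \<sigma> n\<close> survives.\<close>
    have "c \<le> b0" unfolding c_def b0_def using \<sigma> C0 s0 by (intro divide_left_mono) auto
    then have "?\<beta> \<le> K * c" unfolding K_def using c0 by (intro mult_right_mono power_mono mult_left_mono) auto
    then have "C1 * (?\<beta> + 1 / T) \<le> C1 * (K * c + 1 / T)" using C1(1) by (intro mult_left_mono add_mono) auto
    also have "\<dots> = C1 * (K * C0 + 1 / e) / \<sigma> n" unfolding c_def T_def using e \<sigma> by (simp add: field_simps)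
    finally show ?thesis using C1(2)[OF \<mu> T(2) h, of x] unfolding \<mu>_def by linarith
  qed
  have "0 \<le> C1 * (K * C0 + 1 / e)" using C1(1) K0 C0 e by simp
  with main show ?thesis unfolding \<sigma>_def by blast
qed

section \<open>From the normalised variables to \<open>W\<close>, and the integrated bound\<close>

lemma eventually_le_imp_bounded:
  fixes f :: "nat \<Rightarrow> real"
  assumes "\<forall>\<^sub>F n in sequentially. f n \<le> c"
  shows "\<exists>C. \<forall>n. f n \<le> C"
proof -
  obtain N where N: "\<And>n. N \<le> n \<Longrightarrow> f n \<le> c" using assms unfolding eventually_sequentially by blast
  have "f n \<le> max c (Max (f ` {..N}))" for n
  proof (cases "N \<le> n")
    case True
    then show ?thesis using N by (simp add: max.coboundedI1)
  next
    case False
    then have "f n \<le> Max (f ` {..N})" by (intro Max_ge) auto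
    then show ?thesis by simp
  qed
  then show ?thesis by blast
qed

lemma integrable_one_plus_abs_powr:
  assumes "1 < s"
  shows "integrable lborel (\<lambda>x::real. (1 + \<bar>x\<bar>) powr - s)"
proof -
  let ?h = "\<lambda>x::real. indicator {0..} x * (1 + \<bar>x\<bar>) powr - s"
  have h: "integrable lborel ?h"
  proof (rule integrableI_nonneg)
    have "(\<integral>\<^sup>+ x. ennreal ((1 + x) powr - s) * indicator {0..} x \<partial>lborel) = ennreal (0 - (1 + 0) powr (1 - s) / (1 - s))"
    proof (rule nn_integral_FTC_atLeast)
      fix x :: real assume "0 \<le> x"
      then show "((\<lambda>x. (1 + x) powr (1 - s) / (1 - s)) has_real_derivative (1 + x) powr - s) (at x)"
        using assms by (auto intro!: derivative_eq_intros)
    next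
      have "filterlim (\<lambda>x::real. 1 + x) at_top at_top"
        by (intro filterlim_tendsto_add_at_top[OF tendsto_const] filterlim_ident)
      then have "((\<lambda>x::real. (1 + x) powr (1 - s)) \<longlongrightarrow> 0) at_top"
        using assms by (intro tendsto_neg_powr) auto
      from tendsto_divide[OF this tendsto_const[of "1 - s"]] assms
      show "((\<lambda>x. (1 + x) powr (1 - s) / (1 - s)) \<longlongrightarrow> 0) at_top" by simp
    qed auto
    also have "(\<integral>\<^sup>+ x. ennreal ((1 + x) powr - s) * indicator {0..} x \<partial>lborel) = (\<integral>\<^sup>+ x. ennreal (?h x) \<partial>lborel)"
      by (intro nn_integral_cong) (auto split: split_indicator)
    finally show "(\<integral>\<^sup>+ x. ennreal (?h x) \<partial>lborel) < \<infinity>" by simp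
  qed auto
  have "integrable lborel (\<lambda>x. ?h x + ?h (0 + - 1 * x))"
    by (intro Bochner_Integration.integrable_add h) (subst lborel_integrable_real_affine_iff[of "- 1" ?h 0], use h in auto)
  then show ?thesis
    by (rule Bochner_Integration.integrable_bound) (auto split: split_indicator)
qed

theorem theorem5:
  fixes M :: "'a measure"
    and S :: "nat \<Rightarrow> 'a \<Rightarrow> real"
    and A B \<sigma> :: "nat \<Rightarrow> real"
    and W :: "nat \<Rightarrow> 'a \<Rightarrow> real"
    and F :: "nat \<Rightarrow> real \<Rightarrow> real"
    and m :: nat
  assumes "prob_space M"
    and S_meas: "\<And>n. n \<ge> 1 \<Longrightarrow> S n \<in> borel_measurable M"
    and S_L2: "\<And>n. n \<ge> 1 \<Longrightarrow> integrable M (\<lambda>\<omega>. (S n \<omega>)\<^sup>2)"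
    and S_centered: "\<And>n. n \<ge> 1 \<Longrightarrow> (LINT \<omega>|M. S n \<omega>) = 0"
    and sigma_def: "\<And>n. \<sigma> n = L2_norm_rv M (S n)"
    and sigma_pos: "\<And>n. n \<ge> 1 \<Longrightarrow> \<sigma> n > 0"
    and sigma_lim: "filterlim \<sigma> at_top sequentially"
    and A_bounded: "bounded (A ` {1..})"
    and B_pos: "\<And>n. n \<ge> 1 \<Longrightarrow> B n > 0"
    and B_sigma: "(\<lambda>n. B n - \<sigma> n) \<in> O(\<lambda>_. 1)"
    and W_def: "\<And>n \<omega>. W n \<omega> = (S n \<omega> - A n) / B n"
    and F_def: "\<And>n x. F n x = measure M {\<omega> \<in> space M. W n \<omega> \<le> x}"
    and m_ge_2: "m \<ge> 2"
    and growth: "growth_condition M S m"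
  shows "(\<exists>C. \<forall>n\<ge>1. \<forall>x. \<bar>F n x - Phi x\<bar> \<le> C * inverse (\<sigma> n) * inverse ((1 + \<bar>x\<bar>) ^ m)) \<and>
         (\<forall>p > 1 / real m.
            (\<forall>n\<ge>1. integrable lborel (\<lambda>x. \<bar>F n x - Phi x\<bar> powr p)) \<and>
            (\<lambda>n. (LINT x|lborel. \<bar>F n x - Phi x\<bar> powr p) powr (1 / p)) \<in> O(\<lambda>n. inverse (\<sigma> n)))"
proof -
  interpret prob_space M by fact
  obtain a where a: "0 \<le> a" "\<And>n. 1 \<le> n \<Longrightarrow> \<bar>A n\<bar> \<le> a"
    using A_bounded unfolding bounded_iff by (metis abs_ge_zero atLeast_iff imageI order_refl order_trans real_norm_def)
  obtain b' where b': "\<forall>\<^sub>F n in sequentially. \<bar>B n - \<sigma> n\<bar> \<le> b'"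
    using B_sigma by (elim landau_o.bigE) simp
  from eventually_le_imp_bounded[OF this] obtain b where b: "\<And>n. \<bar>B n - \<sigma> n\<bar> \<le> b" by blast
  have b0: "0 \<le> b" using b[of 0] by linarith
  \<comment> \<open>The limit of \<open>\<sigma>\<close> bounds \<open>1 / \<sigma> n\<close> only
    eventually; the finitely many other indices are absorbed into the constant. Its reciprocal
    becomes the uniform lower bound \<open>s0\<close>.\<close>
  obtain q where q: "\<And>n. 1 \<le> n \<Longrightarrow> 1 / \<sigma> n \<le> q"
  proof -
    have "\<forall>\<^sub>F n in sequentially. 1 \<le> \<sigma> n" using sigma_lim unfolding filterlim_at_top by blast
    then have "\<forall>\<^sub>F n in sequentially. 1 / \<sigma> n \<le> 1" by eventually_elim auto
    from eventually_le_imp_bounded[OF this] show thesis using that by blast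
  qed
  obtain r where r: "1 \<le> r" "\<And>n. 1 \<le> n \<Longrightarrow> \<sigma> n / B n \<le> r"
  proof -
    have "\<forall>\<^sub>F n in sequentially. max 1 (2 * b) \<le> \<sigma> n" using sigma_lim unfolding filterlim_at_top by blast
    then have "\<forall>\<^sub>F n in sequentially. \<sigma> n / B n \<le> 2"
    proof eventually_elim
      case (elim n)
      then have "\<sigma> n \<le> 2 * B n" "0 < B n" using b[of n] by linarith+
      then show ?case by (simp add: pos_divide_le_eq)
    qed
    from eventually_le_imp_bounded[OF this] obtain r' where "\<And>n. \<sigma> n / B n \<le> r'" by blast
    then show thesis by (intro that[of "max 1 r'"]) (auto simp: max.coboundedI2)
  qed
  have q0: "0 < q" using q[of 1] sigma_pos[of 1] by (auto intro: less_le_trans[rotated])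
  have s0: "0 < 1 / q" "\<And>n. 1 \<le> n \<Longrightarrow> 1 / q \<le> L2_norm_rv M (S n)"
    using q q0 sigma_pos unfolding sigma_def[symmetric] by (auto simp: field_simps)
  from nonuniform_bound_normalized[OF S_meas S_L2 S_centered s0 m_ge_2 growth, folded sigma_def]
  obtain C0 where C0: "0 \<le> C0" "\<And>n x. 1 \<le> n \<Longrightarrow>
      \<bar>cdf (distr M borel (\<lambda>\<omega>. S n \<omega> / \<sigma> n)) x - Phi x\<bar> * (1 + \<bar>x\<bar>) ^ m \<le> C0 / \<sigma> n"
    by blast
  \<comment> \<open>One power more than \<open>m\<close>: the shift from \<open>x\<close> to
    \<open>y\<close> below may grow linearly in \<open>\<bar>x\<bar>\<close>, and the extra decay of
    the density compensates for it.\<close>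
  obtain K where K: "0 < K" "\<And>z. std_normal_density z * (1 + \<bar>z\<bar>) ^ Suc m \<le> K"
    using std_normal_density_decay by blast
  define H where "H = 1 + r + r * (a * q)"
  have H: "1 \<le> H" unfolding H_def using r a q0 by simp
  define C where "C = C0 * H ^ m + K * H ^ Suc m * (a + b)"
  have C: "0 \<le> C" unfolding C_def using C0 K H a b0 by simp
  have main: "\<bar>F n x - Phi x\<bar> \<le> C * inverse (\<sigma> n) * inverse ((1 + \<bar>x\<bar>) ^ m)" if n: "1 \<le> n" for n x
  proof -
    note [measurable] = S_meas[OF n]
    have \<sigma>: "0 < \<sigma> n" and B: "0 < B n" using sigma_pos[OF n] B_pos[OF n] by auto
    \<comment> \<open>The threshold for \<open>S n / \<sigma> n\<close> equivalent to
      \<open>x\<close> for \<open>W n\<close>. The error splits into \<open>F n x - Phi y\<close>,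
      known from the normalised bound at \<open>y\<close>, and \<open>Phi y - Phi x\<close>; these
      give the two summands of \<open>C\<close>.\<close>
    define y where "y = (B n * x + A n) / \<sigma> n"
    have "W n \<omega> \<le> x \<longleftrightarrow> S n \<omega> / \<sigma> n \<le> y" for \<omega>
      unfolding W_def y_def using \<sigma> B by (simp add: divide_le_cancel pos_divide_le_eq algebra_simps)
    then have F_eq: "F n x = cdf (distr M borel (\<lambda>\<omega>. S n \<omega> / \<sigma> n)) y"
      unfolding F_def cdf_def by (subst measure_distr) (auto simp: vimage_def Int_def intro!: arg_cong[where f="measure M"])
    have Aq: "\<bar>A n / \<sigma> n\<bar> \<le> a * q"
    proof -
      have "\<bar>A n / \<sigma> n\<bar> = \<bar>A n\<bar> * (1 / \<sigma> n)" using \<sigma> by simp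
      also have "\<dots> \<le> a * q" using a(2)[OF n] q[OF n] a(1) \<sigma> by (intro mult_mono) auto
      finally show ?thesis .
    qed
    define \<rho> where "\<rho> = B n / \<sigma> n"
    have scale: "\<bar>u\<bar> \<le> r * (\<rho> * \<bar>u\<bar>)" for u
    proof -
      have "1 \<le> r * \<rho>" unfolding \<rho>_def using r(2)[OF n] \<sigma> B by (simp add: field_simps)
      from mult_right_mono[OF this, of "\<bar>u\<bar>"] show ?thesis by (simp add: mult.assoc)
    qed
    \<comment> \<open>A point \<open>z\<close> between \<open>x\<close> and \<open>y\<close> lies
      beyond one of them in the direction of the sign of \<open>x\<close>. Since \<open>y\<close> is
      \<open>\<rho> * x\<close> moved by at most \<open>a * q\<close>, and
      \<open>1 / \<rho> \<le> r\<close>, either case bounds \<open>\<bar>x\<bar>\<close> by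
      \<open>r * (\<bar>z\<bar> + a * q)\<close>. So \<open>H\<close> compares the weights at
      \<open>x\<close> with those at \<open>y\<close> and at every point between.\<close>
    have near: "1 + \<bar>x\<bar> \<le> H * (1 + \<bar>z\<bar>)" if z: "min x y \<le> z" "z \<le> max x y" for z
    proof -
      have y: "y = \<rho> * x + A n / \<sigma> n" unfolding y_def \<rho>_def by (simp add: add_divide_distrib)
      have aq: "0 \<le> a * q" using a q0 by simp
      have "\<bar>x\<bar> \<le> r * (\<bar>z\<bar> + a * q)"
      proof (cases "0 \<le> x")
        case True
        have "z \<ge> x \<or> z \<ge> y" using z by linarith
        then show ?thesis
        proof
          assume "z \<ge> x"
          then have "1 * \<bar>x\<bar> \<le> r * (\<bar>z\<bar> + a * q)" using True r aq by (intro mult_mono) auto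
          then show ?thesis by simp
        next
          assume "z \<ge> y"
          moreover have "\<rho> * \<bar>x\<bar> = (\<rho> * x)" using True by simp
          ultimately have "\<rho> * \<bar>x\<bar> \<le> \<bar>z\<bar> + a * q" using y Aq by linarith
          then have "r * (\<rho> * \<bar>x\<bar>) \<le> r * (\<bar>z\<bar> + a * q)" using r by (intro mult_left_mono) auto
          then show ?thesis using scale[of x] by linarith
        qed
      next
        case False
        have "z \<le> x \<or> z \<le> y" using z by linarith
        then show ?thesis
        proof
          assume "z \<le> x"
          then have "1 * \<bar>x\<bar> \<le> r * (\<bar>z\<bar> + a * q)" using False r aq by (intro mult_mono) auto
          then show ?thesis by simp
        next
          assume "z \<le> y"
          moreover have "\<rho> * \<bar>x\<bar> = - (\<rho> * x)" using False by simp
          ultimately have "\<rho> * \<bar>x\<bar> \<le> \<bar>z\<bar> + a * q" using y Aq by linarith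
          then have "r * (\<rho> * \<bar>x\<bar>) \<le> r * (\<bar>z\<bar> + a * q)" using r by (intro mult_left_mono) auto
          then show ?thesis using scale[of x] by linarith
        qed
      qed
      moreover have "H * (1 + \<bar>z\<bar>) = 1 + r + r * (a * q) + \<bar>z\<bar> + r * \<bar>z\<bar> + r * (a * q) * \<bar>z\<bar>"
        unfolding H_def by (simp add: algebra_simps)
      moreover have "0 \<le> r * (a * q) * \<bar>z\<bar>" using r aq by simp
      moreover have "r * (\<bar>z\<bar> + a * q) = r * \<bar>z\<bar> + r * (a * q)" by (rule distrib_left)
      ultimately show ?thesis using r(1) abs_ge_zero[of z] by linarith
    qed
    have P: "0 < (1 + \<bar>u\<bar>) ^ k" for u :: real and k by (intro zero_less_power) auto
    have "\<bar>cdf (distr M borel (\<lambda>\<omega>. S n \<omega> / \<sigma> n)) y - Phi y\<bar> * (1 + \<bar>x\<bar>) ^ m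
        \<le> \<bar>cdf (distr M borel (\<lambda>\<omega>. S n \<omega> / \<sigma> n)) y - Phi y\<bar> * (H * (1 + \<bar>y\<bar>)) ^ m"
      by (intro mult_left_mono power_mono near) auto
    also have "\<dots> = \<bar>cdf (distr M borel (\<lambda>\<omega>. S n \<omega> / \<sigma> n)) y - Phi y\<bar> * (1 + \<bar>y\<bar>) ^ m * H ^ m"
      by (simp add: power_mult_distrib)
    also have "\<dots> \<le> C0 / \<sigma> n * H ^ m" using C0(2)[OF n, of y] H by (intro mult_right_mono) auto
    finally have 1: "\<bar>F n x - Phi y\<bar> * (1 + \<bar>x\<bar>) ^ m \<le> C0 / \<sigma> n * H ^ m" unfolding F_eq .
    have dens: "std_normal_density z \<le> K * H ^ Suc m / (1 + \<bar>x\<bar>) ^ Suc m" if z: "min x y \<le> z" "z \<le> max x y" for z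
    proof -
      have "std_normal_density z * (1 + \<bar>x\<bar>) ^ Suc m \<le> std_normal_density z * (H * (1 + \<bar>z\<bar>)) ^ Suc m"
        by (intro mult_left_mono power_mono near z) auto
      also have "\<dots> = std_normal_density z * (1 + \<bar>z\<bar>) ^ Suc m * H ^ Suc m"
        by (simp only: power_mult_distrib mult_ac)
      also have "\<dots> \<le> K * H ^ Suc m" using K(2)[of z] H by (intro mult_right_mono) auto
      finally show ?thesis using P[of x "Suc m"] by (simp only: pos_le_divide_eq)
    qed
    have dist: "\<bar>y - x\<bar> \<le> (a + b) * (1 + \<bar>x\<bar>) / \<sigma> n"
    proof -
      have "y - x = ((B n - \<sigma> n) * x + A n) / \<sigma> n" unfolding y_def using \<sigma> by (simp add: field_simps)
      then have "\<bar>y - x\<bar> = \<bar>(B n - \<sigma> n) * x + A n\<bar> / \<sigma> n" using \<sigma> by simp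
      also have "\<bar>(B n - \<sigma> n) * x + A n\<bar> \<le> b * \<bar>x\<bar> + a"
        using b[of n] a(2)[OF n] by (intro order_trans[OF abs_triangle_ineq] add_mono) (auto simp: abs_mult mult_right_mono)
      also have "\<dots> \<le> (a + b) * (1 + \<bar>x\<bar>)" using a b0 by (simp add: algebra_simps)
      finally show ?thesis using \<sigma> by (simp add: divide_right_mono)
    qed
    have "\<bar>Phi y - Phi x\<bar> \<le> K * H ^ Suc m / (1 + \<bar>x\<bar>) ^ Suc m * \<bar>y - x\<bar>" by (rule Phi_diff_le[OF dens])
    also have "\<dots> \<le> K * H ^ Suc m / (1 + \<bar>x\<bar>) ^ Suc m * ((a + b) * (1 + \<bar>x\<bar>) / \<sigma> n)"
      using dist K H by (intro mult_left_mono) auto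
    also have "\<dots> = K * H ^ Suc m * (a + b) / \<sigma> n / (1 + \<bar>x\<bar>) ^ m"
    proof -
      have "1 + \<bar>x\<bar> \<noteq> 0" by linarith
      then show ?thesis by (simp del: power_Suc add: power_Suc[of "1 + \<bar>x\<bar>"] mult_ac)
    qed
    finally have 2: "\<bar>Phi y - Phi x\<bar> * (1 + \<bar>x\<bar>) ^ m \<le> K * H ^ Suc m * (a + b) / \<sigma> n"
      using P[of x m] by (simp only: pos_le_divide_eq)
    have "\<bar>F n x - Phi x\<bar> * (1 + \<bar>x\<bar>) ^ m \<le> (\<bar>F n x - Phi y\<bar> + \<bar>Phi y - Phi x\<bar>) * (1 + \<bar>x\<bar>) ^ m"
      by (intro mult_right_mono) auto
    also have "\<dots> \<le> C0 / \<sigma> n * H ^ m + K * H ^ Suc m * (a + b) / \<sigma> n" using 1 2 by (simp only: distrib_right)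
    also have "\<dots> = C * inverse (\<sigma> n)" unfolding C_def by (simp add: divide_inverse algebra_simps)
    finally show ?thesis using P[of x m] by (simp only: pos_le_divide_eq[symmetric] divide_inverse)
  qed
  have powr_bound: "integrable lborel (\<lambda>x. \<bar>F n x - Phi x\<bar> powr p) \<and>
      (LINT x|lborel. \<bar>F n x - Phi x\<bar> powr p) powr (1 / p) \<le> C * inverse (\<sigma> n) * (LINT x|lborel. (1 + \<bar>x::real\<bar>) powr - (real m * p)) powr (1 / p)"
    if p: "1 / real m < p" and n: "1 \<le> n" for p n
  proof -
    have \<sigma>: "0 < \<sigma> n" using sigma_pos[OF n] .
    have p0: "0 < p" using p m_ge_2 by (intro less_trans[OF _ p]) auto
    \<comment> \<open>The condition on \<open>p\<close> is exactly that
      \<open>(1 + \<bar>x\<bar>) powr - (m * p)\<close> is integrable. The pointwise bound is raised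
      to the power \<open>p\<close> before integrating, so exponents below 1 are covered
      too.\<close>
    have mp: "1 < real m * p" using p m_ge_2 by (simp add: field_simps)
    let ?g = "\<lambda>x::real. (1 + \<bar>x\<bar>) powr - (real m * p)" and ?c = "(C * inverse (\<sigma> n)) powr p"
    have g: "integrable lborel (\<lambda>x. ?c * ?g x)" by (intro integrable_mult_right integrable_one_plus_abs_powr mp)
    note [measurable] = S_meas[OF n]
    interpret \<nu>: real_distribution std_normal_distribution by (rule real_dist_normal_dist)
    have "mono (F n)" unfolding F_def W_def by (intro monoI finite_measure_mono) auto
    then have [measurable]: "F n \<in> borel_measurable borel" by (rule borel_measurable_mono)
    have "mono Phi" unfolding Phi_def by (intro monoI \<nu>.cdf_nondecreasing)
    then have [measurable]: "Phi \<in> borel_measurable borel" by (rule borel_measurable_mono)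
    have le: "\<bar>F n x - Phi x\<bar> powr p \<le> ?c * ?g x" for x
    proof -
      have "\<bar>F n x - Phi x\<bar> powr p \<le> (C * inverse (\<sigma> n) * inverse ((1 + \<bar>x\<bar>) ^ m)) powr p"
        using main[OF n] p0 by (intro powr_mono2) auto
      also have "\<dots> = ?c * (inverse ((1 + \<bar>x\<bar>) ^ m)) powr p" by (rule powr_mult)
      also have "inverse ((1 + \<bar>x\<bar>) ^ m) powr p = ?g x"
      proof -
        have "0 < 1 + \<bar>x\<bar>" by linarith
        then show ?thesis by (simp add: powr_realpow[symmetric] powr_minus[symmetric] powr_powr)
      qed
      finally show ?thesis .
    qed
    have int: "integrable lborel (\<lambda>x. \<bar>F n x - Phi x\<bar> powr p)"
      by (rule Bochner_Integration.integrable_bound[OF g]) (measurable, use le in \<open>auto intro: order_trans[OF _ abs_ge_self]\<close>)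
    have "(LINT x|lborel. \<bar>F n x - Phi x\<bar> powr p) \<le> (LINT x|lborel. ?c * ?g x)"
      by (intro integral_mono int g le)
    then have "(LINT x|lborel. \<bar>F n x - Phi x\<bar> powr p) \<le> ?c * (LINT x|lborel. ?g x)" by simp
    then have "(LINT x|lborel. \<bar>F n x - Phi x\<bar> powr p) powr (1 / p) \<le> (?c * (LINT x|lborel. ?g x)) powr (1 / p)"
      using p0 by (intro powr_mono2 integral_nonneg_AE) auto
    also have "\<dots> = ?c powr (1 / p) * (LINT x|lborel. ?g x) powr (1 / p)"
      by (rule powr_mult)
    also have "?c powr (1 / p) = C * inverse (\<sigma> n)" using p0 C \<sigma> by (simp add: powr_powr)
    finally show ?thesis using int by blast
  qed
  show ?thesis
  proof (intro conjI allI impI)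
    show "\<exists>C. \<forall>n\<ge>1. \<forall>x. \<bar>F n x - Phi x\<bar> \<le> C * inverse (\<sigma> n) * inverse ((1 + \<bar>x\<bar>) ^ m)" using main by blast
    fix p assume p: "1 / real m < p"
    show "integrable lborel (\<lambda>x. \<bar>F n x - Phi x\<bar> powr p)" if "1 \<le> n" for n using powr_bound[OF p that] by blast
    show "(\<lambda>n. (LINT x|lborel. \<bar>F n x - Phi x\<bar> powr p) powr (1 / p)) \<in> O(\<lambda>n. inverse (\<sigma> n))"
    proof (intro bigoI eventually_sequentiallyI)
      fix n :: nat assume n: "1 \<le> n"
      show "norm ((LINT x|lborel. \<bar>F n x - Phi x\<bar> powr p) powr (1 / p)) \<le>
          (C * (LINT x|lborel. (1 + \<bar>x::real\<bar>) powr - (real m * p)) powr (1 / p)) * norm (inverse (\<sigma> n))"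
        using powr_bound[OF p n] sigma_pos[OF n] by (simp add: mult_ac)
    qed
  qed
qed

end
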